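(* Let $\mathbb K$ be a field of characteristic zero. Let $\mathfrak L=(\widehat{\mathbb L}(a,b,z),\partial)$ be the Lawrence-Sullivan construction, and let $\widehat{\mathrm{Cyl}}\,T(u)=(\widehat T(u\oplus u'\oplus su),D)$, where $u,u'$ have degree $-1$, $su$ has degree $0$, and $D$ is the degree $-1$ (continuous) derivation determined by $Du=-u\otimes u$, $Du'=-u'\otimes u'$ and $$ D(su)= su\otimes u'-u'\otimes su+ \sum_{n\ge 0}\ \sum_{p+q=n}(-1)^q\frac{B_{n}}{p!\,q!}\,su^{\otimes p}\otimes(u'-u)\otimes su^{\otimes q}. $$ Then $D$ is a differential (that is, $D\circ D=0$), and the universal enveloping algebra $U\mathfrak L$ is isomorphic, as a differential graded algebra, to $\widehat{\mathrm{Cyl}}\,T(u)$.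
   Context: All graded objects are $\mathbb Z$-graded over a field $\mathbb K$ of characteristic zero; differentials have degree $-1$. For a graded vector space $V$, $T(V)=\bigoplus_{n\ge 0}T^n(V)$ is the tensor algebra and $\widehat T(V)=\prod_{n\ge0}T^n(V)$ is the complete tensor algebra; its elements are formal series $\sum_{n\ge0}\phi_n$ with $\phi_n\in T^n(V)$. The free Lie algebra $\mathbb L(V)$ is the graded Lie subalgebra of $T(V)$ (with graded commutator bracket) generated by $V$. The complete free Lie algebra $\widehat{\mathbb L}(V)$ is its analogue in $\widehat T(V)$: formal series $\sum_{n\geq 1}\phi_n$ with $\phi_n\in \mathbb L(V)\cap T^n(V)$. The universal enveloping algebra is extended to complete free Lie algebras in the completed sense, so that $U\widehat{\mathbb L}(V)$ is a graded algebra naturally isomorphic to $\widehat T(V)$. If $\widehat{\mathbb L}(V)$ carries a differential, $U\widehat{\mathbb L}(V)$ carries the induced one, i.e. the (continuous) derivation extending it. $B_n$ denotes the $n$-th Bernoulli number, $\frac{x}{e^x-1}=\sum_{n\ge0}\frac{B_n}{n!}x^n$ (so $B_1=-\frac12$), and $\mathrm{ad}_z(w)=[z,w]$. The Lawrence-Sullivan construction $\mathfrak L=(\widehat{\mathbb L}(a,b,z),\partial)$ is the complete free differential graded Lie algebra on $a,b$ of degree $-1$ and $z$ of degree $0$, with $$\partial a=-\tfrac12[a,a],\qquad \partial b=-\tfrac12[b,b],\qquad \partial z=[z,b]+\sum_{i=0}^\infty\frac{B_i}{i!}\mathrm{ad}_z^i(b-a).$$ *)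

theory Defs
  imports
    "HOL-Algebra.Algebra"
    "HOL-Algebra.Algebraic_Closure_Type"
    "HOL-Computational_Algebra.Formal_Power_Series"
    "HOL-Library.Groups_Big_Fun"
begin

section \<open>Noncommutative formal power series\<close>

text \<open>
  A formal series over the letters \<open>'g\<close> is a family of coefficients indexed by words. If \<open>'g\<close> is
  finite and \<open>V\<close> is the vector space with basis \<open>'g\<close>, the words of length \<open>n\<close> are a basis of the
  \<open>n\<close>-fold tensor power of \<open>V\<close>, so that these series are exactly the elements of the complete tensor
  algebra of \<open>V\<close> (the product over all \<open>n\<close>). For arbitrary \<open>'g\<close>, the finitely supported series form
  the free unital associative algebra on \<open>'g\<close>.
\<close>

typedef ('g, 'k) ncs = "UNIV :: ('g list \<Rightarrow> 'k) set"
  morphisms nc_coeff Ncs by simp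

setup_lifting type_definition_ncs

definition splits :: "'g list \<Rightarrow> ('g list \<times> 'g list) set" where
  "splits w = {(u, v). u @ v = w}"

lemma splits_eq: "splits w = (\<lambda>i. (take i w, drop i w)) ` {..length w}"
proof
  show "splits w \<subseteq> (\<lambda>i. (take i w, drop i w)) ` {..length w}"
  proof
    fix p assume "p \<in> splits w"
    then obtain u v where "p = (u, v)" "u @ v = w" by (auto simp: splits_def)
    then show "p \<in> (\<lambda>i. (take i w, drop i w)) ` {..length w}"
      by (intro image_eqI[where x = "length u"]) auto
  qed
qed (auto simp: splits_def)

lemma finite_splits [simp]: "finite (splits w)"
  by (simp add: splits_eq)

lemma sum_splits_only:
  fixes f :: "'g list \<Rightarrow> 'g list \<Rightarrow> 'a::comm_monoid_add"
  assumes "p \<in> splits w" "\<And>u v. (u, v) \<in> splits w \<Longrightarrow> (u, v) \<noteq> p \<Longrightarrow> f u v = 0"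
  shows "(\<Sum>(u, v)\<in>splits w. f u v) = f (fst p) (snd p)"
proof -
  have "(\<Sum>(u, v)\<in>splits w. f u v) = (\<Sum>(u, v)\<in>{p}. f u v)"
    using assms by (intro sum.mono_neutral_right) auto
  then show ?thesis by (simp add: case_prod_beta)
qed

lemma sum_splits_assoc:
  fixes f :: "'g list \<Rightarrow> 'g list \<Rightarrow> 'g list \<Rightarrow> 'a::comm_monoid_add"
  shows "(\<Sum>(x, v)\<in>splits w. \<Sum>(u, t)\<in>splits x. f u t v)
       = (\<Sum>(u, y)\<in>splits w. \<Sum>(t, v)\<in>splits y. f u t v)"
proof -
  have "(\<Sum>(x, v)\<in>splits w. \<Sum>(u, t)\<in>splits x. f u t v)
      = (\<Sum>(p, q)\<in>Sigma (splits w) (\<lambda>p. splits (fst p)). f (fst q) (snd q) (snd p))"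
    by (subst sum.Sigma[symmetric]) (simp_all add: case_prod_beta)
  also have "\<dots> = (\<Sum>(p, q)\<in>Sigma (splits w) (\<lambda>p. splits (snd p)). f (fst p) (fst q) (snd q))"
    by (rule sum.reindex_bij_witness[of _
          "\<lambda>(p, q). ((fst p @ fst q, snd q), (fst p, fst q))"
          "\<lambda>(p, q). ((fst q, snd q @ snd p), (snd q, snd p))"])
       (auto simp: splits_def)
  also have "\<dots> = (\<Sum>(u, y)\<in>splits w. \<Sum>(t, v)\<in>splits y. f u t v)"
    by (subst sum.Sigma[symmetric]) (simp_all add: case_prod_beta)
  finally show ?thesis .
qed

instantiation ncs :: (type, ring_1) ring_1
begin

lift_definition zero_ncs :: "('a, 'b) ncs" is "\<lambda>_. 0" .
lift_definition one_ncs :: "('a, 'b) ncs" is "\<lambda>w. if w = [] then 1 else 0" .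
lift_definition plus_ncs :: "('a, 'b) ncs \<Rightarrow> ('a, 'b) ncs \<Rightarrow> ('a, 'b) ncs"
  is "\<lambda>f g w. f w + g w" .
lift_definition minus_ncs :: "('a, 'b) ncs \<Rightarrow> ('a, 'b) ncs \<Rightarrow> ('a, 'b) ncs"
  is "\<lambda>f g w. f w - g w" .
lift_definition uminus_ncs :: "('a, 'b) ncs \<Rightarrow> ('a, 'b) ncs"
  is "\<lambda>f w. - f w" .
lift_definition times_ncs :: "('a, 'b) ncs \<Rightarrow> ('a, 'b) ncs \<Rightarrow> ('a, 'b) ncs"
  is "\<lambda>f g w. \<Sum>(u, v)\<in>splits w. f u * g v" .

instance
proof
  fix a b c :: "('a, 'b) ncs"
  show "a + b + c = a + (b + c)" by transfer (simp add: add.assoc)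
  show "a + b = b + a" by transfer (simp add: add.commute)
  show "0 + a = a" by transfer simp
  show "- a + a = 0" by transfer simp
  show "a - b = a + - b" by transfer simp
  show "(0::('a, 'b) ncs) \<noteq> 1" by transfer (auto simp: fun_eq_iff)
  show "(a + b) * c = a * c + b * c"
    by transfer (simp add: case_prod_beta distrib_right sum.distrib)
  show "a * (b + c) = a * b + a * c"
    by transfer (simp add: case_prod_beta distrib_left sum.distrib)
  show "1 * a = a"
  proof (transfer, rule ext)
    fix a :: "'a list \<Rightarrow> 'b" and w
    show "(\<Sum>(u, v)\<in>splits w. (if u = [] then 1 else 0) * a v) = a w"
      by (subst sum_splits_only[where p = "([], w)"]) (auto simp: splits_def)
  qed
  show "a * 1 = a"
  proof (transfer, rule ext)
    fix a :: "'a list \<Rightarrow> 'b" and w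
    show "(\<Sum>(u, v)\<in>splits w. a u * (if v = [] then 1 else 0)) = a w"
      by (subst sum_splits_only[where p = "(w, [])"]) (auto simp: splits_def)
  qed
  show "a * b * c = a * (b * c)"
  proof (transfer, rule ext)
    fix a b c :: "'a list \<Rightarrow> 'b" and w
    show "(\<Sum>(x, v)\<in>splits w. (\<Sum>(u, t)\<in>splits x. a u * b t) * c v)
        = (\<Sum>(u, y)\<in>splits w. a u * (\<Sum>(t, v)\<in>splits y. b t * c v))"
      using sum_splits_assoc[of "\<lambda>u t v. a u * b t * c v" w]
      by (simp add: sum_distrib_left sum_distrib_right case_prod_beta mult.assoc)
  qed
qed

end

lift_definition scal :: "'k::ring_1 \<Rightarrow> ('g, 'k) ncs \<Rightarrow> ('g, 'k) ncs"
  is "\<lambda>c f w. c * f w" .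

lift_definition word :: "'g list \<Rightarrow> ('g, 'k::ring_1) ncs"
  is "\<lambda>v w. if w = v then 1 else 0" .

abbreviation gen :: "'g \<Rightarrow> ('g, 'k::ring_1) ncs" where
  "gen g \<equiv> word [g]"

text \<open>The sum of a sequence of series in which every word occurs only finitely often.\<close>

lift_definition formal_sum :: "(nat \<Rightarrow> ('g, 'k::ring_1) ncs) \<Rightarrow> ('g, 'k) ncs"
  is "\<lambda>F w. Sum_any (\<lambda>n. F n w)" .

definition word_deg :: "('g \<Rightarrow> int) \<Rightarrow> 'g list \<Rightarrow> int" where
  "word_deg dg w = sum_list (map dg w)"

definition homogeneous :: "('g \<Rightarrow> int) \<Rightarrow> int \<Rightarrow> ('g, 'k::ring_1) ncs set" where
  "homogeneous dg d = {f. \<forall>w. nc_coeff f w \<noteq> 0 \<longrightarrow> word_deg dg w = d}"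

definition length_ge :: "nat \<Rightarrow> ('g, 'k::ring_1) ncs set" where
  "length_ge n = {f. \<forall>w. length w < n \<longrightarrow> nc_coeff f w = 0}"

lift_definition length_part :: "nat \<Rightarrow> ('g, 'k::ring_1) ncs \<Rightarrow> ('g, 'k) ncs"
  is "\<lambda>n f w. if length w = n then f w else 0" .

section \<open>Graded algebras and derivations\<close>

text \<open>
  Everything is graded in the completed sense: \<open>hom_part A d\<close> is the subspace of elements of degree
  \<open>d\<close>, and a general element of the carrier is a possibly infinite formal sum of homogeneous elements.
  The decreasing filtration \<open>fil\<close> defines the topology (for the complete tensor algebra, the product
  topology of the discrete spaces \<open>T\<^sup>n(V)\<close>).
\<close>

record ('k, 'a) graded_algebra = "('k, 'a) module" +
  hom_part :: "int \<Rightarrow> 'a set"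
  fil :: "nat \<Rightarrow> 'a set"

record ('k, 'a) dg_algebra = "('k, 'a) graded_algebra" +
  diff :: "'a \<Rightarrow> 'a"

definition with_diff :: "('k, 'a) graded_algebra \<Rightarrow> ('a \<Rightarrow> 'a) \<Rightarrow> ('k, 'a) dg_algebra" where
  "with_diff A D = graded_algebra.extend A (dg_algebra.fields D)"

definition derivation :: "('k::field, 'a, 'm) graded_algebra_scheme \<Rightarrow> ('a \<Rightarrow> 'a) \<Rightarrow> bool" where
  "derivation A D \<longleftrightarrow>
     D \<in> carrier A \<rightarrow> carrier A \<and>
     (\<forall>x\<in>carrier A. \<forall>y\<in>carrier A. D (x \<oplus>\<^bsub>A\<^esub> y) = D x \<oplus>\<^bsub>A\<^esub> D y) \<and>
     (\<forall>c. \<forall>x\<in>carrier A. D (c \<odot>\<^bsub>A\<^esub> x) = c \<odot>\<^bsub>A\<^esub> D x) \<and>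
     (\<forall>d. \<forall>x\<in>hom_part A d. D x \<in> hom_part A (d - 1)) \<and>
     (\<forall>d. \<forall>x\<in>hom_part A d. \<forall>y\<in>carrier A.
        D (x \<otimes>\<^bsub>A\<^esub> y) = D x \<otimes>\<^bsub>A\<^esub> y \<oplus>\<^bsub>A\<^esub> ((-1) powi d) \<odot>\<^bsub>A\<^esub> (x \<otimes>\<^bsub>A\<^esub> D y))"

definition continuous_derivation ::
    "('k::field, 'a, 'm) graded_algebra_scheme \<Rightarrow> ('a \<Rightarrow> 'a) \<Rightarrow> bool" where
  "continuous_derivation A D \<longleftrightarrow>
     derivation A D \<and> D \<in> extensional (carrier A) \<and>
     (\<forall>n. \<exists>m. \<forall>x\<in>fil A m. D x \<in> fil A n)"

text \<open>The filtration plays no role in the notion of a differential graded algebra or of an isomorphism.\<close>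

definition is_dg_algebra :: "('k::field, 'a, 'm) dg_algebra_scheme \<Rightarrow> bool" where
  "is_dg_algebra A \<longleftrightarrow>
     ring A \<and> module (ring_of_type_algebra :: 'k ring) A \<and>
     (\<forall>c. \<forall>x\<in>carrier A. \<forall>y\<in>carrier A.
        (c \<odot>\<^bsub>A\<^esub> x) \<otimes>\<^bsub>A\<^esub> y = c \<odot>\<^bsub>A\<^esub> (x \<otimes>\<^bsub>A\<^esub> y) \<and> x \<otimes>\<^bsub>A\<^esub> (c \<odot>\<^bsub>A\<^esub> y) = c \<odot>\<^bsub>A\<^esub> (x \<otimes>\<^bsub>A\<^esub> y)) \<and>
     (\<forall>d. submodule (hom_part A d) (ring_of_type_algebra :: 'k ring) A) \<and>
     (\<forall>S x. finite S \<and> (\<forall>d\<in>S. x d \<in> hom_part A d) \<and> (\<Oplus>\<^bsub>A\<^esub>d\<in>S. x d) = \<zero>\<^bsub>A\<^esub>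
        \<longrightarrow> (\<forall>d\<in>S. x d = \<zero>\<^bsub>A\<^esub>)) \<and>
     \<one>\<^bsub>A\<^esub> \<in> hom_part A 0 \<and>
     (\<forall>d e. \<forall>x\<in>hom_part A d. \<forall>y\<in>hom_part A e. x \<otimes>\<^bsub>A\<^esub> y \<in> hom_part A (d + e)) \<and>
     derivation A (diff A) \<and>
     (\<forall>x\<in>carrier A. diff A (diff A x) = \<zero>\<^bsub>A\<^esub>)"

definition dga_iso ::
    "('k::field, 'a, 'm) dg_algebra_scheme \<Rightarrow> ('k, 'b, 'n) dg_algebra_scheme \<Rightarrow> ('a \<Rightarrow> 'b) set" where
  "dga_iso A B = {\<phi> \<in> ring_iso A B.
     (\<forall>c. \<forall>x\<in>carrier A. \<phi> (c \<odot>\<^bsub>A\<^esub> x) = c \<odot>\<^bsub>B\<^esub> \<phi> x) \<and>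
     (\<forall>d. \<phi> ` hom_part A d = hom_part B d) \<and>
     (\<forall>x\<in>carrier A. \<phi> (diff A x) = diff B (\<phi> x))}"

definition dga_isomorphic ::
    "('k::field, 'a, 'm) dg_algebra_scheme \<Rightarrow> ('k, 'b, 'n) dg_algebra_scheme \<Rightarrow> bool" where
  "dga_isomorphic A B \<longleftrightarrow> is_dg_algebra A \<and> is_dg_algebra B \<and> dga_iso A B \<noteq> {}"

definition complete_tensor ::
    "('g::finite \<Rightarrow> int) \<Rightarrow> ('k::field, ('g, 'k) ncs) graded_algebra" where
  "complete_tensor dg = \<lparr>
     carrier = UNIV, monoid.mult = (*), one = 1, ring.zero = 0, add = (+), module.smult = scal,
     hom_part = homogeneous dg, fil = length_ge\<rparr>"

section \<open>Complete free Lie algebras\<close>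

record ('k, 'l) graded_lie = "'l partial_object" +
  lie_add :: "'l \<Rightarrow> 'l \<Rightarrow> 'l"
  lie_smult :: "'k \<Rightarrow> 'l \<Rightarrow> 'l"
  bracket :: "'l \<Rightarrow> 'l \<Rightarrow> 'l"
  lie_hom_part :: "int \<Rightarrow> 'l set"
  lie_fil :: "nat \<Rightarrow> 'l set"

definition continuous_lie_derivation ::
    "('k::field, 'l) graded_lie \<Rightarrow> ('l \<Rightarrow> 'l) \<Rightarrow> bool" where
  "continuous_lie_derivation L D \<longleftrightarrow>
     D \<in> carrier L \<rightarrow>\<^sub>E carrier L \<and>
     (\<forall>x\<in>carrier L. \<forall>y\<in>carrier L. D (lie_add L x y) = lie_add L (D x) (D y)) \<and>
     (\<forall>c. \<forall>x\<in>carrier L. D (lie_smult L c x) = lie_smult L c (D x)) \<and>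
     (\<forall>d. \<forall>x\<in>lie_hom_part L d. D x \<in> lie_hom_part L (d - 1)) \<and>
     (\<forall>d. \<forall>x\<in>lie_hom_part L d. \<forall>y\<in>carrier L.
        D (bracket L x y)
          = lie_add L (bracket L (D x) y) (lie_smult L ((-1) powi d) (bracket L x (D y)))) \<and>
     (\<forall>n. \<exists>m. \<forall>x\<in>lie_fil L m. D x \<in> lie_fil L n)"

text \<open>
  The graded commutator, \<open>x * y - (-1)\<^bsup>d * e\<^esup> y * x\<close> for \<open>x\<close>, \<open>y\<close> homogeneous of degrees \<open>d\<close>, \<open>e\<close>,
  extended bilinearly and continuously to arbitrary series.
\<close>

lift_definition comm :: "('g \<Rightarrow> int) \<Rightarrow> ('g, 'k::field) ncs \<Rightarrow> ('g, 'k) ncs \<Rightarrow> ('g, 'k) ncs"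
  is "\<lambda>dg f g w. \<Sum>(u, v)\<in>splits w.
        f u * g v - (-1) powi (word_deg dg u * word_deg dg v) * (g u * f v)" .

lemma comm_homogeneous:
  assumes "f \<in> homogeneous dg d" "g \<in> homogeneous dg e"
  shows "comm dg f g = f * g - scal ((-1) powi (d * e)) (g * f)"
  using assms unfolding homogeneous_def mem_Collect_eq
proof (transfer, intro ext)
  fix f g :: "'a list \<Rightarrow> 'b" and dg :: "'a \<Rightarrow> int" and d e :: int and w
  assume f: "\<forall>w. f w \<noteq> 0 \<longrightarrow> word_deg dg w = d"
    and g: "\<forall>w. g w \<noteq> 0 \<longrightarrow> word_deg dg w = e"
  have *: "(-1) powi (word_deg dg u * word_deg dg v) * (g u * f v)
      = (-1) powi (d * e) * (g u * f v)" for u v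
  proof (cases "g u = 0 \<or> f v = 0")
    case False
    then show ?thesis using f g by (metis mult.commute)
  qed auto
  show "(\<Sum>(u, v)\<in>splits w.
        f u * g v - (-1) powi (word_deg dg u * word_deg dg v) * (g u * f v))
      = (\<Sum>(u, v)\<in>splits w. f u * g v)
        - (-1) powi (d * e) * (\<Sum>(u, v)\<in>splits w. g u * f v)"
    unfolding * by (simp add: sum_subtractf sum_distrib_left case_prod_beta)
qed

inductive_set free_lie :: "('g \<Rightarrow> int) \<Rightarrow> ('g, 'k::field) ncs set"
  for dg :: "'g \<Rightarrow> int" where
  gen: "gen g \<in> free_lie dg"
| zero: "0 \<in> free_lie dg"
| add: "x \<in> free_lie dg \<Longrightarrow> y \<in> free_lie dg \<Longrightarrow> x + y \<in> free_lie dg"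
| scal: "x \<in> free_lie dg \<Longrightarrow> scal c x \<in> free_lie dg"
| comm: "x \<in> free_lie dg \<Longrightarrow> y \<in> free_lie dg \<Longrightarrow> comm dg x y \<in> free_lie dg"

definition lie_series :: "('g \<Rightarrow> int) \<Rightarrow> ('g, 'k::field) ncs set" where
  "lie_series dg = {f. nc_coeff f [] = 0 \<and> (\<forall>n\<ge>1. length_part n f \<in> free_lie dg)}"

definition complete_free_lie ::
    "('g::finite \<Rightarrow> int) \<Rightarrow> ('k::field, ('g, 'k) ncs) graded_lie" where
  "complete_free_lie dg = \<lparr>
     carrier = lie_series dg, lie_add = (+), lie_smult = scal, bracket = comm dg,
     lie_hom_part = (\<lambda>d. lie_series dg \<inter> homogeneous dg d),
     lie_fil = (\<lambda>n. lie_series dg \<inter> length_ge n)\<rparr>"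

section \<open>Completed universal enveloping algebras\<close>

text \<open>
  For a graded Lie algebra \<open>L\<close> with a decreasing filtration, the enveloping algebra \<open>U L\<close> is presented
  as the free algebra on the set \<open>L\<close>, modulo the relations making the inclusion linear (which give
  the tensor algebra of the vector space \<open>L\<close>) and turning brackets into graded commutators. The
  filtration of \<open>L\<close> induces one on \<open>U L\<close>: its \<open>n\<close>-th stage is spanned by the products
  \<open>x\<^sub>1 \<dots> x\<^sub>k\<close> with \<open>x\<^sub>i \<in> lie_fil L m\<^sub>i\<close> and \<open>m\<^sub>1 + \<dots> + m\<^sub>k \<ge> n\<close>. The completed enveloping algebra
  is the inverse limit of the quotients of \<open>U L\<close> by these stages; \<open>uea_ideal L n\<close> is the preimage of
  the \<open>n\<close>-th stage in the free algebra.
\<close>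

definition free_algebra :: "'x set \<Rightarrow> ('x, 'k::field) ncs ring" where
  "free_algebra M = (ring_of_type_algebra :: ('x, 'k) ncs ring)
     \<lparr>carrier := {f. finite {w. nc_coeff f w \<noteq> 0} \<and> {w. nc_coeff f w \<noteq> 0} \<subseteq> lists M}\<rparr>"

definition uea_relations :: "('k::field, 'l) graded_lie \<Rightarrow> ('l, 'k) ncs set" where
  "uea_relations L =
     {gen (lie_add L x y) - gen x - gen y | x y. x \<in> carrier L \<and> y \<in> carrier L} \<union>
     {gen (lie_smult L c x) - scal c (gen x) | c x. x \<in> carrier L} \<union>
     {gen x * gen y - scal ((-1) powi (d * e)) (gen y * gen x) - gen (bracket L x y)
        | x y d e. x \<in> lie_hom_part L d \<and> y \<in> lie_hom_part L e}"

definition uea_stage_words :: "('k, 'l) graded_lie \<Rightarrow> nat \<Rightarrow> 'l list set" where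
  "uea_stage_words L n =
     {xs \<in> lists (carrier L). \<exists>ms. list_all2 (\<lambda>x m. x \<in> lie_fil L m) xs ms \<and> n \<le> sum_list ms}"

definition uea_ideal :: "('k::field, 'l) graded_lie \<Rightarrow> nat \<Rightarrow> ('l, 'k) ncs set" where
  "uea_ideal L n =
     Idl\<^bsub>free_algebra (carrier L)\<^esub> (uea_relations L \<union> word ` uea_stage_words L n)"

definition free_hom_part :: "('k::field, 'l) graded_lie \<Rightarrow> int \<Rightarrow> ('l, 'k) ncs set" where
  "free_hom_part L d = {t \<in> carrier (free_algebra (carrier L)).
     \<forall>xs. nc_coeff t xs \<noteq> 0 \<longrightarrow>
       (\<exists>ds. list_all2 (\<lambda>x e. x \<in> lie_hom_part L e) xs ds \<and> sum_list ds = d)}"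

definition uea_quot :: "('k::field, 'l) graded_lie \<Rightarrow> nat \<Rightarrow> ('l, 'k) ncs set ring" where
  "uea_quot L n = free_algebra (carrier L) Quot uea_ideal L n"

text \<open>
  An element of the inverse limit is a sequence of cosets, the \<open>n\<close>-th one a coset of \<open>uea_ideal L n\<close>;
  compatibility with the projections means that these cosets are decreasing.
\<close>

definition uea_carrier :: "('k::field, 'l) graded_lie \<Rightarrow> (nat \<Rightarrow> ('l, 'k) ncs set) set" where
  "uea_carrier L = {s. \<forall>n. s n \<in> carrier (uea_quot L n) \<and> s (Suc n) \<subseteq> s n}"

definition complete_uea ::
    "('k::field, 'l) graded_lie \<Rightarrow> ('k, nat \<Rightarrow> ('l, 'k) ncs set) graded_algebra" where
  "complete_uea L = \<lparr>
     carrier = uea_carrier L,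
     monoid.mult = (\<lambda>s t n. s n \<otimes>\<^bsub>uea_quot L n\<^esub> t n),
     one = (\<lambda>n. \<one>\<^bsub>uea_quot L n\<^esub>),
     ring.zero = (\<lambda>n. \<zero>\<^bsub>uea_quot L n\<^esub>),
     add = (\<lambda>s t n. s n \<oplus>\<^bsub>uea_quot L n\<^esub> t n),
     module.smult = (\<lambda>c s n. \<Union>t\<in>s n. uea_ideal L n +>\<^bsub>free_algebra (carrier L)\<^esub> scal c t),
     hom_part = (\<lambda>d. {s \<in> uea_carrier L. \<forall>n. s n \<inter> free_hom_part L d \<noteq> {}}),
     fil = (\<lambda>n. {s \<in> uea_carrier L. s n = \<zero>\<^bsub>uea_quot L n\<^esub>})\<rparr>"

definition uea_inj :: "('k::field, 'l) graded_lie \<Rightarrow> 'l \<Rightarrow> nat \<Rightarrow> ('l, 'k) ncs set" where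
  "uea_inj L x = (\<lambda>n. uea_ideal L n +>\<^bsub>free_algebra (carrier L)\<^esub> gen x)"

definition uea_diff ::
    "('k::field, 'l) graded_lie \<Rightarrow> ('l \<Rightarrow> 'l) \<Rightarrow>
     (nat \<Rightarrow> ('l, 'k) ncs set) \<Rightarrow> nat \<Rightarrow> ('l, 'k) ncs set" where
  "uea_diff L d = (THE D. continuous_derivation (complete_uea L) D \<and>
     (\<forall>x\<in>carrier L. D (uea_inj L x) = uea_inj L (d x)))"

definition dg_uea ::
    "('k::field, 'l) graded_lie \<Rightarrow> ('l \<Rightarrow> 'l) \<Rightarrow>
     ('k, nat \<Rightarrow> ('l, 'k) ncs set) dg_algebra" where
  "dg_uea L d = with_diff (complete_uea L) (uea_diff L d)"

section \<open>The Lawrence-Sullivan construction and the cylinder\<close>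

definition bernoulli :: "nat \<Rightarrow> 'k::field_char_0" where
  "bernoulli n = fact n * fps_nth (fps_X / (fps_exp 1 - 1)) n"

datatype ls_gen = Ga | Gb | Gz

instance ls_gen :: finite
proof
  have "(UNIV :: ls_gen set) = {Ga, Gb, Gz}" using ls_gen.exhaust by auto
  then show "finite (UNIV :: ls_gen set)" by (metis finite.emptyI finite.insertI)
qed

fun ls_deg :: "ls_gen \<Rightarrow> int" where
  "ls_deg Ga = -1" | "ls_deg Gb = -1" | "ls_deg Gz = 0"

definition LS_lie :: "('k::field_char_0, (ls_gen, 'k) ncs) graded_lie" where
  "LS_lie = complete_free_lie ls_deg"

definition LS_diff :: "(ls_gen, 'k::field_char_0) ncs \<Rightarrow> (ls_gen, 'k) ncs" where
  "LS_diff = (THE d. continuous_lie_derivation LS_lie d \<and>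
     d (gen Ga) = scal (-1/2) (comm ls_deg (gen Ga) (gen Ga)) \<and>
     d (gen Gb) = scal (-1/2) (comm ls_deg (gen Gb) (gen Gb)) \<and>
     d (gen Gz) = comm ls_deg (gen Gz) (gen Gb) +
       formal_sum (\<lambda>i. scal (bernoulli i / fact i)
         ((comm ls_deg (gen Gz) ^^ i) (gen Gb - gen Ga))))"

datatype cyl_gen = Gu | Gu' | Gsu

instance cyl_gen :: finite
proof
  have "(UNIV :: cyl_gen set) = {Gu, Gu', Gsu}" using cyl_gen.exhaust by auto
  then show "finite (UNIV :: cyl_gen set)" by (metis finite.emptyI finite.insertI)
qed

fun cyl_deg :: "cyl_gen \<Rightarrow> int" where
  "cyl_deg Gu = -1" | "cyl_deg Gu' = -1" | "cyl_deg Gsu = 0"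

definition cyl_diff :: "(cyl_gen, 'k::field_char_0) ncs \<Rightarrow> (cyl_gen, 'k) ncs" where
  "cyl_diff = (THE D. continuous_derivation (complete_tensor cyl_deg) D \<and>
     D (gen Gu) = - (gen Gu * gen Gu) \<and>
     D (gen Gu') = - (gen Gu' * gen Gu') \<and>
     D (gen Gsu) = gen Gsu * gen Gu' - gen Gu' * gen Gsu +
       formal_sum (\<lambda>n. \<Sum>(p, q)\<in>{(p, q). p + q = n}.
         scal ((-1) ^ q * (bernoulli n / (fact p * fact q)))
           (gen Gsu ^ p * (gen Gu' - gen Gu) * gen Gsu ^ q)))"

definition Cyl_T :: "('k::field_char_0, (cyl_gen, 'k) ncs) dg_algebra" where
  "Cyl_T = with_diff (complete_tensor cyl_deg) cyl_diff"

end

theory Submission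
  imports Defs
begin

text \<open>
  As graded algebras, both sides are the algebra of noncommutative series in three letters. For the
  cylinder this is the definition, with \<open>u\<close>, \<open>u'\<close>, \<open>su\<close> in place of \<open>a\<close>, \<open>b\<close>, \<open>z\<close>. For the
  enveloping algebra, multiplying out a formal product of Lie series gives a map to the series. Modulo
  the ideal of the \<open>n\<close>-th stage every Lie series is congruent to a Lie polynomial, and every Lie
  polynomial to a noncommutative polynomial in the letters. Therefore this ideal consists exactly of
  the elements whose evaluation has no terms of length below \<open>n\<close> (\<open>uea_ideal_eq\<close>), and the inverse limit
  of the quotients is the algebra of all series (\<open>uea_carrier_eq\<close>).

  A continuous derivation of the series algebra is determined by its values on the letters, and these
  can be prescribed (\<open>graded_derivation_unique\<close>, \<open>graded_derivation_ext\<close>). Let \<open>D\<close> be the one with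
  the Lawrence-Sullivan values. It preserves Lie series, so that its restriction is the differential
  of the Lie algebra (\<open>LS_diff_eq\<close>), and it corresponds to the induced derivation of the enveloping
  algebra (\<open>uea_diff_eq\<close>). The binomial expansion of iterated commutators turns its value on \<open>z\<close> into
  the formula for \<open>D(su)\<close> (\<open>bernoulli_ad_power\<close>), so it also corresponds to the derivation of the
  cylinder (\<open>cyl_diff_to_cyl\<close>).

  It remains to see that \<open>D \<circ> D = 0\<close>. This only has to be checked on letters, and on \<open>a\<close> and \<open>b\<close> it
  is immediate. For \<open>z\<close>, consider \<open>E = e\<^sup>z\<close>. Every derivation, graded or not, that treats \<open>z\<close> as an
  element of degree \<open>0\<close> satisfies \<open>D E = ((e\<^bsup>ad z\<^esup> - 1) / ad z) (D z) * E\<close> (\<open>derivation_nc_exp\<close>). As the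
  Bernoulli series is the inverse of \<open>(e\<^sup>t - 1) / t\<close>, the formula for \<open>D z\<close> says that
  \<open>D E = E * b - a * E\<close>, and then \<open>D (D E) = 0\<close> follows from \<open>D a = - a * a\<close> and \<open>D b = - b * b\<close>. The
  same rule applied to \<open>D \<circ> D\<close> gives \<open>((e\<^bsup>ad z\<^esup> - 1) / ad z) (D (D z)) * E = 0\<close>, hence \<open>D (D z) = 0\<close>
  (\<open>bernoulli_derivation_square_zero\<close>).
\<close>

section \<open>Calculus of noncommutative series\<close>

lemma ncs_eqI: "(\<And>w. nc_coeff f w = nc_coeff g w) \<Longrightarrow> f = g"
  by (metis nc_coeff_inject ext)

lemma nc_coeff_simps [simp]:
  "nc_coeff 0 w = 0"
  "nc_coeff (f + g) w = nc_coeff f w + nc_coeff g w"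
  "nc_coeff (f - g) w = nc_coeff f w - nc_coeff g w"
  "nc_coeff (- f) w = - nc_coeff f w"
  "nc_coeff (scal c f) w = c * nc_coeff f w"
  by (simp_all add: zero_ncs.rep_eq plus_ncs.rep_eq minus_ncs.rep_eq uminus_ncs.rep_eq scal.rep_eq)

lemma nc_coeff_one: "nc_coeff 1 w = (if w = [] then 1 else 0)"
  by (simp add: one_ncs.rep_eq)

lemma nc_coeff_times:
  "nc_coeff (f * g) w = (\<Sum>(u, v)\<in>splits w. nc_coeff f u * nc_coeff g v)"
  by (simp add: times_ncs.rep_eq)

lemma nc_coeff_word: "nc_coeff (word v) w = (if w = v then 1 else 0)"
  by (simp add: word.rep_eq)

lemma nc_coeff_sum: "nc_coeff (sum f S) w = (\<Sum>i\<in>S. nc_coeff (f i) w)"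
  by (induction S rule: infinite_finite_induct) auto

interpretation ncs: vector_space "scal :: 'k::field \<Rightarrow> ('g, 'k) ncs \<Rightarrow> ('g, 'k) ncs"
  by unfold_locales (auto intro!: ncs_eqI simp: algebra_simps)

lemma scal_mult:
  fixes f g :: "('g, 'k::field) ncs"
  shows "scal c f * g = scal c (f * g)" "f * scal c g = scal c (f * g)"
  by (auto intro!: ncs_eqI sum.cong simp: nc_coeff_times sum_distrib_left case_prod_beta)

lemma word_Nil: "word [] = 1"
  by (rule ncs_eqI) (simp add: nc_coeff_word nc_coeff_one)

lemma word_mult: "word u * word v = word (u @ v)"
proof (rule ncs_eqI)
  fix w
  have "nc_coeff (word u * word v) w
      = (\<Sum>p\<in>splits w. if p = (u, v) then 1 else 0)"
    unfolding nc_coeff_times by (intro sum.cong) (auto simp: nc_coeff_word split: if_splits)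
  also have "\<dots> = nc_coeff (word (u @ v)) w"
    by (simp add: nc_coeff_word) (auto simp: splits_def)
  finally show "nc_coeff (word u * word v) w = nc_coeff (word (u @ v)) w" .
qed

lemma word_Cons: "word (g # w) = gen g * word w"
  by (simp add: word_mult)

subsection \<open>The length filtration\<close>

lemma length_ge_0 [simp]: "f \<in> length_ge 0"
  by (simp add: length_ge_def)

lemma length_ge_zero [simp]: "0 \<in> length_ge n"
  by (simp add: length_ge_def)

lemma length_ge_add: "f \<in> length_ge n \<Longrightarrow> g \<in> length_ge n \<Longrightarrow> f + g \<in> length_ge n"
  by (simp add: length_ge_def)

lemma length_ge_diff: "f \<in> length_ge n \<Longrightarrow> g \<in> length_ge n \<Longrightarrow> f - g \<in> length_ge n"
  by (simp add: length_ge_def)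

lemma length_ge_uminus: "f \<in> length_ge n \<Longrightarrow> - f \<in> length_ge n"
  by (simp add: length_ge_def)

lemma length_ge_scal: "f \<in> length_ge n \<Longrightarrow> scal c f \<in> length_ge n"
  by (simp add: length_ge_def)

lemma length_ge_sum: "(\<And>i. i \<in> S \<Longrightarrow> f i \<in> length_ge n) \<Longrightarrow> sum f S \<in> length_ge n"
  by (simp add: length_ge_def nc_coeff_sum)

lemma length_ge_mono: "f \<in> length_ge n \<Longrightarrow> m \<le> n \<Longrightarrow> f \<in> length_ge m"
  by (simp add: length_ge_def)

lemma length_ge_mult:
  assumes "f \<in> length_ge m" "g \<in> length_ge n"
  shows "f * g \<in> length_ge (m + n)"
  unfolding length_ge_def
proof (intro CollectI allI impI)
  fix w :: "'a list" assume "length w < m + n"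
  then have "length u < m \<or> length v < n" if "(u, v) \<in> splits w" for u v
    using that by (auto simp: splits_def)
  then show "nc_coeff (f * g) w = 0"
    using assms unfolding nc_coeff_times length_ge_def
    by (intro sum.neutral) fastforce
qed

lemma length_ge_mult_left: "g \<in> length_ge n \<Longrightarrow> f * g \<in> length_ge n"
  using length_ge_mult[of f 0 g n] by simp

lemma length_ge_mult_right: "f \<in> length_ge n \<Longrightarrow> f * g \<in> length_ge n"
  using length_ge_mult[of f n g 0] by simp

lemma length_ge_word: "word w \<in> length_ge n \<longleftrightarrow> n \<le> length w"
  by (auto simp: length_ge_def nc_coeff_word not_less)

lemma length_ge_power: "f \<in> length_ge 1 \<Longrightarrow> f ^ n \<in> length_ge n"
proof (induction n)
  case (Suc n)
  then show ?case using length_ge_mult[of f 1 "f ^ n" n] by simp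
qed simp

lemma length_ge_all_imp_zero: "(\<And>n. f \<in> length_ge n) \<Longrightarrow> f = 0"
  by (rule ncs_eqI) (auto simp: length_ge_def)

text \<open>Over a finite alphabet, the part of length below \<open>n\<close> is a finite combination of words.\<close>

definition trunc :: "nat \<Rightarrow> ('g::finite, 'k::field) ncs \<Rightarrow> ('g, 'k) ncs" where
  "trunc n f = (\<Sum>w | length w < n. scal (nc_coeff f w) (word w))"

lemma finite_words_less: "finite {w :: 'g::finite list. length w < n}"
proof (rule finite_subset[OF _ finite_lists_length_le[of UNIV n]])
  show "{w :: 'g list. length w < n} \<subseteq> {xs. set xs \<subseteq> UNIV \<and> length xs \<le> n}" by auto
qed simp

lemma finite_words_le: "finite {w :: 'g::finite list. length w \<le> n}"
  using finite_words_less[of "Suc n"] by (simp add: less_Suc_eq_le)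

lemma nc_coeff_trunc: "nc_coeff (trunc n f) w = (if length w < n then nc_coeff f w else 0)"
  by (simp add: trunc_def nc_coeff_sum nc_coeff_word finite_words_less if_distrib cong: if_cong)

lemma trunc_diff: "f - trunc n f \<in> length_ge n"
  by (simp add: length_ge_def nc_coeff_trunc)

subsection \<open>Continuous linear maps\<close>

definition cont_linear :: "(('g, 'k::field) ncs \<Rightarrow> ('h, 'k) ncs) \<Rightarrow> bool" where
  "cont_linear T \<longleftrightarrow> (\<forall>x y. T (x + y) = T x + T y) \<and> (\<forall>c x. T (scal c x) = scal c (T x)) \<and>
     (\<forall>n. \<exists>m. \<forall>x\<in>length_ge m. T x \<in> length_ge n)"

lemma cont_linearI:
  assumes "\<And>x y. T (x + y) = T x + T y" "\<And>c x. T (scal c x) = scal c (T x)"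
    "\<And>n x. x \<in> length_ge n \<Longrightarrow> T x \<in> length_ge n"
  shows "cont_linear T"
  using assms unfolding cont_linear_def by blast

lemma cont_linear_add: "cont_linear T \<Longrightarrow> T (x + y) = T x + T y"
  by (simp add: cont_linear_def)

lemma cont_linear_scal: "cont_linear T \<Longrightarrow> T (scal c x) = scal c (T x)"
  by (simp add: cont_linear_def)

lemma cont_linear_zero: "cont_linear T \<Longrightarrow> T 0 = 0"
  using cont_linear_add[of T 0 0] by simp

lemma cont_linear_uminus: "cont_linear T \<Longrightarrow> T (- x) = - T x"
  using cont_linear_add[of T x "- x"] cont_linear_zero[of T] by (simp add: minus_unique)

lemma cont_linear_diff: "cont_linear T \<Longrightarrow> T (x - y) = T x - T y"
  using cont_linear_add[of T x "- y"] cont_linear_uminus[of T y] by simp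

lemma cont_linear_sum: "cont_linear T \<Longrightarrow> T (sum f S) = (\<Sum>i\<in>S. T (f i))"
  by (induction S rule: infinite_finite_induct) (auto simp: cont_linear_zero cont_linear_add)

lemma cont_linear_cont:
  assumes "cont_linear T"
  obtains m where "\<And>x. x \<in> length_ge m \<Longrightarrow> T x \<in> length_ge n"
  using assms unfolding cont_linear_def by meson

text \<open>
  Words span a dense subspace, so that identities between continuous linear maps need only be checked
  on words. This is how the product rules below are obtained.
\<close>

lemma cont_linear_eqI:
  fixes T S :: "('g::finite, 'k::field) ncs \<Rightarrow> ('h, 'k) ncs"
  assumes T: "cont_linear T" and S: "cont_linear S" and eq: "\<And>w. T (word w) = S (word w)"
  shows "T f = S f"
proof -
  have "T f - S f \<in> length_ge n" for n
  proof -
    obtain m where m: "\<And>x. x \<in> length_ge m \<Longrightarrow> T x \<in> length_ge n"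
      using cont_linear_cont[OF T] by blast
    obtain m' where m': "\<And>x. x \<in> length_ge m' \<Longrightarrow> S x \<in> length_ge n"
      using cont_linear_cont[OF S] by blast
    define t where "t = trunc (max m m') f"
    have t: "f - t \<in> length_ge m" "f - t \<in> length_ge m'"
      using trunc_diff[of f "max m m'"] unfolding t_def by (auto intro: length_ge_mono)
    have "T t = S t"
      unfolding t_def trunc_def by (simp add: cont_linear_sum T S cont_linear_scal eq)
    then have "T f - S f = T (f - t) - S (f - t)"
      by (simp add: cont_linear_diff T S)
    then show ?thesis
      using m[OF t(1)] m'[OF t(2)] by (simp add: length_ge_diff)
  qed
  then show ?thesis using length_ge_all_imp_zero[of "T f - S f"] by auto
qed

lemma cont_bilinear_eqI:
  fixes B C :: "('g::finite, 'k::field) ncs \<Rightarrow> ('h::finite, 'k) ncs \<Rightarrow> ('i, 'k) ncs"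
  assumes "\<And>y. cont_linear (\<lambda>x. B x y)" "\<And>x. cont_linear (B x)"
    and "\<And>y. cont_linear (\<lambda>x. C x y)" "\<And>x. cont_linear (C x)"
    and "\<And>u v. B (word u) (word v) = C (word u) (word v)"
  shows "B x y = C x y"
  by (rule cont_linear_eqI[of "\<lambda>x. B x y" "\<lambda>x. C x y"], fact, fact,
      rule cont_linear_eqI[of "B (word _)" "C (word _)"], fact+)

lemma cont_linear_comp:
  assumes "cont_linear T" "cont_linear S" shows "cont_linear (\<lambda>x. T (S x))"
  unfolding cont_linear_def
proof (intro conjI allI)
  fix n
  obtain m where m: "\<And>x. x \<in> length_ge m \<Longrightarrow> T x \<in> length_ge n"
    using cont_linear_cont[OF assms(1)] by blast
  obtain l where "\<And>x. x \<in> length_ge l \<Longrightarrow> S x \<in> length_ge m"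
    using cont_linear_cont[OF assms(2)] by blast
  then show "\<exists>l. \<forall>x\<in>length_ge l. T (S x) \<in> length_ge n" using m by blast
qed (use assms in \<open>simp_all add: cont_linear_add cont_linear_scal\<close>)

lemma cont_linear_id: "cont_linear (\<lambda>x. x)"
  by (rule cont_linearI) auto

lemma cont_linear_plus:
  assumes "cont_linear T" "cont_linear S" shows "cont_linear (\<lambda>x. T x + S x)"
  unfolding cont_linear_def
proof (intro conjI allI)
  fix n
  obtain m where m: "\<And>x. x \<in> length_ge m \<Longrightarrow> T x \<in> length_ge n"
    using cont_linear_cont[OF assms(1)] by blast
  obtain l where l: "\<And>x. x \<in> length_ge l \<Longrightarrow> S x \<in> length_ge n"
    using cont_linear_cont[OF assms(2)] by blast
  have "\<forall>x\<in>length_ge (max l m). T x + S x \<in> length_ge n"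
    using m l by (meson length_ge_add length_ge_mono max.cobounded1 max.cobounded2)
  then show "\<exists>l. \<forall>x\<in>length_ge l. T x + S x \<in> length_ge n" by blast
qed (use assms in \<open>simp_all add: cont_linear_add cont_linear_scal ncs.scale_right_distrib algebra_simps\<close>)

lemma cont_linear_smult: "cont_linear T \<Longrightarrow> cont_linear (\<lambda>x. scal c (T x))"
  by (rule cont_linear_comp[of "scal c"])
    (auto intro!: cont_linearI simp: ncs.scale_right_distrib length_ge_scal ncs.scale_left_commute)

lemma cont_linear_minus:
  assumes "cont_linear T" "cont_linear S" shows "cont_linear (\<lambda>x. T x - S x)"
  using cont_linear_plus[OF assms(1) cont_linear_smult[OF assms(2), of "-1"]] by simp

lemma cont_linear_times_left: "cont_linear T \<Longrightarrow> cont_linear (\<lambda>x. f * T x)"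
  by (rule cont_linear_comp[of "(*) f"])
    (auto intro!: cont_linearI simp: distrib_left length_ge_mult_left scal_mult)

lemma cont_linear_times_right: "cont_linear T \<Longrightarrow> cont_linear (\<lambda>x. T x * f)"
  by (rule cont_linear_comp[of "\<lambda>x. x * f"])
    (auto intro!: cont_linearI simp: distrib_right length_ge_mult_right scal_mult)

lemmas cont_linear_intros = cont_linear_id cont_linear_plus cont_linear_minus cont_linear_smult
  cont_linear_times_left cont_linear_times_right

text \<open>
  The continuous linear map with prescribed values on words. The coefficient at \<open>w\<close> is a finite sum
  because only the values on the finitely many words not longer than \<open>w\<close> can contribute.
\<close>

lift_definition word_ext ::
    "('g list \<Rightarrow> ('h, 'k::field) ncs) \<Rightarrow> ('g::finite, 'k) ncs \<Rightarrow> ('h, 'k) ncs"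
  is "\<lambda>T f w. \<Sum>v | length v \<le> length w. f v * T v w" .

lemma nc_coeff_word_ext:
  "nc_coeff (word_ext T f) w
     = (\<Sum>v | length v \<le> length w. nc_coeff f v * nc_coeff (T v) w)"
  by (simp add: word_ext.rep_eq)

lemma word_ext_length_ge:
  assumes "\<And>w. T w \<in> length_ge (length w)" "f \<in> length_ge n"
  shows "word_ext T f \<in> length_ge n"
  using assms unfolding length_ge_def nc_coeff_word_ext mem_Collect_eq
  by (intro allI impI sum.neutral) (metis (mono_tags, lifting) le_less_trans mem_Collect_eq mult_zero_left)

lemma cont_linear_word_ext:
  assumes "\<And>w. T w \<in> length_ge (length w)"
  shows "cont_linear (word_ext T)"
  by (rule cont_linearI)
    (use assms in \<open>auto intro!: ncs_eqI word_ext_length_ge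
      simp: nc_coeff_word_ext algebra_simps sum.distrib sum_distrib_left\<close>)

lemma word_ext_word:
  assumes "\<And>w. T w \<in> length_ge (length w)"
  shows "word_ext T (word v) = T v"
proof (rule ncs_eqI)
  fix w
  have "nc_coeff (word_ext T (word v)) w
      = (\<Sum>x | length x \<le> length w. if x = v then nc_coeff (T v) w else 0)"
    unfolding nc_coeff_word_ext by (intro sum.cong) (auto simp: nc_coeff_word)
  also have "\<dots> = nc_coeff (T v) w"
    using assms[of v] by (subst sum.delta) (auto simp: length_ge_def finite_words_le)
  finally show "nc_coeff (word_ext T (word v)) w = nc_coeff (T v) w" .
qed

subsection \<open>Locally finite sums\<close>

lemma nc_coeff_formal_sum:
  assumes "\<And>n. F n \<in> length_ge n"
  shows "nc_coeff (formal_sum F) w = (\<Sum>n\<le>length w. nc_coeff (F n) w)"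
proof -
  have "{n. nc_coeff (F n) w \<noteq> 0} \<subseteq> {..length w}"
    using assms by (force simp: length_ge_def not_less[symmetric])
  then show ?thesis
    unfolding formal_sum.rep_eq by (intro Sum_any.expand_superset) auto
qed

lemma formal_sum_tail:
  assumes "\<And>n. F n \<in> length_ge n"
  shows "formal_sum F - (\<Sum>i<n. F i) \<in> length_ge n"
  unfolding length_ge_def
proof (intro CollectI allI impI)
  fix w :: "'a list" assume "length w < n"
  then have "(\<Sum>i<n. nc_coeff (F i) w) = (\<Sum>i\<le>length w. nc_coeff (F i) w)"
    using assms by (intro sum.mono_neutral_right) (auto simp: length_ge_def)
  then show "nc_coeff (formal_sum F - (\<Sum>i<n. F i)) w = 0"
    by (simp add: nc_coeff_formal_sum assms nc_coeff_sum)
qed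

lemma formal_sum_length_ge:
  assumes "\<And>n. F n \<in> length_ge n" "\<And>n. F n \<in> length_ge m"
  shows "formal_sum F \<in> length_ge m"
  using assms(2) by (auto simp: length_ge_def nc_coeff_formal_sum[OF assms(1)] intro!: sum.neutral)

text \<open>
  Modulo a given length, both sides are the finite sum of the images of the first terms; the tails are
  small by the continuity of \<open>T\<close> on one side and by local finiteness of the image on the other.
\<close>

lemma cont_linear_formal_sum:
  assumes T: "cont_linear T" and F: "\<And>n. F n \<in> length_ge n" and TF: "\<And>n. T (F n) \<in> length_ge n"
  shows "T (formal_sum F) = formal_sum (\<lambda>n. T (F n))"
proof -
  have "T (formal_sum F) - formal_sum (\<lambda>n. T (F n)) \<in> length_ge n" for n
  proof -
    obtain m where m: "\<And>x. x \<in> length_ge m \<Longrightarrow> T x \<in> length_ge n"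
      using cont_linear_cont[OF T] by blast
    define k where "k = max m n"
    have "T (formal_sum F - (\<Sum>i<k. F i)) \<in> length_ge n"
      using formal_sum_tail[of F k, OF F] by (intro m) (auto simp: k_def intro: length_ge_mono)
    moreover have "formal_sum (\<lambda>n. T (F n)) - (\<Sum>i<k. T (F i)) \<in> length_ge n"
      using formal_sum_tail[of "\<lambda>n. T (F n)" k, OF TF] by (auto simp: k_def intro: length_ge_mono)
    ultimately have "T (formal_sum F - (\<Sum>i<k. F i)) -
        (formal_sum (\<lambda>n. T (F n)) - (\<Sum>i<k. T (F i))) \<in> length_ge n"
      by (rule length_ge_diff)
    then show ?thesis by (simp add: cont_linear_diff cont_linear_sum T)
  qed
  then show ?thesis using length_ge_all_imp_zero[of "T (formal_sum F) - formal_sum (\<lambda>n. T (F n))"] by auto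
qed

text \<open>
  The coefficient at a word of length \<open>l\<close> only involves \<open>H i j\<close> with \<open>i + j \<le> l\<close>, so that summing over
  a square or over antidiagonals makes no difference.
\<close>

lemma formal_sum_formal_sum:
  fixes H :: "nat \<Rightarrow> nat \<Rightarrow> ('g, 'k::field) ncs"
  assumes H: "\<And>i j. H i j \<in> length_ge (i + j)"
  shows "formal_sum (\<lambda>i. formal_sum (H i)) = formal_sum (\<lambda>n. \<Sum>i\<le>n. H i (n - i))"
proof (rule ncs_eqI)
  fix w :: "'g list"
  let ?L = "length w"
  have H0: "nc_coeff (H i j) w = 0" if "?L < i + j" for i j
    using H[of i j] that by (simp add: length_ge_def)
  have H1: "H i j \<in> length_ge j" "H i j \<in> length_ge i" for i j
    using H[of i j] by (auto intro: length_ge_mono)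
  have H2: "formal_sum (H i) \<in> length_ge i" for i
    by (intro formal_sum_length_ge H1)
  have H3: "(\<Sum>i\<le>n. H i (n - i)) \<in> length_ge n" for n
  proof (intro length_ge_sum)
    fix i assume "i \<in> {..n}"
    then show "H i (n - i) \<in> length_ge n" using H[of i "n - i"] by simp
  qed
  have "nc_coeff (formal_sum (\<lambda>i. formal_sum (H i))) w
      = (\<Sum>i\<le>?L. \<Sum>j\<le>?L. nc_coeff (H i j) w)"
    by (simp add: nc_coeff_formal_sum H1 H2)
  also have "\<dots> = (\<Sum>(i, j)\<in>{..?L} \<times> {..?L}. nc_coeff (H i j) w)"
    by (simp add: sum.cartesian_product)
  also have "\<dots> = (\<Sum>(i, j)\<in>{(i, j). i + j \<le> ?L}. nc_coeff (H i j) w)"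
    using H0 by (intro sum.mono_neutral_right) (auto simp: not_less[symmetric])
  also have "\<dots> = (\<Sum>n\<le>?L. \<Sum>i\<le>n. nc_coeff (H i (n - i)) w)"
    by (rule sum.triangle_reindex_eq)
  also have "\<dots> = nc_coeff (formal_sum (\<lambda>n. \<Sum>i\<le>n. H i (n - i))) w"
    by (simp add: nc_coeff_formal_sum H3 nc_coeff_sum)
  finally show "nc_coeff (formal_sum (\<lambda>i. formal_sum (H i))) w
    = nc_coeff (formal_sum (\<lambda>n. \<Sum>i\<le>n. H i (n - i))) w" .
qed

lemma formal_sum_times:
  fixes F G :: "nat \<Rightarrow> ('g, 'k::field) ncs"
  assumes F: "\<And>n. F n \<in> length_ge n" and G: "\<And>n. G n \<in> length_ge n"
  shows "formal_sum F * formal_sum G = formal_sum (\<lambda>n. \<Sum>i\<le>n. F i * G (n - i))"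
proof -
  have "formal_sum F * formal_sum G = formal_sum (\<lambda>i. F i * formal_sum G)"
    by (rule cont_linear_formal_sum[of "\<lambda>x. x * formal_sum G"])
      (intro cont_linear_intros F length_ge_mult_right)+
  moreover have "F i * formal_sum G = formal_sum (\<lambda>j. F i * G j)" for i
    by (rule cont_linear_formal_sum) (intro cont_linear_intros G length_ge_mult_left)+
  moreover have "formal_sum (\<lambda>i. formal_sum (\<lambda>j. F i * G j))
      = formal_sum (\<lambda>n. \<Sum>i\<le>n. F i * G (n - i))"
    by (intro formal_sum_formal_sum length_ge_mult F G)
  ultimately show ?thesis by simp
qed

lemma formal_sum_only_0:
  assumes "\<And>n. n > 0 \<Longrightarrow> F n = 0"
  shows "formal_sum F = F 0"
proof (rule ncs_eqI)
  fix w
  have "F n \<in> length_ge n" for n using assms[of n] by (cases n) auto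
  then have "nc_coeff (formal_sum F) w = (\<Sum>n\<le>length w. nc_coeff (F n) w)"
    by (rule nc_coeff_formal_sum)
  also have "\<dots> = (\<Sum>n\<in>{0}. nc_coeff (F n) w)"
    using assms by (intro sum.mono_neutral_right) auto
  finally show "nc_coeff (formal_sum F) w = nc_coeff (F 0) w" by simp
qed

section \<open>Gradings and derivations\<close>

lemma minus_one_powi: "(-1 :: 'k::field) powi n = (if even n then 1 else - 1)"
  by (simp add: power_int_minus_left)

lemma word_deg_simps [simp]:
  "word_deg dg [] = 0" "word_deg dg (g # w) = dg g + word_deg dg w"
  "word_deg dg (u @ v) = word_deg dg u + word_deg dg v"
  by (simp_all add: word_deg_def)

lemma homogeneous_zero [simp]: "0 \<in> homogeneous dg d"
  by (simp add: homogeneous_def)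

lemma homogeneous_add: "f \<in> homogeneous dg d \<Longrightarrow> g \<in> homogeneous dg d \<Longrightarrow> f + g \<in> homogeneous dg d"
  by (auto simp: homogeneous_def) (metis add.right_neutral add_cancel_right_left)

lemma homogeneous_uminus: "f \<in> homogeneous dg d \<Longrightarrow> - f \<in> homogeneous dg d"
  by (simp add: homogeneous_def)

lemma homogeneous_diff: "f \<in> homogeneous dg d \<Longrightarrow> g \<in> homogeneous dg d \<Longrightarrow> f - g \<in> homogeneous dg d"
  using homogeneous_add[of f dg d "- g"] homogeneous_uminus[of g dg d] by simp

lemma homogeneous_scal:
  fixes f :: "('g, 'k::field) ncs"
  shows "f \<in> homogeneous dg d \<Longrightarrow> scal c f \<in> homogeneous dg d"
  by (auto simp: homogeneous_def)

lemma homogeneous_sum: "(\<And>i. i \<in> S \<Longrightarrow> f i \<in> homogeneous dg d) \<Longrightarrow> sum f S \<in> homogeneous dg d"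
  by (induction S rule: infinite_finite_induct) (auto intro: homogeneous_add)

lemma homogeneous_word [simp]: "word w \<in> homogeneous dg (word_deg dg w)"
  by (simp add: homogeneous_def nc_coeff_word)

lemma homogeneous_gen [simp]: "gen g \<in> homogeneous dg (dg g)"
  using homogeneous_word[of "[g]" dg] by simp

lemma homogeneous_one [simp]: "1 \<in> homogeneous dg 0"
  by (simp add: homogeneous_def nc_coeff_one)

lemma homogeneous_mult:
  fixes f g :: "('g, 'k::field) ncs"
  assumes "f \<in> homogeneous dg d" "g \<in> homogeneous dg e"
  shows "f * g \<in> homogeneous dg (d + e)"
  unfolding homogeneous_def
proof (intro CollectI allI impI)
  fix w assume "nc_coeff (f * g) w \<noteq> 0"
  then obtain p where "p \<in> splits w" "nc_coeff f (fst p) * nc_coeff g (snd p) \<noteq> 0"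
    unfolding nc_coeff_times by (metis (no_types, lifting) case_prod_beta sum.neutral)
  then show "word_deg dg w = d + e"
    using assms by (auto simp: homogeneous_def splits_def)
qed

lemma homogeneous_power:
  fixes f :: "('g, 'k::field) ncs"
  shows "f \<in> homogeneous dg 0 \<Longrightarrow> f ^ n \<in> homogeneous dg 0"
proof (induction n)
  case (Suc n)
  then show ?case using homogeneous_mult[of f dg 0 "f ^ n" 0] by simp
qed simp

lemma homogeneous_formal_sum:
  assumes "\<And>n. F n \<in> length_ge n" "\<And>n. F n \<in> homogeneous dg d"
  shows "formal_sum F \<in> homogeneous dg d"
  using assms(2) unfolding homogeneous_def nc_coeff_formal_sum[OF assms(1)] mem_Collect_eq
  by (meson sum.not_neutral_contains_not_neutral)

text \<open>
  The grading automorphism. With it the graded Leibniz rule can be stated for all series at once,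
  without decomposing them into homogeneous components.
\<close>

lift_definition twist :: "('g \<Rightarrow> int) \<Rightarrow> ('g, 'k::field) ncs \<Rightarrow> ('g, 'k) ncs"
  is "\<lambda>dg f w. (-1) powi word_deg dg w * f w" .

lemma nc_coeff_twist [simp]: "nc_coeff (twist dg f) w = (-1) powi word_deg dg w * nc_coeff f w"
  by (simp add: twist.rep_eq)

lemma cont_linear_twist: "cont_linear (twist dg)"
  by (rule cont_linearI) (auto intro!: ncs_eqI simp: algebra_simps length_ge_def)

lemma twist_homogeneous:
  assumes "f \<in> homogeneous dg d" shows "twist dg f = scal ((-1) powi d) f"
proof (rule ncs_eqI)
  show "nc_coeff (twist dg f) w = nc_coeff (scal ((-1) powi d) f) w" for w
    using assms by (cases "nc_coeff f w = 0") (auto simp: homogeneous_def)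
qed

lemma twist_word: "twist dg (word w) = scal ((-1) powi word_deg dg w) (word w)"
  by (rule twist_homogeneous) simp

lemma twist_gen: "twist dg (gen g) = scal ((-1) powi dg g) (gen g)"
  by (simp add: twist_word)

lemma twist_one [simp]: "twist dg 1 = 1"
  by (rule ncs_eqI) (simp add: nc_coeff_one)

definition graded_derivation ::
    "('g \<Rightarrow> int) \<Rightarrow> (('g, 'k::field) ncs \<Rightarrow> ('g, 'k) ncs) \<Rightarrow> bool" where
  "graded_derivation dg D \<longleftrightarrow> cont_linear D \<and>
     (\<forall>d. \<forall>x\<in>homogeneous dg d. D x \<in> homogeneous dg (d - 1)) \<and>
     (\<forall>x y. D (x * y) = D x * y + twist dg x * D y)"

lemma graded_derivationD:
  assumes "graded_derivation dg D"
  shows "cont_linear D" "x \<in> homogeneous dg d \<Longrightarrow> D x \<in> homogeneous dg (d - 1)"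
    "D (x * y) = D x * y + twist dg x * D y"
  using assms by (auto simp: graded_derivation_def)

text \<open>
  Words are homogeneous, so by density the Leibniz rule for homogeneous left factors implies the one
  with the grading automorphism.
\<close>

lemma continuous_derivation_complete_tensor:
  fixes dg :: "'g::finite \<Rightarrow> int" and D :: "('g, 'k::field) ncs \<Rightarrow> ('g, 'k) ncs"
  shows "continuous_derivation (complete_tensor dg) D \<longleftrightarrow> graded_derivation dg D"
proof
  assume "continuous_derivation (complete_tensor dg) D"
  then have add: "D (x + y) = D x + D y" and scal: "D (scal c x) = scal c (D x)"
    and deg: "x \<in> homogeneous dg d \<Longrightarrow> D x \<in> homogeneous dg (d - 1)"
    and mult: "x \<in> homogeneous dg d \<Longrightarrow> D (x * y) = D x * y + scal ((-1) powi d) (x * D y)"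
    and cont: "\<exists>m. \<forall>x\<in>length_ge m. D x \<in> length_ge n" for x y d c n
    by (auto simp: continuous_derivation_def derivation_def complete_tensor_def)
  have cl: "cont_linear D"
    using add scal cont by (simp add: cont_linear_def)
  have "D (x * y) = D x * y + twist dg x * D y" for x y
  proof (rule cont_linear_eqI[of "\<lambda>x. D (x * y)" "\<lambda>x. D x * y + twist dg x * D y"])
    show "cont_linear (\<lambda>x. D (x * y))"
      by (rule cont_linear_comp[OF cl]) (intro cont_linear_intros)
    show "cont_linear (\<lambda>x. D x * y + twist dg x * D y)"
      by (intro cont_linear_intros cl cont_linear_twist)
    show "D (word w * y) = D (word w) * y + twist dg (word w) * D y" for w
      by (simp add: mult[OF homogeneous_word] twist_word scal_mult)
  qed
  then show "graded_derivation dg D"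
    using cl deg by (auto simp: graded_derivation_def)
next
  assume D: "graded_derivation dg D"
  note cl = graded_derivationD(1)[OF D]
  have "\<exists>m. \<forall>x\<in>length_ge m. D x \<in> length_ge n" for n
    using cl unfolding cont_linear_def by blast
  then show "continuous_derivation (complete_tensor dg) D"
    using graded_derivationD[OF D]
    by (auto simp: continuous_derivation_def derivation_def complete_tensor_def cont_linear_add
        cont_linear_scal twist_homogeneous scal_mult)
qed

lemma graded_derivation_one: "graded_derivation dg D \<Longrightarrow> D 1 = 0"
  using graded_derivationD(3)[of dg D 1 1] by simp

lemma graded_derivation_unique:
  fixes dg :: "'g::finite \<Rightarrow> int" and D D' :: "('g, 'k::field) ncs \<Rightarrow> ('g, 'k) ncs"
  assumes D: "graded_derivation dg D" and D': "graded_derivation dg D'"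
    and eq: "\<And>g. D (gen g) = D' (gen g)"
  shows "D = D'"
proof (rule ext, rule cont_linear_eqI[of D D'])
  show "D (word w) = D' (word w)" for w
  proof (induction w)
    case Nil
    then show ?case by (simp add: word_Nil graded_derivation_one[OF D] graded_derivation_one[OF D'])
  next
    case (Cons g w)
    then show ?case
      by (simp only: word_Cons[of g w] graded_derivationD(3)[OF D] graded_derivationD(3)[OF D'] eq)
  qed
qed (use D D' in \<open>auto dest: graded_derivationD\<close>)

text \<open>
  \<open>D \<circ> D\<close> is a derivation without signs: in \<open>D (D (x * y))\<close> the two mixed terms \<open>\<plusminus> D x * D y\<close> have
  opposite signs, as \<open>D\<close> changes the parity of \<open>x\<close>.
\<close>

lemma graded_derivation_square_zero:
  fixes dg :: "'g::finite \<Rightarrow> int" and D :: "('g, 'k::field) ncs \<Rightarrow> ('g, 'k) ncs"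
  assumes D: "graded_derivation dg D" and gen: "\<And>g. D (D (gen g)) = 0"
  shows "D (D x) = 0"
proof -
  note cl = graded_derivationD(1)[OF D]
  have sq: "D (D (word w)) = 0" for w
  proof (induction w)
    case Nil
    then show ?case by (simp add: word_Nil graded_derivation_one[OF D] cont_linear_zero[OF cl])
  next
    case (Cons g w)
    have "D (gen g) \<in> homogeneous dg (dg g - 1)"
      by (rule graded_derivationD(2)[OF D homogeneous_gen])
    then have "twist dg (D (gen g)) = scal ((-1) powi (dg g - 1)) (D (gen g))"
      by (rule twist_homogeneous)
    then show ?case
      using Cons gen
      by (simp only: word_Cons[of g w] graded_derivationD(3)[OF D] twist_gen cont_linear_add[OF cl]
          cont_linear_scal[OF cl] scal_mult)
        (simp add: minus_one_powi)
  qed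
  show ?thesis
    by (rule cont_linear_eqI[of "\<lambda>x. D (D x)" "\<lambda>x. 0 * x", simplified])
      (use cl sq cont_linear_comp[OF cl cl] cont_linear_times_left[OF cont_linear_id, of 0] in simp_all)
qed

text \<open>The Leibniz rule forces the value of a derivation on a word to be given by this recursion.\<close>

fun leibniz :: "('g \<Rightarrow> int) \<Rightarrow> ('g \<Rightarrow> ('g, 'k::field) ncs) \<Rightarrow> 'g list \<Rightarrow> ('g, 'k) ncs" where
  "leibniz dg \<delta> [] = 0"
| "leibniz dg \<delta> (g # w) = \<delta> g * word w + scal ((-1) powi dg g) (gen g * leibniz dg \<delta> w)"

definition derivation_ext ::
    "('g::finite \<Rightarrow> int) \<Rightarrow> ('g \<Rightarrow> ('g, 'k::field) ncs) \<Rightarrow> ('g, 'k) ncs \<Rightarrow> ('g, 'k) ncs" where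
  "derivation_ext dg \<delta> = word_ext (leibniz dg \<delta>)"

context
  fixes dg :: "'g::finite \<Rightarrow> int" and \<delta> :: "'g \<Rightarrow> ('g, 'k::field) ncs"
  assumes \<delta>_length: "\<And>g. \<delta> g \<in> length_ge 1"
    and \<delta>_deg: "\<And>g. \<delta> g \<in> homogeneous dg (dg g - 1)"
begin

lemma leibniz_length: "leibniz dg \<delta> w \<in> length_ge (length w)"
proof (induction w)
  case (Cons g w)
  have "\<delta> g * word w \<in> length_ge (1 + length w)"
    by (intro length_ge_mult \<delta>_length) (simp add: length_ge_word)
  moreover have "gen g * leibniz dg \<delta> w \<in> length_ge (1 + length w)"
    by (intro length_ge_mult Cons) (simp add: length_ge_word)
  ultimately show ?case by (simp add: length_ge_add length_ge_scal)
qed simp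

lemma derivation_ext_word: "derivation_ext dg \<delta> (word w) = leibniz dg \<delta> w"
  unfolding derivation_ext_def by (rule word_ext_word[OF leibniz_length])

lemma derivation_ext_gen: "derivation_ext dg \<delta> (gen g) = \<delta> g"
  by (simp add: derivation_ext_word word_Nil)

lemma derivation_ext_length_ge: "x \<in> length_ge n \<Longrightarrow> derivation_ext dg \<delta> x \<in> length_ge n"
  unfolding derivation_ext_def by (rule word_ext_length_ge[OF leibniz_length])

lemma leibniz_append:
  "leibniz dg \<delta> (u @ v)
     = leibniz dg \<delta> u * word v + scal ((-1) powi word_deg dg u) (word u * leibniz dg \<delta> v)"
proof (induction u)
  case Nil
  then show ?case by (simp add: word_Nil)
next
  case (Cons g u)
  then show ?case
    by (simp add: word_Cons[of g u] word_mult[symmetric, of u v] distrib_right distrib_left scal_mult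
        ncs.scale_right_distrib power_int_add mult.assoc add.assoc)
qed

lemma leibniz_deg: "leibniz dg \<delta> w \<in> homogeneous dg (word_deg dg w - 1)"
proof (induction w)
  case (Cons g w)
  have "\<delta> g * word w \<in> homogeneous dg (dg g - 1 + word_deg dg w)"
    by (intro homogeneous_mult \<delta>_deg homogeneous_word)
  moreover have "gen g * leibniz dg \<delta> w \<in> homogeneous dg (dg g + (word_deg dg w - 1))"
    by (intro homogeneous_mult Cons homogeneous_gen)
  ultimately show ?case
    by (auto intro!: homogeneous_add homogeneous_scal simp: algebra_simps)
qed simp

lemma graded_derivation_ext: "graded_derivation dg (derivation_ext dg \<delta>)"
  unfolding graded_derivation_def
proof (intro conjI allI ballI)
  let ?D = "derivation_ext dg \<delta>"
  show cl: "cont_linear ?D"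
    unfolding derivation_ext_def by (rule cont_linear_word_ext[OF leibniz_length])
  fix x y :: "('g, 'k) ncs"
  have words: "?D (word u * word v) = ?D (word u) * word v + twist dg (word u) * ?D (word v)" for u v
    by (simp add: word_mult derivation_ext_word leibniz_append twist_word scal_mult)
  show "?D (x * y) = ?D x * y + twist dg x * ?D y"
    by (rule cont_bilinear_eqI[of "\<lambda>x y. ?D (x * y)" "\<lambda>x y. ?D x * y + twist dg x * ?D y", OF _ _ _ _ words])
      (intro cont_linear_comp[OF cl] cont_linear_intros cl cont_linear_twist)+
next
  fix d and x :: "('g, 'k) ncs" assume x: "x \<in> homogeneous dg d"
  show "derivation_ext dg \<delta> x \<in> homogeneous dg (d - 1)"
    unfolding homogeneous_def
  proof (intro CollectI allI impI)
    fix w assume "nc_coeff (derivation_ext dg \<delta> x) w \<noteq> 0"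
    then obtain v where "nc_coeff x v \<noteq> 0" "nc_coeff (leibniz dg \<delta> v) w \<noteq> 0"
      unfolding derivation_ext_def nc_coeff_word_ext
      by (metis (no_types, lifting) mult_zero_left mult_zero_right sum.neutral)
    then show "word_deg dg w = d - 1"
      using x leibniz_deg[of v] by (auto simp: homogeneous_def)
  qed
qed

end

section \<open>Power series in an inner derivation and the exponential\<close>

definition ad :: "('g, 'k::field) ncs \<Rightarrow> ('g, 'k) ncs \<Rightarrow> ('g, 'k) ncs" where
  "ad z x = z * x - x * z"

definition ad_series :: "'k::field fps \<Rightarrow> ('g, 'k) ncs \<Rightarrow> ('g, 'k) ncs \<Rightarrow> ('g, 'k) ncs" where
  "ad_series p z x = formal_sum (\<lambda>i. scal (fps_nth p i) ((ad z ^^ i) x))"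

definition nc_exp :: "('g, 'k::field_char_0) ncs \<Rightarrow> ('g, 'k) ncs" where
  "nc_exp z = formal_sum (\<lambda>n. scal (1 / fact n) (z ^ n))"

text \<open>The series \<open>(e\<^sup>t - 1) / t\<close>, which governs the derivative of the exponential.\<close>

definition dexp_fps :: "'k::field_char_0 fps" where
  "dexp_fps = Abs_fps (\<lambda>n. 1 / fact (Suc n))"

definition bernoulli_fps :: "'k::field_char_0 fps" where
  "bernoulli_fps = Abs_fps (\<lambda>n. bernoulli n / fact n)"

lemma dexp_bernoulli_fps: "dexp_fps * bernoulli_fps = (1 :: 'k::field_char_0 fps)"
proof -
  let ?e = "fps_exp 1 - 1 :: 'k fps"
  have e: "dexp_fps * fps_X = ?e"
  proof (rule fps_ext)
    show "fps_nth (dexp_fps * fps_X) n = fps_nth ?e n" for n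
      by (cases n) (simp_all add: dexp_fps_def del: fact_Suc)
  qed
  have bern: "bernoulli_fps = fps_X / ?e"
    by (rule fps_ext) (simp add: bernoulli_fps_def bernoulli_def)
  have dvd: "?e dvd fps_X"
  proof -
    have "fps_nth (dexp_fps :: 'k fps) 0 \<noteq> 0" by (simp add: dexp_fps_def)
    then have "?e * inverse dexp_fps = fps_X"
      by (simp add: e[symmetric] mult.commute mult.left_commute inverse_mult_eq_1')
    then show ?thesis by (metis dvd_triv_left)
  qed
  have "bernoulli_fps * ?e = fps_X"
    unfolding bern by (rule dvd_div_mult_self[OF dvd])
  then have "(dexp_fps * bernoulli_fps) * fps_X = (1 :: 'k fps) * fps_X"
    by (simp add: e[symmetric] mult_ac)
  then show ?thesis by (subst (asm) mult_cancel_right) simp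
qed

context
  fixes z :: "('g::finite, 'k::field_char_0) ncs"
  assumes z_length: "z \<in> length_ge 1"
begin

lemma cont_linear_ad: "cont_linear (ad z)"
  unfolding ad_def by (intro cont_linear_intros)

lemma ad_power_scal: "(ad z ^^ i) (scal c x) = scal c ((ad z ^^ i) x)"
  by (induction i) (simp_all add: cont_linear_scal[OF cont_linear_ad])

lemma ad_power_add: "(ad z ^^ i) (x + y) = (ad z ^^ i) x + (ad z ^^ i) y"
  by (induction i) (simp_all add: cont_linear_add[OF cont_linear_ad])

lemma ad_power_length:
  assumes "x \<in> length_ge m" shows "(ad z ^^ i) x \<in> length_ge (m + i)"
proof (induction i)
  case (Suc i)
  let ?y = "(ad z ^^ i) x"
  have "z * ?y \<in> length_ge (1 + (m + i))" "?y * z \<in> length_ge ((m + i) + 1)"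
    by (intro length_ge_mult Suc z_length)+
  then show ?case by (simp add: ad_def[of z ?y] length_ge_diff)
qed (use assms in simp)

lemma ad_series_terms_length: "scal c ((ad z ^^ i) x) \<in> length_ge i"
  using ad_power_length[of x 0 i] by (simp add: length_ge_scal)

lemma nc_coeff_ad_series:
  "nc_coeff (ad_series p z x) w = (\<Sum>i\<le>length w. fps_nth p i * nc_coeff ((ad z ^^ i) x) w)"
  unfolding ad_series_def by (simp add: nc_coeff_formal_sum[OF ad_series_terms_length])

lemma ad_series_length:
  assumes "x \<in> length_ge m" shows "ad_series p z x \<in> length_ge m"
  unfolding ad_series_def
proof (rule formal_sum_length_ge[OF ad_series_terms_length])
  show "scal (fps_nth p n) ((ad z ^^ n) x) \<in> length_ge m" for n
    using ad_power_length[OF assms, of n] by (auto intro: length_ge_scal length_ge_mono)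
qed

lemma cont_linear_ad_series: "cont_linear (ad_series p z)"
  by (rule cont_linearI)
    (auto intro!: ncs_eqI ad_series_length simp: nc_coeff_ad_series ad_power_add ad_power_scal
      algebra_simps sum.distrib sum_distrib_left)

text \<open>
  Substituting the commutator with \<open>z\<close> for the variable is multiplicative, the product of power series
  becoming composition. It converges because the commutator with \<open>z\<close> raises the length.
\<close>

lemma ad_series_mult: "ad_series p z (ad_series q z x) = ad_series (p * q) z x"
proof -
  have "ad_series p z (ad_series q z x)
      = formal_sum (\<lambda>j. ad_series p z (scal (fps_nth q j) ((ad z ^^ j) x)))"
    unfolding ad_series_def[of q]
    by (rule cont_linear_formal_sum[OF cont_linear_ad_series ad_series_terms_length])
      (rule ad_series_length[OF ad_series_terms_length])
  also have "\<dots> = formal_sum (\<lambda>j. formal_sum (\<lambda>i.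
      scal (fps_nth q j * fps_nth p i) ((ad z ^^ (i + j)) x)))"
    by (simp add: ad_series_def ad_power_scal funpow_add mult.commute)
  also have "\<dots> = formal_sum (\<lambda>n. \<Sum>j\<le>n.
      scal (fps_nth q j * fps_nth p (n - j)) ((ad z ^^ (n - j + j)) x))"
    by (rule formal_sum_formal_sum) (metis add.commute ad_series_terms_length)
  also have "\<dots> = ad_series (p * q) z x"
    unfolding ad_series_def
    by (simp add: mult.commute[of p] fps_mult_nth ncs.scale_sum_left atLeast0AtMost)
  finally show ?thesis .
qed

lemma ad_series_one: "ad_series 1 z x = x"
  unfolding ad_series_def by (subst formal_sum_only_0) auto

lemma nc_exp_terms_length: "scal (1 / fact n) (z ^ n) \<in> length_ge n"
  by (intro length_ge_scal length_ge_power z_length)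

text \<open>
  As \<open>e\<^sup>z - 1\<close> has no constant term, \<open>x = - x * (e\<^sup>z - 1)\<close> pushes the lowest length of \<open>x\<close> up
  indefinitely.
\<close>

lemma nc_exp_cancel:
  assumes "x * nc_exp z = 0" shows "x = 0"
proof -
  have "nc_exp z - 1 \<in> length_ge 1"
    unfolding nc_exp_def using formal_sum_tail[of "\<lambda>n. scal (1 / fact n) (z ^ n)" 1, OF nc_exp_terms_length]
    by simp
  have "x \<in> length_ge n" for n
  proof (induction n)
    case (Suc n)
    have "x * (nc_exp z - 1) \<in> length_ge (n + 1)"
      by (intro length_ge_mult Suc) fact
    moreover have "x * (nc_exp z - 1) = - x"
      using assms by (simp add: algebra_simps)
    ultimately show ?case using length_ge_uminus[of "- x" "Suc n"] by simp
  qed simp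
  then show ?thesis by (rule length_ge_all_imp_zero)
qed

text \<open>
  For \<open>n > 0\<close> the recursion says \<open>P n = (\<Sum>p + q = n - 1. z\<^sup>p * w * z\<^sup>q)\<close>, which is the Leibniz rule for \<open>z\<^sup>n\<close> with
  \<open>w\<close> the derivative of \<open>z\<close>. Moving every power of \<open>z\<close> to the right of \<open>w\<close> by
  \<open>z * v = ad z v + v * z\<close> and collecting terms produces binomial coefficients by Pascal's rule.
\<close>

lemma leibniz_powers_binomial:
  assumes "P 0 = 0" "\<And>n. P (Suc n) = w * z ^ n + z * P n"
  shows "P (Suc n) = (\<Sum>k\<le>n. scal (of_nat (Suc n choose Suc k)) ((ad z ^^ k) w * z ^ (n - k)))"
proof (induction n)
  case 0
  then show ?case by (simp add: assms)
next
  case (Suc n)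
  let ?A = "\<lambda>k. (ad z ^^ k) w"
  have zA: "z * ?A k = ?A (Suc k) + ?A k * z" for k
    by (simp add: ad_def)
  have zA': "z * (?A k * z ^ (n - k)) = ?A (Suc k) * z ^ (Suc n - Suc k) + ?A k * z ^ (Suc n - k)"
    if "k \<le> n" for k
    using that by (simp only: mult.assoc[symmetric] zA)
      (simp add: distrib_right mult.assoc Suc_diff_le)
  have "P (Suc (Suc n)) = w * z ^ Suc n
      + (\<Sum>k\<le>n. scal (of_nat (Suc n choose Suc k)) (z * (?A k * z ^ (n - k))))"
    by (simp add: assms(2)[of "Suc n"] Suc.IH sum_distrib_left scal_mult)
  also have "\<dots> = (w * z ^ Suc n
        + (\<Sum>k\<le>n. scal (of_nat (Suc n choose Suc k)) (?A (Suc k) * z ^ (Suc n - Suc k))))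
      + (\<Sum>k\<le>n. scal (of_nat (Suc n choose Suc k)) (?A k * z ^ (Suc n - k)))"
    by (simp add: zA' ncs.scale_right_distrib sum.distrib)
  also have "w * z ^ Suc n
        + (\<Sum>k\<le>n. scal (of_nat (Suc n choose Suc k)) (?A (Suc k) * z ^ (Suc n - Suc k)))
      = (\<Sum>k\<le>Suc n. scal (of_nat (Suc n choose k)) (?A k * z ^ (Suc n - k)))"
    by (subst sum.atMost_Suc_shift) simp
  also have "(\<Sum>k\<le>n. scal (of_nat (Suc n choose Suc k)) (?A k * z ^ (Suc n - k)))
      = (\<Sum>k\<le>Suc n. scal (of_nat (Suc n choose Suc k)) (?A k * z ^ (Suc n - k)))"
    by (simp add: binomial_eq_0)
  also have "(\<Sum>k\<le>Suc n. scal (of_nat (Suc n choose k)) (?A k * z ^ (Suc n - k))) + \<dots>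
      = (\<Sum>k\<le>Suc n. scal (of_nat (Suc (Suc n) choose Suc k)) (?A k * z ^ (Suc n - k)))"
    by (simp add: sum.distrib[symmetric] ncs.scale_left_distrib[symmetric] del: sum.atMost_Suc)
  finally show ?case .
qed

text \<open>
  The noncommutative chain rule for the exponential. It applies to everything that behaves like an
  ungraded derivation on the powers of \<open>z\<close>.
\<close>

lemma derivation_nc_exp:
  assumes T: "cont_linear T" and len: "\<And>n x. x \<in> length_ge n \<Longrightarrow> T x \<in> length_ge n"
    and one: "T 1 = 0" and pow: "\<And>n. T (z * z ^ n) = T z * z ^ n + z * T (z ^ n)"
  shows "T (nc_exp z) = ad_series dexp_fps z (T z) * nc_exp z"
proof -
  define F where "F n = scal (1 / fact n) (T (z ^ n))" for n
  have F_len: "F n \<in> length_ge n" for n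
    unfolding F_def by (intro length_ge_scal len length_ge_power z_length)
  have "F (Suc n) = (\<Sum>k\<le>n. scal (fps_nth dexp_fps k) ((ad z ^^ k) (T z))
      * scal (1 / fact (n - k)) (z ^ (n - k)))" for n
  proof -
    have "of_nat (Suc n choose Suc k) / fact (Suc n) = (1 / fact (Suc k) * (1 / fact (n - k)) :: 'k)"
      if "k \<le> n" for k
      using that binomial_fact[of "Suc k" "Suc n", where 'a = 'k] by (simp del: fact_Suc)
    then have "F (Suc n) = (\<Sum>k\<le>n. scal (1 / fact (Suc k) * (1 / fact (n - k)))
        ((ad z ^^ k) (T z) * z ^ (n - k)))"
      unfolding F_def using leibniz_powers_binomial[of "\<lambda>n. T (z ^ n)" "T z" n] one pow
      by (simp add: ncs.scale_sum_right del: fact_Suc)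
    then show ?thesis
      by (simp add: dexp_fps_def scal_mult mult.commute del: fact_Suc)
  qed
  then have "formal_sum (\<lambda>n. F (Suc n)) = ad_series dexp_fps z (T z) * nc_exp z"
    unfolding ad_series_def nc_exp_def
    by (subst formal_sum_times[OF ad_series_terms_length nc_exp_terms_length]) simp
  (* The shift is harmless: F 0 = 0, and F (Suc (length w)) has no coefficient at w. *)
  moreover have "formal_sum F = formal_sum (\<lambda>n. F (Suc n))"
  proof (rule ncs_eqI)
    fix w :: "'g list"
    have F0: "F 0 = 0" by (simp add: F_def one)
    have "nc_coeff (F (Suc (length w))) w = 0"
      using F_len[of "Suc (length w)"] by (simp add: length_ge_def)
    moreover have "F (Suc n) \<in> length_ge n" for n
      using F_len[of "Suc n"] by (rule length_ge_mono) simp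
    ultimately show "nc_coeff (formal_sum F) w = nc_coeff (formal_sum (\<lambda>n. F (Suc n))) w"
      using sum.atMost_Suc_shift[of "\<lambda>n. nc_coeff (F n) w" "length w"]
      by (simp add: nc_coeff_formal_sum F_len F0)
  qed
  moreover have "T (nc_exp z) = formal_sum F"
    unfolding nc_exp_def F_def
    by (subst cont_linear_formal_sum[OF T nc_exp_terms_length])
      (simp_all only: cont_linear_scal[OF T] length_ge_scal len length_ge_power[OF z_length])
  ultimately show ?thesis by simp
qed

text \<open>
  With \<open>E = e\<^sup>z\<close>, the chain rule turns the formula for \<open>D z\<close> into \<open>D E = E * b - a * E\<close>: the two
  parts of \<open>D z\<close> contribute \<open>E * b - b * E\<close> and, as the Bernoulli series is inverse to
  \<open>(e\<^sup>t - 1) / t\<close>, \<open>(b - a) * E\<close>. From this \<open>D (D E) = 0\<close> is a direct computation, and the chain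
  rule for the ungraded derivation \<open>D \<circ> D\<close> gives back \<open>D (D z) = 0\<close>.
\<close>

lemma bernoulli_derivation_square_zero:
  assumes D: "graded_derivation dg D" and len: "\<And>n x. x \<in> length_ge n \<Longrightarrow> D x \<in> length_ge n"
    and a: "a \<in> homogeneous dg (-1)" "D a = - (a * a)"
    and b: "b \<in> homogeneous dg (-1)" "D b = - (b * b)"
    and z: "z \<in> homogeneous dg 0" "D z = ad z b + ad_series bernoulli_fps z (b - a)"
  shows "D (D z) = 0"
proof -
  define E where "E = nc_exp z"
  note cl = graded_derivationD(1)[OF D] and mult = graded_derivationD(3)[OF D]
  have tz: "twist dg x = x" if "x \<in> homogeneous dg 0" for x :: "('g, 'k) ncs"
    using twist_homogeneous[OF that] by simp
  have todd: "twist dg x = - x" if "x \<in> homogeneous dg (-1)" for x :: "('g, 'k) ncs"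
    using twist_homogeneous[OF that] by simp
  have zn: "z ^ n \<in> homogeneous dg 0" for n by (rule homogeneous_power[OF z(1)])
  have E0: "E \<in> homogeneous dg 0"
    unfolding E_def nc_exp_def
    by (rule homogeneous_formal_sum[OF nc_exp_terms_length]) (intro homogeneous_scal zn)
  have Dz: "D z \<in> homogeneous dg (-1)" using graded_derivationD(2)[OF D z(1)] by simp
  have DE: "D E = ad_series dexp_fps z (D z) * E"
    unfolding E_def
    by (rule derivation_nc_exp[OF cl len graded_derivation_one[OF D]]) (simp_all add: mult tz[OF z(1)])
  have DDE: "D (D E) = ad_series dexp_fps z (D (D z)) * E"
    unfolding E_def
    by (rule derivation_nc_exp[OF cont_linear_comp[OF cl cl]])
      (simp_all add: len graded_derivation_one[OF D] cont_linear_zero[OF cl] cont_linear_add[OF cl]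
        mult tz[OF z(1)] todd[OF Dz])
  (* The chain rule for the inner derivation x \<mapsto> x * b - b * x, whose value on z is ad z b. *)
  have inner: "E * b - b * E = ad_series dexp_fps z (ad z b) * E"
    unfolding E_def ad_def
    by (rule derivation_nc_exp[of "\<lambda>x. x * b - b * x"])
      (auto intro!: cont_linear_intros intro: length_ge_diff[OF length_ge_mult_right length_ge_mult_left]
        simp: algebra_simps)
  have "ad_series dexp_fps z (D z) = ad_series dexp_fps z (ad z b) + (b - a)"
    by (simp add: z(2) cont_linear_add[OF cont_linear_ad_series] ad_series_mult dexp_bernoulli_fps
        ad_series_one)
  then have DE': "D E = E * b - a * E"
    by (simp add: DE distrib_right inner[symmetric]) (simp add: algebra_simps)
  have "D (D E) = (E * b - a * E) * b - E * (b * b) - (- (a * a) * E - a * (E * b - a * E))"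
    unfolding DE' cont_linear_diff[OF cl] mult tz[OF E0] todd[OF a(1)] a(2) b(2)
    by (simp only: mult_minus_left mult_minus_right diff_conv_add_uminus)
  also have "\<dots> = 0"
    by (simp add: algebra_simps)
  finally have "ad_series dexp_fps z (D (D z)) * nc_exp z = 0"
    unfolding DDE unfolding E_def .
  then have "ad_series dexp_fps z (D (D z)) = 0"
    by (rule nc_exp_cancel)
  then have "ad_series bernoulli_fps z (ad_series dexp_fps z (D (D z))) = 0"
    by (simp add: cont_linear_zero[OF cont_linear_ad_series])
  then show ?thesis
    by (simp add: ad_series_mult mult.commute[of bernoulli_fps] dexp_bernoulli_fps ad_series_one)
qed

end

text \<open>The binomial expansion of an iterated commutator, left and right multiplication commuting.\<close>

lemma ad_power_binomial:
  "(ad z ^^ n) x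
     = (\<Sum>p\<le>n. scal ((-1) ^ (n - p) * of_nat (n choose p)) (z ^ p * x * z ^ (n - p)))"
proof (induction n)
  case (Suc n)
  let ?t = "\<lambda>p q. z ^ p * x * z ^ q"
  have "(ad z ^^ Suc n) x = (\<Sum>p\<le>n. scal ((-1) ^ (n - p) * of_nat (n choose p)) (?t (Suc p) (n - p)))
      + (\<Sum>p\<le>n. scal ((-1) ^ (Suc n - p) * of_nat (n choose p)) (?t p (Suc n - p)))"
  proof -
    have t: "z * ?t p q = ?t (Suc p) q" "?t p q * z = ?t p (Suc q)" for p q
      by (simp_all add: mult.assoc power_commutes)
    have neg: "(\<Sum>p\<le>n. scal ((-1) ^ (Suc n - p) * of_nat (n choose p)) (?t p (Suc n - p)))
        = - (\<Sum>p\<le>n. scal ((-1) ^ (n - p) * of_nat (n choose p)) (?t p (Suc (n - p))))"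
      unfolding sum_negf[symmetric] by (intro sum.cong) (simp_all add: Suc_diff_le)
    show ?thesis
      unfolding neg funpow.simps o_apply Suc ad_def sum_distrib_left sum_distrib_right scal_mult t
      by (rule diff_conv_add_uminus)
  qed
  also have "(\<Sum>p\<le>n. scal ((-1) ^ (Suc n - p) * of_nat (n choose p)) (?t p (Suc n - p)))
     = scal ((-1) ^ Suc n) (?t 0 (Suc n)) +
       (\<Sum>p\<le>n. scal ((-1) ^ (n - p) * of_nat (n choose Suc p)) (?t (Suc p) (n - p)))"
  proof -
    have "(\<Sum>p\<le>n. scal ((-1) ^ (Suc n - p) * of_nat (n choose p)) (?t p (Suc n - p)))
      = (\<Sum>p\<le>Suc n. scal ((-1) ^ (Suc n - p) * of_nat (n choose p)) (?t p (Suc n - p)))"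
      by (simp add: binomial_eq_0)
    then show ?thesis by (subst (asm) sum.atMost_Suc_shift) simp
  qed
  also have "(\<Sum>p\<le>n. scal ((-1) ^ (n - p) * of_nat (n choose p)) (?t (Suc p) (n - p)))
      + (scal ((-1) ^ Suc n) (?t 0 (Suc n)) +
       (\<Sum>p\<le>n. scal ((-1) ^ (n - p) * of_nat (n choose Suc p)) (?t (Suc p) (n - p))))
     = scal ((-1) ^ Suc n) (?t 0 (Suc n)) +
       (\<Sum>p\<le>n. scal ((-1) ^ (n - p) * of_nat (Suc n choose Suc p)) (?t (Suc p) (n - p)))"
    by (simp only: add.left_commute[of "sum _ _"] sum.distrib[symmetric] binomial_Suc_Suc of_nat_add
        ncs.scale_left_distrib[symmetric] distrib_left[symmetric])
  also have "\<dots> = (\<Sum>p\<le>Suc n. scal ((-1) ^ (Suc n - p) * of_nat (Suc n choose p)) (?t p (Suc n - p)))"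
    by (subst sum.atMost_Suc_shift) simp
  finally show ?case .
qed simp

lemma bernoulli_ad_power:
  fixes z x :: "('g, 'k::field_char_0) ncs"
  shows "(\<Sum>(p, q)\<in>{(p, q). p + q = n}. scal ((-1) ^ q * (bernoulli n / (fact p * fact q)))
            (z ^ p * x * z ^ q))
       = scal (fps_nth bernoulli_fps n) ((ad z ^^ n) x)"
proof -
  have "(\<Sum>(p, q)\<in>{(p, q). p + q = n}. scal ((-1) ^ q * (bernoulli n / (fact p * fact q)))
            (z ^ p * x * z ^ q))
      = (\<Sum>p\<le>n. scal ((-1) ^ (n - p) * (bernoulli n / (fact p * fact (n - p))))
            (z ^ p * x * z ^ (n - p)))"
    by (rule sum.reindex_bij_witness[of _ "\<lambda>p. (p, n - p)" fst]) auto
  also have "\<dots> = scal (fps_nth bernoulli_fps n) ((ad z ^^ n) x)"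
    unfolding ad_power_binomial ncs.scale_sum_right bernoulli_fps_def
    by (intro sum.cong) (simp_all add: binomial_fact mult.commute mult.left_commute)
  finally show ?thesis .
qed

section \<open>Complete free Lie algebras\<close>

lemma nc_coeff_comm:
  "nc_coeff (comm dg f g) w = (\<Sum>(u, v)\<in>splits w. nc_coeff f u * nc_coeff g v
      - (-1) powi (word_deg dg u * word_deg dg v) * (nc_coeff g u * nc_coeff f v))"
  by (simp add: comm.rep_eq)

lemma length_ge_comm:
  fixes f g :: "('g, 'k::field) ncs"
  assumes "f \<in> length_ge m" "g \<in> length_ge n"
  shows "comm dg f g \<in> length_ge (m + n)"
  unfolding length_ge_def
proof (intro CollectI allI impI)
  fix w :: "'g list" assume w: "length w < m + n"
  have *: "nc_coeff f u * nc_coeff g v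
      - (-1) powi (word_deg dg u * word_deg dg v) * (nc_coeff g u * nc_coeff f v) = 0"
    if "(u, v) \<in> splits w" for u v
  proof -
    have "length u < m \<or> length v < n" "length v < m \<or> length u < n"
      using that w by (auto simp: splits_def)
    then show ?thesis using assms by (auto simp: length_ge_def)
  qed
  show "nc_coeff (comm dg f g) w = 0"
    unfolding nc_coeff_comm
    by (intro sum.neutral ballI) (simp only: split_paired_all prod.case *)
qed

lemma homogeneous_comm:
  assumes "f \<in> homogeneous dg' d" "g \<in> homogeneous dg' e"
  shows "comm dg f g \<in> homogeneous dg' (d + e)"
  unfolding homogeneous_def
proof (intro CollectI allI impI)
  fix w assume "nc_coeff (comm dg f g) w \<noteq> 0"
  then obtain p where p: "p \<in> splits w"
    and "nc_coeff f (fst p) * nc_coeff g (snd p) - (-1) powi (word_deg dg (fst p) * word_deg dg (snd p))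
      * (nc_coeff g (fst p) * nc_coeff f (snd p)) \<noteq> 0"
    unfolding nc_coeff_comm by (metis (no_types, lifting) case_prod_beta sum.neutral)
  then have "nc_coeff f (fst p) * nc_coeff g (snd p) \<noteq> 0 \<or> nc_coeff g (fst p) * nc_coeff f (snd p) \<noteq> 0"
    by auto
  then show "word_deg dg' w = d + e"
    using assms p by (auto simp: homogeneous_def splits_def)
qed

lemma cont_linear_comm_right: "cont_linear (comm dg f)"
proof (rule cont_linearI)
  show "comm dg f (x + y) = comm dg f x + comm dg f y" for x y
    by (rule ncs_eqI) (simp add: nc_coeff_comm case_prod_beta sum.distrib[symmetric] algebra_simps)
  show "comm dg f (scal c x) = scal c (comm dg f x)" for c x
    by (rule ncs_eqI) (simp add: nc_coeff_comm case_prod_beta sum_distrib_left algebra_simps)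
  show "comm dg f x \<in> length_ge n" if "x \<in> length_ge n" for n x
    using length_ge_comm[of f 0 x n] that by simp
qed

lemma cont_linear_comm_left: "cont_linear (\<lambda>x. comm dg x f)"
proof (rule cont_linearI)
  show "comm dg (x + y) f = comm dg x f + comm dg y f" for x y
    by (rule ncs_eqI) (simp add: nc_coeff_comm case_prod_beta sum.distrib[symmetric] algebra_simps)
  show "comm dg (scal c x) f = scal c (comm dg x f)" for c x
    by (rule ncs_eqI) (simp add: nc_coeff_comm case_prod_beta sum_distrib_left algebra_simps)
  show "comm dg x f \<in> length_ge n" if "x \<in> length_ge n" for n x
    using length_ge_comm[of x n f 0] that by simp
qed

text \<open>
  For \<open>f\<close> of degree \<open>0\<close> no signs occur, whatever the degrees in \<open>g\<close>; it suffices to look at words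
  \<open>g\<close>, which are homogeneous.
\<close>

lemma comm_degree_0:
  fixes f :: "('g::finite, 'k::field) ncs"
  assumes "f \<in> homogeneous dg 0" shows "comm dg f g = ad f g"
  by (rule cont_linear_eqI[OF cont_linear_comm_right])
    (auto intro!: cont_linear_intros simp: ad_def[abs_def] comm_homogeneous[OF assms homogeneous_word])

lemma twist_comm:
  fixes x y :: "('g::finite, 'k::field) ncs"
  shows "twist dg (comm dg x y) = comm dg (twist dg x) (twist dg y)"
proof (rule cont_bilinear_eqI[of "\<lambda>x y. twist dg (comm dg x y)"
      "\<lambda>x y. comm dg (twist dg x) (twist dg y)"])
  show "twist dg (comm dg (word u) (word v)) = comm dg (twist dg (word u)) (twist dg (word v))" for u v
    by (simp add: twist_word cont_linear_scal[OF cont_linear_comm_left]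
        cont_linear_scal[OF cont_linear_comm_right] power_int_add
        twist_homogeneous[OF homogeneous_comm[OF homogeneous_word homogeneous_word]])
qed (intro cont_linear_comp[OF cont_linear_twist] cont_linear_comp[OF cont_linear_comm_left]
  cont_linear_comp[OF cont_linear_comm_right] cont_linear_comm_left cont_linear_comm_right
  cont_linear_twist)+

text \<open>
  On words of degrees \<open>d\<close> and \<open>e\<close>, applying \<open>D\<close> to one factor changes the sign \<open>(-1)\<^bsup>d * e\<^esup>\<close> of the
  commutator by \<open>(-1)\<^sup>e\<close> or \<open>(-1)\<^sup>d\<close>. These changes match the signs in the Leibniz rule for the two
  products in the commutator.
\<close>

lemma graded_derivation_comm:
  fixes x y :: "('g::finite, 'k::field) ncs"
  assumes D: "graded_derivation dg D"
  shows "D (comm dg x y) = comm dg (D x) y + comm dg (twist dg x) (D y)"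
proof (rule cont_bilinear_eqI[of "\<lambda>x y. D (comm dg x y)"
      "\<lambda>x y. comm dg (D x) y + comm dg (twist dg x) (D y)"])
  note cl = graded_derivationD(1)[OF D] and mult = graded_derivationD(3)[OF D]
  fix u v :: "'g list"
  let ?d = "word_deg dg u" and ?e = "word_deg dg v"
  have u: "word u \<in> homogeneous dg ?d" and v: "word v \<in> homogeneous dg ?e" by simp_all
  note Du = graded_derivationD(2)[OF D u] and Dv = graded_derivationD(2)[OF D v]
  have "D (comm dg (word u) (word v)) =
      D (word u) * word v + scal ((-1) powi ?d) (word u * D (word v))
      - scal ((-1) powi (?d * ?e)) (D (word v) * word u + scal ((-1) powi ?e) (word v * D (word u)))"
    by (simp only: comm_homogeneous[OF u v] cont_linear_diff[OF cl] cont_linear_scal[OF cl] mult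
        twist_word scal_mult)
  also have "\<dots> = comm dg (D (word u)) (word v) + comm dg (twist dg (word u)) (D (word v))"
    unfolding twist_word comm_homogeneous[OF Du v] cont_linear_scal[OF cont_linear_comm_left]
      comm_homogeneous[OF u Dv] minus_one_powi
    by (auto simp: algebra_simps)
  finally show "D (comm dg (word u) (word v))
      = comm dg (D (word u)) (word v) + comm dg (twist dg (word u)) (D (word v))" .
qed (intro cont_linear_comp[OF graded_derivationD(1)[OF D]] cont_linear_comp[OF cont_linear_comm_left]
  cont_linear_comp[OF cont_linear_comm_right] cont_linear_comm_left cont_linear_comm_right
  cont_linear_plus cont_linear_twist graded_derivationD(1)[OF D])+

subsection \<open>Lie monomials\<close>

text \<open>
  Iterated brackets of generators are homogeneous for both the grading and the word length, and they
  span the free Lie algebra. This reduces linear statements about Lie elements to homogeneous ones.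
\<close>

inductive_set lie_monomial :: "('g \<Rightarrow> int) \<Rightarrow> ('g, 'k::field) ncs set" for dg :: "'g \<Rightarrow> int" where
  gen: "gen g \<in> lie_monomial dg"
| comm: "x \<in> lie_monomial dg \<Longrightarrow> y \<in> lie_monomial dg \<Longrightarrow> comm dg x y \<in> lie_monomial dg"

lemma lie_monomial_free_lie: "x \<in> lie_monomial dg \<Longrightarrow> x \<in> free_lie dg"
  by (induction rule: lie_monomial.induct) (auto intro: free_lie.intros)

lemma lie_monomial_homogeneous:
  assumes "x \<in> lie_monomial dg" obtains d where "x \<in> homogeneous dg d"
  using assms
proof (induction arbitrary: thesis rule: lie_monomial.induct)
  case (comm x y)
  then show ?case by (metis homogeneous_comm)
qed (metis homogeneous_gen)

lemma word_deg_length: "word_deg (\<lambda>_. 1) w = int (length w)"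
  by (induction w) auto

lemma lie_monomial_length:
  assumes "x \<in> lie_monomial dg" obtains n where "n \<ge> 1" "x \<in> homogeneous (\<lambda>_. 1) (int n)"
  using assms
proof (induction arbitrary: thesis rule: lie_monomial.induct)
  case (gen g)
  show ?case by (rule gen[of 1]) (use homogeneous_gen[of g "\<lambda>_. 1"] in simp_all)
next
  case (comm x y)
  obtain m n where "m \<ge> 1" "x \<in> homogeneous (\<lambda>_. 1) (int m)" "n \<ge> 1" "y \<in> homogeneous (\<lambda>_. 1) (int n)"
    using comm.IH by metis
  then show ?case
    using comm.prems[of "m + n"] homogeneous_comm[of x "\<lambda>_. 1" "int m" y "int n" dg] by auto
qed

lemma free_lie_span:
  fixes x :: "('g::finite, 'k::field) ncs"
  assumes "x \<in> free_lie dg" shows "x \<in> ncs.span (lie_monomial dg)"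
  using assms
proof (induction rule: free_lie.induct)
  case (comm x y)
  note cl = cont_linear_comm_left[of dg] and cr = cont_linear_comm_right[of dg]
  let ?S = "ncs.span (lie_monomial dg)"
  have right: "comm dg m y \<in> ?S" if m: "m \<in> lie_monomial dg" for m
  proof (rule ncs.span_induct[OF comm.IH(2)])
    show "ncs.subspace {y. comm dg m y \<in> ?S}"
      by (rule ncs.subspaceI) (simp_all add: cont_linear_zero[OF cr] cont_linear_add[OF cr]
        cont_linear_scal[OF cr] ncs.span_zero ncs.span_add ncs.span_scale)
  qed (intro ncs.span_base lie_monomial.comm m)
  show ?case
  proof (rule ncs.span_induct[OF comm.IH(1)])
    show "ncs.subspace {x. comm dg x y \<in> ?S}"
      by (rule ncs.subspaceI) (simp_all add: cont_linear_zero[OF cl] cont_linear_add[OF cl]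
        cont_linear_scal[OF cl] ncs.span_zero ncs.span_add ncs.span_scale)
  qed (rule right)
qed (auto intro: ncs.span_zero ncs.span_add ncs.span_scale ncs.span_base lie_monomial.gen)

lemma free_lie_linear_induct [consumes 1, case_names monomial zero add scal]:
  fixes x :: "('g::finite, 'k::field) ncs"
  assumes "x \<in> free_lie dg" "\<And>m. m \<in> lie_monomial dg \<Longrightarrow> P m" "P 0"
    "\<And>x y. x \<in> free_lie dg \<Longrightarrow> y \<in> free_lie dg \<Longrightarrow> P x \<Longrightarrow> P y \<Longrightarrow> P (x + y)"
    "\<And>c x. x \<in> free_lie dg \<Longrightarrow> P x \<Longrightarrow> P (scal c x)"
  shows "P x"
proof -
  have "x \<in> free_lie dg \<and> P x"
  proof (rule ncs.span_induct[OF free_lie_span[OF assms(1)]])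
    show "ncs.subspace {x. x \<in> free_lie dg \<and> P x}"
      by (rule ncs.subspaceI) (simp_all add: assms free_lie.zero free_lie.add free_lie.scal)
  qed (simp add: assms(2) lie_monomial_free_lie)
  then show ?thesis by simp
qed

lemma twist_free_lie: "x \<in> free_lie dg \<Longrightarrow> twist dg x \<in> free_lie dg"
  for x :: "('g::finite, 'k::field) ncs"
  by (induction rule: free_lie.induct)
    (auto intro: free_lie.intros simp: twist_gen twist_comm cont_linear_zero[OF cont_linear_twist]
      cont_linear_add[OF cont_linear_twist] cont_linear_scal[OF cont_linear_twist])

subsection \<open>Lie series\<close>

lemma nc_coeff_length_part [simp]:
  "nc_coeff (length_part n f) w = (if length w = n then nc_coeff f w else 0)"
  by (simp add: length_part.rep_eq)

lemma lie_series_zero: "(0 :: ('g, 'k::field) ncs) \<in> lie_series dg"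
proof -
  have "length_part n (0 :: ('g, 'k) ncs) = 0" for n by (rule ncs_eqI) simp
  then show ?thesis by (simp add: lie_series_def free_lie.zero)
qed

lemma lie_series_add: "x \<in> lie_series dg \<Longrightarrow> y \<in> lie_series dg \<Longrightarrow> x + y \<in> lie_series dg"
proof -
  have "length_part n (x + y) = length_part n x + length_part n y" for n by (rule ncs_eqI) simp
  then show "x \<in> lie_series dg \<Longrightarrow> y \<in> lie_series dg \<Longrightarrow> ?thesis"
    by (simp add: lie_series_def free_lie.add)
qed

lemma lie_series_scal: "x \<in> lie_series dg \<Longrightarrow> scal c x \<in> lie_series dg"
proof -
  have "length_part n (scal c x) = scal c (length_part n x)" for n by (rule ncs_eqI) simp
  then show "x \<in> lie_series dg \<Longrightarrow> ?thesis"
    by (simp add: lie_series_def free_lie.scal)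
qed

lemma lie_series_diff: "x \<in> lie_series dg \<Longrightarrow> y \<in> lie_series dg \<Longrightarrow> x - y \<in> lie_series dg"
  using lie_series_add[of x dg "scal (-1) y"] lie_series_scal[of y dg "-1"] by simp

lemma lie_series_sum: "(\<And>i. i \<in> S \<Longrightarrow> f i \<in> lie_series dg) \<Longrightarrow> sum f S \<in> lie_series dg"
  by (induction S rule: infinite_finite_induct) (auto intro: lie_series_zero lie_series_add)

lemma free_lie_lie_series:
  fixes x :: "('g::finite, 'k::field) ncs"
  assumes "x \<in> free_lie dg" shows "x \<in> lie_series dg"
  using assms
proof (induction rule: free_lie_linear_induct)
  case (monomial m)
  obtain k where k: "k \<ge> 1" "m \<in> homogeneous (\<lambda>_. 1) (int k)"
    using monomial by (rule lie_monomial_length)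
  then have supp: "nc_coeff m w \<noteq> 0 \<Longrightarrow> length w = k" for w
    by (auto simp: homogeneous_def word_deg_length)
  have "length_part n m = (if n = k then m else 0)" for n
    by (rule ncs_eqI) (use supp in auto)
  moreover have "nc_coeff m [] = 0" using supp[of "[]"] k by auto
  ultimately show ?case
    using monomial by (auto simp: lie_series_def intro: free_lie.zero lie_monomial_free_lie)
qed (auto intro: lie_series_zero lie_series_add lie_series_scal)

text \<open>Lie series are the limits of Lie polynomials, by this lemma and the closure property below.\<close>

lemma trunc_lie_series:
  fixes f :: "('g::finite, 'k::field) ncs"
  assumes "f \<in> lie_series dg" shows "trunc n f \<in> free_lie dg"
proof (induction n)
  case 0
  have "trunc 0 f = 0" by (rule ncs_eqI) (simp add: nc_coeff_trunc)
  then show ?case by (simp add: free_lie.zero)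
next
  case (Suc n)
  have "trunc (Suc n) f = trunc n f + length_part n f"
    by (rule ncs_eqI) (simp add: nc_coeff_trunc)
  moreover have "length_part n f \<in> free_lie dg"
  proof (cases n)
    case 0
    have "length_part 0 f = 0"
      using assms by (intro ncs_eqI) (simp add: lie_series_def)
    then show ?thesis using 0 by (simp add: free_lie.zero)
  qed (use assms in \<open>simp add: lie_series_def\<close>)
  ultimately show ?case using Suc by (simp add: free_lie.add)
qed

lemma lie_series_closed:
  assumes "\<And>n. \<exists>h\<in>lie_series dg. f - h \<in> length_ge n"
  shows "f \<in> lie_series dg"
  unfolding lie_series_def
proof (intro CollectI conjI allI impI)
  obtain h where "h \<in> lie_series dg" "f - h \<in> length_ge 1" using assms by blast
  then show "nc_coeff f [] = 0" by (simp add: lie_series_def length_ge_def)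
next
  fix n :: nat assume n: "n \<ge> 1"
  obtain h where h: "h \<in> lie_series dg" "f - h \<in> length_ge (Suc n)" using assms by blast
  then have "length_part n f = length_part n h"
    by (intro ncs_eqI) (simp add: length_ge_def)
  then show "length_part n f \<in> free_lie dg" using h(1) n by (simp add: lie_series_def)
qed

lemma lie_series_comm:
  fixes f g :: "('g::finite, 'k::field) ncs"
  assumes "f \<in> lie_series dg" "g \<in> lie_series dg"
  shows "comm dg f g \<in> lie_series dg"
proof (rule lie_series_closed, rule bexI)
  fix n
  let ?f = "trunc n f" and ?g = "trunc n g"
  show "comm dg ?f ?g \<in> lie_series dg"
    by (intro free_lie_lie_series free_lie.comm trunc_lie_series assms)
  have "comm dg f g - comm dg ?f ?g = comm dg (f - ?f) g + comm dg ?f (g - ?g)"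
    by (simp add: cont_linear_diff[OF cont_linear_comm_left] cont_linear_diff[OF cont_linear_comm_right])
  moreover have "comm dg (f - ?f) g \<in> length_ge n"
    using length_ge_comm[OF trunc_diff[of f n], of g 0] by simp
  moreover have "comm dg ?f (g - ?g) \<in> length_ge n"
    using length_ge_comm[OF _ trunc_diff[of g n], of ?f 0] by simp
  ultimately show "comm dg f g - comm dg ?f ?g \<in> length_ge n"
    by (simp add: length_ge_add)
qed

lemma lie_series_formal_sum:
  assumes "\<And>n. F n \<in> length_ge n" "\<And>n. F n \<in> lie_series dg"
  shows "formal_sum F \<in> lie_series dg"
  using formal_sum_tail[OF assms(1)] assms(2) by (intro lie_series_closed) (blast intro: lie_series_sum)

lemma lie_series_gen: "gen g \<in> lie_series dg"
  for g :: "'g::finite"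
  by (intro free_lie_lie_series free_lie.gen)

text \<open>
  On Lie polynomials this follows from the Leibniz rule for brackets. A Lie series is a limit of Lie
  polynomials, and the Lie series are closed.
\<close>

lemma graded_derivation_lie_series:
  fixes D :: "('g::finite, 'k::field) ncs \<Rightarrow> ('g, 'k) ncs"
  assumes D: "graded_derivation dg D" and len: "\<And>n x. x \<in> length_ge n \<Longrightarrow> D x \<in> length_ge n"
    and gen: "\<And>g. D (gen g) \<in> lie_series dg" and f: "f \<in> lie_series dg"
  shows "D f \<in> lie_series dg"
proof (rule lie_series_closed, rule bexI)
  note cl = graded_derivationD(1)[OF D]
  have "D x \<in> lie_series dg" if "x \<in> free_lie dg" for x
    using that
  proof (induction rule: free_lie.induct)
    case (comm x y)
    then show ?case
      unfolding graded_derivation_comm[OF D]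
      by (intro lie_series_add lie_series_comm free_lie_lie_series[of x] free_lie_lie_series[of y]
          free_lie_lie_series[of "twist dg x"] twist_free_lie)
  qed (auto simp: cont_linear_zero[OF cl] cont_linear_add[OF cl] cont_linear_scal[OF cl] gen
      intro: lie_series_zero lie_series_add lie_series_scal)
  then show "D (trunc n f) \<in> lie_series dg" for n
    using f by (simp add: trunc_lie_series)
  show "D f - D (trunc n f) \<in> length_ge n" for n
    using len[OF trunc_diff] by (simp add: cont_linear_diff[OF cl, symmetric])
qed

lemma complete_free_lie_simps:
  "carrier (complete_free_lie dg) = lie_series dg"
  "lie_add (complete_free_lie dg) = (+)" "lie_smult (complete_free_lie dg) = scal"
  "bracket (complete_free_lie dg) = comm dg"
  "lie_hom_part (complete_free_lie dg) d = lie_series dg \<inter> homogeneous dg d"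
  "lie_fil (complete_free_lie dg) n = lie_series dg \<inter> length_ge n"
  by (simp_all add: complete_free_lie_def)

lemma continuous_lie_derivation_restrict:
  fixes D :: "('g::finite, 'k::field) ncs \<Rightarrow> ('g, 'k) ncs"
  assumes D: "graded_derivation dg D" and len: "\<And>n x. x \<in> length_ge n \<Longrightarrow> D x \<in> length_ge n"
    and gen: "\<And>g. D (gen g) \<in> lie_series dg"
  shows "continuous_lie_derivation (complete_free_lie dg) (restrict D (lie_series dg))"
proof -
  note cl = graded_derivationD(1)[OF D]
  have lie: "D f \<in> lie_series dg" if "f \<in> lie_series dg" for f
    by (rule graded_derivation_lie_series[OF D len gen that])
  show ?thesis
    unfolding continuous_lie_derivation_def complete_free_lie_simps
  proof (intro conjI allI ballI)
    show "\<exists>m. \<forall>x\<in>lie_series dg \<inter> length_ge m. restrict D (lie_series dg) x \<in> lie_series dg \<inter> length_ge n" for n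
      using lie len by (intro exI[of _ n]) auto
    fix d and x y :: "('g, 'k) ncs" assume x: "x \<in> lie_series dg \<inter> homogeneous dg d" and y: "y \<in> lie_series dg"
    then show "restrict D (lie_series dg) (comm dg x y) = comm dg (restrict D (lie_series dg) x) y
        + scal ((-1) powi d) (comm dg x (restrict D (lie_series dg) y))"
      by (simp add: graded_derivation_comm[OF D] lie_series_comm twist_homogeneous[of x dg d]
          cont_linear_scal[OF cont_linear_comm_left])
  qed (auto simp: lie lie_series_add lie_series_scal cont_linear_add[OF cl] cont_linear_scal[OF cl]
      intro: graded_derivationD(2)[OF D])
qed

text \<open>
  The Leibniz rule is only given for homogeneous left arguments, which Lie monomials are; linearity
  and continuity extend the equality to Lie polynomials and to Lie series.
\<close>

lemma continuous_lie_derivation_unique: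
  fixes d d' :: "('g::finite, 'k::field) ncs \<Rightarrow> ('g, 'k) ncs"
  assumes d: "continuous_lie_derivation (complete_free_lie dg) d"
    and d': "continuous_lie_derivation (complete_free_lie dg) d'"
    and gen: "\<And>g. d (gen g) = d' (gen g)"
  shows "d = d'"
proof -
  let ?L = "lie_series dg"
  have props: "e \<in> ?L \<rightarrow>\<^sub>E ?L" "x \<in> ?L \<Longrightarrow> y \<in> ?L \<Longrightarrow> e (x + y) = e x + e y"
    "x \<in> ?L \<Longrightarrow> e (scal c x) = scal c (e x)"
    "x \<in> ?L \<Longrightarrow> x \<in> homogeneous dg i \<Longrightarrow> y \<in> ?L \<Longrightarrow>
       e (comm dg x y) = comm dg (e x) y + scal ((-1) powi i) (comm dg x (e y))"
    "\<exists>m. \<forall>x\<in>?L \<inter> length_ge m. e x \<in> ?L \<inter> length_ge n"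
    if "continuous_lie_derivation (complete_free_lie dg) e" for e x y c i n
    using that unfolding continuous_lie_derivation_def complete_free_lie_simps by blast+
  have mon: "d x = d' x" if "x \<in> lie_monomial dg" for x
    using that
  proof (induction rule: lie_monomial.induct)
    case (comm x y)
    obtain i where i: "x \<in> homogeneous dg i" using comm(1) by (rule lie_monomial_homogeneous)
    have "x \<in> ?L" "y \<in> ?L" using comm by (auto intro: free_lie_lie_series lie_monomial_free_lie)
    then show ?case using comm.IH i props(4)[OF d] props(4)[OF d'] by metis
  qed (rule gen)
  have zero: "d 0 = d' 0"
    using props(3)[OF d lie_series_zero, of 0] props(3)[OF d' lie_series_zero, of 0] by simp
  have free: "d x = d' x" if "x \<in> free_lie dg" for x
    using that
    by (induction rule: free_lie_linear_induct)
      (auto simp: mon zero props(2)[OF d] props(2)[OF d'] props(3)[OF d] props(3)[OF d'] free_lie_lie_series)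
  have "d f = d' f" if f: "f \<in> ?L" for f
  proof -
    have "d f - d' f \<in> length_ge n" for n
    proof -
      obtain m where m: "\<forall>x\<in>?L \<inter> length_ge m. d x \<in> ?L \<inter> length_ge n" using props(5)[OF d] by blast
      obtain m' where m': "\<forall>x\<in>?L \<inter> length_ge m'. d' x \<in> ?L \<inter> length_ge n" using props(5)[OF d'] by blast
      let ?t = "trunc (max m m') f"
      have t: "?t \<in> free_lie dg" "?t \<in> ?L"
        using f by (auto intro: trunc_lie_series free_lie_lie_series)
      have "f - ?t \<in> length_ge (max m m')" by (rule trunc_diff)
      then have tail: "f - ?t \<in> ?L" "f - ?t \<in> length_ge m" "f - ?t \<in> length_ge m'"
        using f t by (auto intro: lie_series_diff length_ge_mono)
      have "d f = d ?t + d (f - ?t)" "d' f = d' ?t + d' (f - ?t)"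
        using props(2)[OF d t(2) tail(1)] props(2)[OF d' t(2) tail(1)] by simp_all
      then have "d f - d' f = d (f - ?t) - d' (f - ?t)"
        using free[OF t(1)] by simp
      then show ?thesis using m m' tail by (simp add: length_ge_diff)
    qed
    then show ?thesis using length_ge_all_imp_zero[of "d f - d' f"] by auto
  qed
  then show ?thesis
    using props(1)[OF d] props(1)[OF d'] by (intro extensionalityI[of _ ?L]) (auto simp: PiE_def)
qed

section \<open>The completed enveloping algebra of a complete free Lie algebra\<close>

subsection \<open>Free algebras and evaluation\<close>

lemma carrier_free_algebra:
  "carrier (free_algebra M) = {f. finite {w. nc_coeff f w \<noteq> 0} \<and> {w. nc_coeff f w \<noteq> 0} \<subseteq> lists M}"
  by (simp add: free_algebra_def)

lemma free_algebra_ops: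
  "monoid.mult (free_algebra M) = (*)" "monoid.one (free_algebra M) = 1"
  "ring.zero (free_algebra M) = 0" "ring.add (free_algebra M) = (+)"
  by (simp_all add: free_algebra_def ring_of_type_algebra_def)

lemma free_algebra_zero: "0 \<in> carrier (free_algebra M)"
  by (simp add: carrier_free_algebra)

lemma free_algebra_add:
  assumes "f \<in> carrier (free_algebra M)" "g \<in> carrier (free_algebra M)"
  shows "f + g \<in> carrier (free_algebra M)"
proof -
  have "{w. nc_coeff (f + g) w \<noteq> 0} \<subseteq> {w. nc_coeff f w \<noteq> 0} \<union> {w. nc_coeff g w \<noteq> 0}"
    by auto
  then show ?thesis
    using assms unfolding carrier_free_algebra by (blast intro: finite_subset)
qed

lemma free_algebra_scal:
  assumes "f \<in> carrier (free_algebra M)"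
  shows "scal c f \<in> carrier (free_algebra M)"
proof -
  have "{w. nc_coeff (scal c f) w \<noteq> 0} \<subseteq> {w. nc_coeff f w \<noteq> 0}"
    by auto
  then show ?thesis
    using assms unfolding carrier_free_algebra by (blast intro: finite_subset)
qed

lemma free_algebra_uminus: "f \<in> carrier (free_algebra M) \<Longrightarrow> - f \<in> carrier (free_algebra M)"
  using free_algebra_scal[of f M "-1"] by simp

lemma free_algebra_diff:
  "f \<in> carrier (free_algebra M) \<Longrightarrow> g \<in> carrier (free_algebra M) \<Longrightarrow> f - g \<in> carrier (free_algebra M)"
  using free_algebra_add[of f M "- g"] free_algebra_uminus[of g M] by simp

lemma free_algebra_sum:
  "(\<And>i. i \<in> S \<Longrightarrow> f i \<in> carrier (free_algebra M)) \<Longrightarrow> sum f S \<in> carrier (free_algebra M)"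
  by (induction S rule: infinite_finite_induct) (auto intro: free_algebra_zero free_algebra_add)

lemma free_algebra_word: "w \<in> lists M \<Longrightarrow> word w \<in> carrier (free_algebra M)"
  by (auto simp: carrier_free_algebra nc_coeff_word)

lemma free_algebra_gen: "x \<in> M \<Longrightarrow> gen x \<in> carrier (free_algebra M)"
  by (simp add: free_algebra_word)

lemma free_algebra_mult:
  assumes "f \<in> carrier (free_algebra M)" "g \<in> carrier (free_algebra M)"
  shows "f * g \<in> carrier (free_algebra M)"
proof -
  let ?S = "\<lambda>f. {w. nc_coeff f w \<noteq> 0}"
  have sub: "?S (f * g) \<subseteq> (\<lambda>(u, v). u @ v) ` (?S f \<times> ?S g)"
  proof
    fix w assume "w \<in> ?S (f * g)"
    then obtain p where "p \<in> splits w" "nc_coeff f (fst p) * nc_coeff g (snd p) \<noteq> 0"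
      unfolding nc_coeff_times mem_Collect_eq by (metis (no_types, lifting) case_prod_beta sum.neutral)
    then show "w \<in> (\<lambda>(u, v). u @ v) ` (?S f \<times> ?S g)"
      by (intro image_eqI[of _ _ p]) (auto simp: splits_def)
  qed
  have lists: "u \<in> lists M" if "nc_coeff f u \<noteq> 0 \<or> nc_coeff g u \<noteq> 0" for u
    using assms that by (auto simp only: carrier_free_algebra)
  have "finite (?S f \<times> ?S g)"
    using assms by (simp add: carrier_free_algebra)
  then have "finite (?S (f * g))"
    by (rule finite_subset[OF sub finite_imageI])
  moreover have "?S (f * g) \<subseteq> lists M"
  proof
    fix w assume "w \<in> ?S (f * g)"
    then obtain u v where "w = u @ v" "nc_coeff f u \<noteq> 0" "nc_coeff g v \<noteq> 0"
      using sub by auto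
    then show "w \<in> lists M" using lists[of u] lists[of v] by simp
  qed
  ultimately show ?thesis
    by (simp only: carrier_free_algebra mem_Collect_eq)
qed

lemma ring_free_algebra: "ring (free_algebra M)"
  by (rule ringI; (rule abelian_groupI | rule monoidI)?)
    (auto simp: free_algebra_ops algebra_simps free_algebra_add free_algebra_mult free_algebra_zero
      free_algebra_word[of "[]", simplified word_Nil] intro: free_algebra_uminus bexI[of _ "- _"])

lemma free_algebra_induct [consumes 1, case_names word add]:
  assumes "t \<in> carrier (free_algebra M)"
    and word: "\<And>c w. w \<in> lists M \<Longrightarrow> P (scal c (word w))"
    and add: "\<And>x y. x \<in> carrier (free_algebra M) \<Longrightarrow> y \<in> carrier (free_algebra M) \<Longrightarrow>
      P x \<Longrightarrow> P y \<Longrightarrow> P (x + y)"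
  shows "P t"
proof -
  let ?S = "{w. nc_coeff t w \<noteq> 0}"
  have S: "finite ?S" "?S \<subseteq> lists M"
    using assms(1) by (auto simp: carrier_free_algebra)
  have "P (\<Sum>w\<in>T. scal (nc_coeff t w) (word w))" if "finite T" "T \<subseteq> lists M" for T
    using that
  proof (induction rule: finite_induct)
    case empty
    then show ?case using word[of "[]" 0] by simp
  next
    case (insert w T)
    then show ?case
      by (auto intro!: add word free_algebra_sum free_algebra_scal free_algebra_word)
  qed
  moreover have "(\<Sum>w\<in>?S. scal (nc_coeff t w) (word w)) = t"
    by (rule ncs_eqI) (simp add: nc_coeff_sum nc_coeff_word S if_distrib cong: if_cong)
  ultimately show ?thesis using S by metis
qed

text \<open>
  The algebra map from the free algebra on a set of series to the series themselves, multiplying out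
  formal words. On elements of infinite support the sum below is \<open>0\<close>.
\<close>

definition eval_words :: "(('g, 'k::field) ncs, 'k) ncs \<Rightarrow> ('g, 'k) ncs" where
  "eval_words t = (\<Sum>xs | nc_coeff t xs \<noteq> 0. scal (nc_coeff t xs) (prod_list xs))"

lemma eval_words_superset:
  assumes "finite S" "{w. nc_coeff t w \<noteq> 0} \<subseteq> S"
  shows "eval_words t = (\<Sum>xs\<in>S. scal (nc_coeff t xs) (prod_list xs))"
  unfolding eval_words_def using assms by (intro sum.mono_neutral_left) auto

lemma eval_words_add:
  assumes "s \<in> carrier (free_algebra M)" "t \<in> carrier (free_algebra M)"
  shows "eval_words (s + t) = eval_words s + eval_words t"
proof -
  let ?S = "{w. nc_coeff s w \<noteq> 0} \<union> {w. nc_coeff t w \<noteq> 0}"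
  have fin: "finite ?S" using assms by (simp add: carrier_free_algebra)
  show ?thesis
    by (subst (1 2 3) eval_words_superset[OF fin]) (auto simp: ncs.scale_left_distrib sum.distrib)
qed

lemma eval_words_scal:
  assumes "t \<in> carrier (free_algebra M)"
  shows "eval_words (scal c t) = scal c (eval_words t)"
proof -
  have fin: "finite {w. nc_coeff t w \<noteq> 0}" using assms by (simp add: carrier_free_algebra)
  show ?thesis
    by (subst (1 2) eval_words_superset[OF fin]) (auto simp: ncs.scale_sum_right)
qed

lemma eval_words_diff:
  assumes "s \<in> carrier (free_algebra M)" "t \<in> carrier (free_algebra M)"
  shows "eval_words (s - t) = eval_words s - eval_words t"
  using eval_words_add[OF assms(1) free_algebra_uminus[OF assms(2)]] eval_words_scal[OF assms(2), of "-1"]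
  by simp

lemma eval_words_word: "eval_words (word xs) = prod_list xs"
  by (subst eval_words_superset[of "{xs}"]) (auto simp: nc_coeff_word)

lemma eval_words_scal_word: "eval_words (scal c (word xs)) = scal c (prod_list xs)"
  by (subst eval_words_superset[of "{xs}"]) (auto simp: nc_coeff_word)

lemma eval_words_one: "eval_words 1 = 1"
  using eval_words_word[of "[]"] by (simp add: word_Nil)

lemma eval_words_mult:
  assumes s: "s \<in> carrier (free_algebra M)" and t: "t \<in> carrier (free_algebra M)"
  shows "eval_words (s * t) = eval_words s * eval_words t"
  using s
proof (induction rule: free_algebra_induct)
  case (word c u)
  show ?case
    using t
  proof (induction rule: free_algebra_induct)
    case (word d v)
    show ?case
      by (simp add: scal_mult word_mult eval_words_scal_word)
  next
    case (add x y)
    then show ?case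
      using word
      by (simp add: distrib_left eval_words_add[of _ M] free_algebra_mult free_algebra_scal free_algebra_word)
  qed
next
  case (add x y)
  then show ?case
    using t by (simp add: distrib_right eval_words_add[of _ M] free_algebra_mult)
qed

lemma eval_words_sum:
  assumes "\<And>i. i \<in> S \<Longrightarrow> f i \<in> carrier (free_algebra M)"
  shows "eval_words (sum f S) = (\<Sum>i\<in>S. eval_words (f i))"
  using assms
  by (induction S rule: infinite_finite_induct)
    (auto simp: eval_words_def[of 0] eval_words_add[of _ M] free_algebra_sum)

lemma prod_list_map_gen: "prod_list (map gen w) = word w"
  by (induction w) (auto simp: word_Nil word_mult)

text \<open>
  A section of the evaluation up to terms of length \<open>\<ge> n\<close>: it writes a series as a polynomial in
  the generators.
\<close>

definition generator_lift :: "nat \<Rightarrow> ('g::finite, 'k::field) ncs \<Rightarrow> (('g, 'k) ncs, 'k) ncs" where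
  "generator_lift n f = (\<Sum>w | length w < n. scal (nc_coeff f w) (word (map gen w)))"

lemma generator_lift_add: "generator_lift n (f + g) = generator_lift n f + generator_lift n g"
  by (simp add: generator_lift_def ncs.scale_left_distrib sum.distrib)

lemma generator_lift_scal: "generator_lift n (scal c f) = scal c (generator_lift n f)"
  by (simp add: generator_lift_def ncs.scale_sum_right)

lemma generator_lift_diff: "generator_lift n (f - g) = generator_lift n f - generator_lift n g"
  by (simp add: generator_lift_def ncs.scale_left_diff_distrib sum_subtractf)

lemma generator_lift_length_ge: "f \<in> length_ge n \<Longrightarrow> generator_lift n f = 0"
  by (simp add: generator_lift_def length_ge_def)

lemma generator_lift_word: "generator_lift n (word w) = (if length w < n then word (map gen w) else 0)"
proof -
  have "generator_lift n (word w) = (\<Sum>v | length v < n. if v = w then word (map gen w) else 0)"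
    unfolding generator_lift_def by (intro sum.cong) (auto simp: nc_coeff_word)
  then show ?thesis by (simp add: finite_words_less)
qed

subsection \<open>The filtration of the enveloping algebra\<close>

context
  fixes dg :: "'g::finite \<Rightarrow> int"
begin

private abbreviation (input) "L \<equiv> (complete_free_lie dg :: ('k::field, ('g, 'k) ncs) graded_lie)"
private abbreviation (input) "F \<equiv> (free_algebra (lie_series dg) :: (('g, 'k::field) ncs, 'k) ncs ring)"

lemma uea_relations_carrier: "uea_relations L \<subseteq> carrier F"
  unfolding uea_relations_def complete_free_lie_simps
  by (auto intro!: free_algebra_diff free_algebra_gen free_algebra_scal free_algebra_mult
      lie_series_add lie_series_scal lie_series_comm)

lemma uea_stage_words_carrier: "word ` uea_stage_words L n \<subseteq> carrier F"
  by (auto simp: uea_stage_words_def complete_free_lie_simps intro: free_algebra_word)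

lemma uea_ideal_ideal: "ideal (uea_ideal L n) F"
  unfolding uea_ideal_def complete_free_lie_simps
  by (intro ring.genideal_ideal ring_free_algebra Un_least uea_relations_carrier uea_stage_words_carrier)

lemma uea_ideal_generators: "uea_relations L \<union> word ` uea_stage_words L n \<subseteq> uea_ideal L n"
  unfolding uea_ideal_def complete_free_lie_simps
  by (intro ring.genideal_self ring_free_algebra Un_least uea_relations_carrier uea_stage_words_carrier)

lemma uea_ideal_closed:
  fixes x y t :: "(('g, 'k::field) ncs, 'k) ncs" and c :: 'k
  shows uea_ideal_zero: "0 \<in> uea_ideal L n"
    and uea_ideal_add: "x \<in> uea_ideal L n \<Longrightarrow> y \<in> uea_ideal L n \<Longrightarrow> x + y \<in> uea_ideal L n"
    and uea_ideal_mult_left: "x \<in> uea_ideal L n \<Longrightarrow> t \<in> carrier F \<Longrightarrow> t * x \<in> uea_ideal L n"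
    and uea_ideal_mult_right: "x \<in> uea_ideal L n \<Longrightarrow> t \<in> carrier F \<Longrightarrow> x * t \<in> uea_ideal L n"
    and uea_ideal_scal: "x \<in> uea_ideal L n \<Longrightarrow> scal c x \<in> uea_ideal L n"
    and uea_ideal_diff: "x \<in> uea_ideal L n \<Longrightarrow> y \<in> uea_ideal L n \<Longrightarrow> x - y \<in> uea_ideal L n"
proof -
  interpret I: ideal "uea_ideal L n" F by (rule uea_ideal_ideal)
  show "0 \<in> uea_ideal L n"
    using additive_subgroup.zero_closed[OF I.additive_subgroup_axioms] by (simp add: free_algebra_ops)
  show add: "x \<in> uea_ideal L n \<Longrightarrow> y \<in> uea_ideal L n \<Longrightarrow> x + y \<in> uea_ideal L n" for x y :: "(('g, 'k) ncs, 'k) ncs"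
    using additive_subgroup.a_closed[OF I.additive_subgroup_axioms, of x y] by (simp add: free_algebra_ops)
  show left: "x \<in> uea_ideal L n \<Longrightarrow> t \<in> carrier F \<Longrightarrow> t * x \<in> uea_ideal L n" for x t :: "(('g, 'k) ncs, 'k) ncs"
    using I.I_l_closed[of x t] by (simp add: free_algebra_ops)
  show "x \<in> uea_ideal L n \<Longrightarrow> t \<in> carrier F \<Longrightarrow> x * t \<in> uea_ideal L n" for x t :: "(('g, 'k) ncs, 'k) ncs"
    using I.I_r_closed[of x t] by (simp add: free_algebra_ops)
  have "scal c (1 :: (('g, 'k) ncs, 'k) ncs) \<in> carrier F" for c :: 'k
    using free_algebra_word[of "[]"] by (auto simp: word_Nil intro: free_algebra_scal)
  then show scal: "x \<in> uea_ideal L n \<Longrightarrow> scal c x \<in> uea_ideal L n" for x :: "(('g, 'k) ncs, 'k) ncs" and c :: 'k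
    using left[of x "scal c 1"] by (simp add: scal_mult)
  show "x \<in> uea_ideal L n \<Longrightarrow> y \<in> uea_ideal L n \<Longrightarrow> x - y \<in> uea_ideal L n" for x y :: "(('g, 'k) ncs, 'k) ncs"
    using add[of x "scal (-1) y"] scal[of y "-1"] by simp
qed

lemma prod_list_stage:
  assumes "list_all2 (\<lambda>x m. x \<in> A \<inter> length_ge m) xs ms"
  shows "prod_list xs \<in> length_ge (sum_list ms)"
  using assms by (induction rule: list_all2_induct) (auto intro: length_ge_mult)

text \<open>
  The relations evaluate to \<open>0\<close>, and the evaluation of a product of Lie series has at least the sum
  of their lowest lengths.
\<close>

lemma uea_ideal_subset:
  "uea_ideal (L :: ('k::field, ('g, 'k) ncs) graded_lie) n
     \<subseteq> {t \<in> carrier F. eval_words t \<in> length_ge n}" (is "_ \<subseteq> ?K")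
proof -
  have "ideal ?K F"
  proof (rule idealI[OF ring_free_algebra])
    interpret F: ring F by (rule ring_free_algebra)
    show "subgroup ?K (add_monoid F)"
    proof (rule F.add.subgroupI)
      fix t assume t: "t \<in> ?K"
      then have "\<ominus>\<^bsub>F\<^esub> t = - t"
        by (intro F.minus_equality) (auto simp: free_algebra_ops free_algebra_uminus)
      then show "\<ominus>\<^bsub>F\<^esub> t \<in> ?K"
        using t eval_words_scal[of t _ "-1"] by (auto simp: free_algebra_uminus length_ge_uminus)
    qed (auto simp: free_algebra_ops eval_words_add free_algebra_add length_ge_add free_algebra_zero
        eval_words_def[of 0] intro!: exI[of _ 0])
  qed (auto simp: free_algebra_ops eval_words_mult free_algebra_mult length_ge_mult_left length_ge_mult_right)
  moreover have "uea_relations L \<subseteq> ?K"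
  proof
    fix t :: "(('g, 'k) ncs, 'k) ncs" assume t: "t \<in> uea_relations L"
    note simps = eval_words_diff[of _ "lie_series dg"] eval_words_scal[of _ "lie_series dg"]
      eval_words_mult[of _ "lie_series dg"] eval_words_word free_algebra_diff free_algebra_gen
      free_algebra_scal free_algebra_mult lie_series_add lie_series_scal lie_series_comm
    have "eval_words t = 0"
      using t unfolding uea_relations_def complete_free_lie_simps
    proof (elim UnE CollectE exE conjE)
      fix x y d e
      assume xy: "x \<in> lie_series dg \<inter> homogeneous dg d" "y \<in> lie_series dg \<inter> homogeneous dg e"
        and "t = gen x * gen y - scal ((-1) powi (d * e)) (gen y * gen x) - gen (comm dg x y)"
      then have "eval_words t = x * y - scal ((-1) powi (d * e)) (y * x) - comm dg x y"
        by (simp add: simps)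
      then show ?thesis using xy by (simp add: comm_homogeneous[of x dg d y e])
    qed (simp_all add: simps)
    then show "t \<in> ?K" using t uea_relations_carrier by auto
  qed
  moreover have "word ` uea_stage_words L n \<subseteq> ?K"
  proof
    fix t :: "(('g, 'k) ncs, 'k) ncs" assume t: "t \<in> word ` uea_stage_words L n"
    then obtain xs ms where "t = word xs" "n \<le> sum_list ms"
      "list_all2 (\<lambda>x m. x \<in> lie_series dg \<inter> length_ge m) xs ms"
      unfolding uea_stage_words_def complete_free_lie_simps by auto
    then have "eval_words t \<in> length_ge n"
      by (auto simp only: eval_words_word intro: length_ge_mono prod_list_stage)
    then show "t \<in> ?K" using t uea_stage_words_carrier by auto
  qed
  ultimately show ?thesis
    unfolding uea_ideal_def complete_free_lie_simps
    by (intro ring.genideal_minimal ring_free_algebra) auto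
qed

lemma generator_lift_carrier: "generator_lift n f \<in> carrier F"
  unfolding generator_lift_def
  by (auto intro!: free_algebra_sum free_algebra_scal free_algebra_word lie_series_gen)

lemma eval_words_generator_lift:
  fixes f :: "('g, 'k::field) ncs"
  shows "eval_words (generator_lift n f) = trunc n f"
proof -
  have car: "(word (map gen w) :: (('g, 'k) ncs, 'k) ncs) \<in> carrier F" for w :: "'g list"
    by (auto intro!: free_algebra_word lie_series_gen)
  show ?thesis
    unfolding generator_lift_def trunc_def
    by (simp add: eval_words_sum[of _ _ "lie_series dg"] eval_words_scal[OF car] free_algebra_scal car
        eval_words_word prod_list_map_gen)
qed

lemma word_gens_stage:
  assumes "n \<le> length w" shows "word (map gen w) \<in> uea_ideal L n"
proof -
  have "list_all2 (\<lambda>x m. x \<in> lie_series dg \<inter> length_ge m) (map gen w) (replicate (length w) 1)"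
    by (auto simp: list_all2_conv_all_nth lie_series_gen length_ge_word)
  then have "map gen w \<in> uea_stage_words L n"
    using assms unfolding uea_stage_words_def complete_free_lie_simps
    by (auto simp: lie_series_gen sum_list_replicate intro!: exI[of _ "replicate (length w) 1"])
  then show ?thesis using uea_ideal_generators by blast
qed

text \<open>Below length \<open>n\<close> the section is multiplicative; the other words in generators lie in the ideal.\<close>

lemma generator_lift_mult:
  fixes f h :: "('g, 'k::field) ncs"
  shows "generator_lift n f * generator_lift n h - generator_lift n (f * h) \<in> uea_ideal L n"
proof -
  let ?B = "\<lambda>f h. generator_lift n f * generator_lift n h - generator_lift n (f * h)"
  have add: "?B (f + f') h = ?B f h + ?B f' h" "?B f (h + h') = ?B f h + ?B f h'"
    for f f' h h' :: "('g, 'k) ncs"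
    by (simp_all add: generator_lift_add distrib_left distrib_right)
  have scal: "?B (scal c f) h = scal c (?B f h)" "?B f (scal c h) = scal c (?B f h)"
    for c and f h :: "('g, 'k) ncs"
    by (simp_all add: generator_lift_scal scal_mult ncs.scale_right_diff_distrib)
  have words: "?B (word u) (word v) \<in> uea_ideal L n" for u v :: "'g list"
    using word_gens_stage[of n "u @ v"] uea_ideal_zero[of n]
    by (auto simp: generator_lift_word word_mult)
  have trunc: "P (trunc n f)"
    if "P 0" "\<And>c w. P (scal c (word w))" "\<And>x y. P x \<Longrightarrow> P y \<Longrightarrow> P (x + y)"
    for P and f :: "('g, 'k) ncs"
  proof -
    have "P (\<Sum>w\<in>S. scal (nc_coeff f w) (word w))" for S
      by (induction S rule: infinite_finite_induct) (use that in auto)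
    then show ?thesis unfolding trunc_def .
  qed
  have zero: "?B 0 h = 0" "?B f 0 = 0" for f h :: "('g, 'k) ncs"
    using scal(1)[of 0 f h] scal(2)[of f 0 h] by simp_all
  have right: "?B (word u) (trunc n h) \<in> uea_ideal L n" for u and h :: "('g, 'k) ncs"
    by (rule trunc[of "\<lambda>h. ?B (word u) h \<in> uea_ideal L n"])
      (simp_all only: add scal zero uea_ideal_add uea_ideal_scal uea_ideal_zero words)
  have left: "?B (trunc n f) (trunc n h) \<in> uea_ideal L n"
    by (rule trunc[of "\<lambda>f. ?B f (trunc n h) \<in> uea_ideal L n"])
      (simp_all only: add scal zero uea_ideal_add uea_ideal_scal uea_ideal_zero right)
  have tail: "?B x h = 0" "?B h x = 0" if "x \<in> length_ge n" for x h :: "('g, 'k) ncs"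
    using that by (simp_all add: generator_lift_length_ge length_ge_mult_left length_ge_mult_right)
  have "?B f h = ?B (trunc n f + (f - trunc n f)) (trunc n h + (h - trunc n h))" by simp
  also have "\<dots> = ?B (trunc n f) (trunc n h)"
    by (simp only: add tail[OF trunc_diff] add_0_right)
  finally show ?thesis using left by simp
qed

lemma generator_lift_mult_congruent:
  assumes s: "s \<in> carrier F" "s - generator_lift n f \<in> uea_ideal L n"
    and t: "t \<in> carrier F" "t - generator_lift n h \<in> uea_ideal L n"
  shows "s * t - generator_lift n (f * h) \<in> uea_ideal L n"
proof -
  have "s * t - generator_lift n (f * h)
      = (s - generator_lift n f) * t + generator_lift n f * (t - generator_lift n h) + (generator_lift n f * generator_lift n h - generator_lift n (f * h))"
    by (simp add: algebra_simps)
  also have "\<dots> \<in> uea_ideal L n"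
    by (intro uea_ideal_add uea_ideal_mult_right uea_ideal_mult_left generator_lift_mult generator_lift_carrier s t)
  finally show ?thesis .
qed

text \<open>
  A Lie series is congruent to a Lie polynomial by the definition of the stages, and a Lie polynomial
  to a noncommutative polynomial in the generators by the bracket relations.
\<close>

lemma generator_lift_gen:
  assumes x: "x \<in> lie_series dg" shows "gen x - generator_lift n x \<in> uea_ideal L n"
proof -
  have rel: "r \<in> uea_relations L \<Longrightarrow> r \<in> uea_ideal L n" for r
    using uea_ideal_generators by blast
  have add: "gen (x + y) - generator_lift n (x + y) \<in> uea_ideal L n"
    if "x \<in> lie_series dg" "y \<in> lie_series dg"
      "gen x - generator_lift n x \<in> uea_ideal L n" "gen y - generator_lift n y \<in> uea_ideal L n" for x y
  proof -
    have "gen (x + y) - gen x - gen y \<in> uea_relations L"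
      unfolding uea_relations_def complete_free_lie_simps using that by blast
    then have "(gen (x + y) - gen x - gen y) + ((gen x - generator_lift n x) + (gen y - generator_lift n y)) \<in> uea_ideal L n"
      by (intro uea_ideal_add rel that)
    then show ?thesis by (simp add: generator_lift_add algebra_simps)
  qed
  have scal: "gen (scal c x) - generator_lift n (scal c x) \<in> uea_ideal L n"
    if "x \<in> lie_series dg" "gen x - generator_lift n x \<in> uea_ideal L n" for c x
  proof -
    have "gen (scal c x) - scal c (gen x) \<in> uea_relations L"
      unfolding uea_relations_def complete_free_lie_simps using that by blast
    then have "(gen (scal c x) - scal c (gen x)) + scal c (gen x - generator_lift n x) \<in> uea_ideal L n"
      by (intro uea_ideal_add uea_ideal_scal rel that)
    then show ?thesis by (simp add: generator_lift_scal ncs.scale_right_diff_distrib)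
  qed
  have free: "gen x - generator_lift n x \<in> uea_ideal L n" if "x \<in> free_lie dg" for x
    using that
  proof (induction rule: free_lie_linear_induct)
    case (monomial m)
    then show ?case
    proof (induction rule: lie_monomial.induct)
      case (gen g)
      show ?case
        using word_gens_stage[of n "[g]"] uea_ideal_zero[of n] by (auto simp: generator_lift_word not_less)
    next
      case (comm x y)
      obtain d e where d: "x \<in> homogeneous dg d" and e: "y \<in> homogeneous dg e"
        using comm.hyps lie_monomial_homogeneous by metis
      have xy: "x \<in> lie_series dg" "y \<in> lie_series dg"
        using comm.hyps by (auto intro: free_lie_lie_series lie_monomial_free_lie)
      let ?s = "(-1) powi (d * e)"
      have "gen x * gen y - scal ?s (gen y * gen x) - gen (comm dg x y) \<in> uea_relations L"
        unfolding uea_relations_def complete_free_lie_simps using xy d e by blast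
      then have "((gen x * gen y - generator_lift n (x * y)) - scal ?s (gen y * gen x - generator_lift n (y * x)))
          - (gen x * gen y - scal ?s (gen y * gen x) - gen (comm dg x y)) \<in> uea_ideal L n"
        using comm.IH xy
        by (intro uea_ideal_diff[OF uea_ideal_diff[OF _ uea_ideal_scal] rel] generator_lift_mult_congruent)
          (auto intro: free_algebra_gen)
      then show ?case
        by (simp add: comm_homogeneous[OF d e] generator_lift_diff generator_lift_scal ncs.scale_right_diff_distrib algebra_simps)
    qed
  next
    case zero
    (* The relation for the scalar 0 puts the letter 0 of the free algebra into the ideal. *)
    have "gen (scal 0 0) - scal 0 (gen 0) \<in> uea_relations L"
      unfolding uea_relations_def complete_free_lie_simps using lie_series_zero by blast
    then show ?case using rel by (simp add: generator_lift_length_ge)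
  qed (auto intro: add scal free_lie_lie_series)
  have t: "trunc n x \<in> free_lie dg" by (rule trunc_lie_series[OF x])
  have tail: "x - trunc n x \<in> lie_series dg" "x - trunc n x \<in> length_ge n"
    using x t by (auto intro: lie_series_diff free_lie_lie_series trunc_diff)
  have "[x - trunc n x] \<in> uea_stage_words L n"
    unfolding uea_stage_words_def complete_free_lie_simps using tail
    by (auto intro!: exI[of _ "[n]"])
  then have "gen (x - trunc n x) \<in> uea_ideal L n"
    using uea_ideal_generators by blast
  then have "gen (x - trunc n x) - generator_lift n (x - trunc n x) \<in> uea_ideal L n"
    using tail by (simp add: generator_lift_length_ge)
  then have "gen (trunc n x + (x - trunc n x)) - generator_lift n (trunc n x + (x - trunc n x)) \<in> uea_ideal L n"
    by (intro add[OF free_lie_lie_series[OF t] tail(1) free[OF t]])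
  then show ?thesis by simp
qed

text \<open>
  Every element of the free algebra is congruent to the polynomial in the generators that it evaluates
  to: this holds for single Lie series, and the section is multiplicative modulo the ideal.
\<close>

lemma generator_lift_eval_words:
  fixes t :: "(('g, 'k::field) ncs, 'k) ncs"
  assumes "t \<in> carrier F"
  shows "t - generator_lift n (eval_words t) \<in> uea_ideal L n"
  using assms
proof (induction rule: free_algebra_induct)
  case (word c w)
  then have "word w - generator_lift n (prod_list w) \<in> uea_ideal L n"
  proof (induction w)
    case Nil
    then show ?case
      using word_gens_stage[of n "[] :: 'g list"] uea_ideal_zero[of n]
      by (cases n) (auto simp: word_Nil[symmetric] generator_lift_word)
  next
    case (Cons x w)
    then have "gen x * word w - generator_lift n (x * prod_list w) \<in> uea_ideal L n"
      by (intro generator_lift_mult_congruent free_algebra_gen free_algebra_word generator_lift_gen) auto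
    then show ?case by (simp add: word_mult)
  qed
  then have "scal c (word w - generator_lift n (prod_list w)) \<in> uea_ideal L n"
    by (rule uea_ideal_scal)
  then show ?case
    by (simp add: eval_words_scal_word generator_lift_scal ncs.scale_right_diff_distrib)
next
  case (add x y)
  have "x + y - generator_lift n (eval_words (x + y))
      = (x - generator_lift n (eval_words x)) + (y - generator_lift n (eval_words y))"
    using add by (simp add: eval_words_add[of _ "lie_series dg"] generator_lift_add)
  then show ?case using add uea_ideal_add by metis
qed

text \<open>
  An element whose evaluation starts in length \<open>n\<close> is congruent to the value \<open>0\<close> of the section. This
  identifies the \<open>n\<close>-th quotient with the series modulo length \<open>n\<close>.
\<close>

lemma uea_ideal_eq:
  "uea_ideal (L :: ('k::field, ('g, 'k) ncs) graded_lie) n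
     = {t \<in> carrier F. eval_words t \<in> length_ge n}"
proof
  show "{t \<in> carrier F. eval_words t \<in> length_ge n} \<subseteq> uea_ideal (L :: ('k, ('g, 'k) ncs) graded_lie) n"
  proof clarify
    fix t :: "(('g, 'k) ncs, 'k) ncs"
    assume "t \<in> carrier F" "eval_words t \<in> length_ge n"
    then show "t \<in> uea_ideal L n"
      using generator_lift_eval_words[of t n] by (simp add: generator_lift_length_ge)
  qed
qed (rule uea_ideal_subset)

subsection \<open>The inverse limit\<close>

text \<open>
  The element of the inverse limit that corresponds to a series: in each quotient it is given as the
  full preimage of the truncated series under the evaluation.
\<close>

definition uea_of_series ::
    "('g, 'k::field) ncs \<Rightarrow> nat \<Rightarrow> (('g, 'k) ncs, 'k) ncs set" where
  "uea_of_series f n = {t \<in> carrier F. eval_words t - f \<in> length_ge n}"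

lemma generator_lift_uea_of_series: "generator_lift n f \<in> uea_of_series f n"
  using length_ge_uminus[OF trunc_diff[of f n]]
  by (simp add: uea_of_series_def generator_lift_carrier eval_words_generator_lift)

lemma uea_of_series_coset:
  fixes f :: "('g, 'k::field) ncs"
  assumes t: "t \<in> uea_of_series f n"
  shows "uea_ideal L n +>\<^bsub>F\<^esub> t = uea_of_series f n"
proof -
  have t': "t \<in> carrier F" "eval_words t - f \<in> length_ge n"
    using t by (auto simp: uea_of_series_def)
  have "uea_ideal L n +>\<^bsub>F\<^esub> t = (\<lambda>h. h + t) ` uea_ideal L n"
    by (auto simp: a_r_coset_def' free_algebra_ops)
  also have "\<dots> = uea_of_series f n"
  proof safe
    fix h assume "h \<in> uea_ideal (L :: ('k, ('g, 'k) ncs) graded_lie) n"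
    then have h: "h \<in> carrier F" "eval_words h \<in> length_ge n"
      by (simp_all add: uea_ideal_eq)
    have "eval_words (h + t) - f = eval_words h + (eval_words t - f)"
      using h t' by (simp add: eval_words_add)
    then show "h + t \<in> uea_of_series f n"
      using h t' length_ge_add[OF h(2) t'(2)] by (simp add: uea_of_series_def free_algebra_add add_diff_eq)
  next
    fix s assume "s \<in> uea_of_series f n"
    then have s: "s \<in> carrier F" "eval_words s - f \<in> length_ge n"
      by (auto simp: uea_of_series_def)
    have "eval_words (s - t) = (eval_words s - f) - (eval_words t - f)"
      using s t' by (simp add: eval_words_diff)
    then have "s - t \<in> uea_ideal L n"
      using s t' length_ge_diff[OF s(2) t'(2)] by (simp add: uea_ideal_eq free_algebra_diff)
    then show "s \<in> (\<lambda>h. h + t) ` uea_ideal L n"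
      by (intro image_eqI[of _ _ "s - t"]) simp_all
  qed
  finally show ?thesis .
qed

lemma uea_of_series_eval:
  fixes t :: "(('g, 'k::field) ncs, 'k) ncs"
  assumes "t \<in> carrier F"
  shows "uea_ideal L n +>\<^bsub>F\<^esub> t = uea_of_series (eval_words t) n"
  using assms by (intro uea_of_series_coset) (simp add: uea_of_series_def)

lemma uea_of_series_cong:
  assumes "f - g \<in> length_ge n" shows "uea_of_series f n = uea_of_series g n"
proof -
  have "eval_words t - f \<in> length_ge n \<longleftrightarrow> eval_words t - g \<in> length_ge n" for t
    using length_ge_add[of "eval_words t - f" n "f - g"] length_ge_diff[of "eval_words t - g" n "f - g"]
      assms by auto
  then show ?thesis by (simp add: uea_of_series_def)
qed

lemma uea_of_series_memD:
  "t \<in> uea_of_series f n \<Longrightarrow> t \<in> uea_of_series g n \<Longrightarrow> f - g \<in> length_ge n"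
  using length_ge_diff[of "eval_words t - g" n "eval_words t - f"] by (simp add: uea_of_series_def)

text \<open>
  The coset of an element is given by its evaluation. Conversely, only the truncation of a series
  matters in a quotient, and truncations are evaluations of polynomials in the generators.
\<close>

lemma uea_quot_carrier:
  "carrier (uea_quot L n) = (\<lambda>f. uea_of_series f n) ` (UNIV :: ('g, 'k::field) ncs set)"
proof -
  have "carrier (uea_quot L n)
      = (\<lambda>t. uea_of_series (eval_words t) n) ` carrier (F :: (('g, 'k) ncs, 'k) ncs ring)"
    by (auto simp: uea_quot_def FactRing_def A_RCOSETS_def' complete_free_lie_simps uea_of_series_eval)
  also have "\<dots> = (\<lambda>f. uea_of_series f n) ` (UNIV :: ('g, 'k) ncs set)"
  proof safe
    fix f :: "('g, 'k) ncs"
    have "trunc n f - f \<in> length_ge n"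
      using length_ge_uminus[OF trunc_diff[of f n]] by simp
    then have "uea_of_series f n = uea_of_series (eval_words (generator_lift n f)) n"
      unfolding eval_words_generator_lift by (rule uea_of_series_cong[symmetric])
    then show "uea_of_series f n \<in> (\<lambda>t. uea_of_series (eval_words t) n) ` carrier F"
      using generator_lift_carrier by blast
  qed auto
  finally show ?thesis .
qed

lemma inj_uea_of_series: "inj (uea_of_series :: ('g, 'k::field) ncs \<Rightarrow> _)"
proof (rule injI)
  fix f g :: "('g, 'k) ncs" assume "uea_of_series f = uea_of_series g"
  then have "f - g \<in> length_ge n" for n
    using generator_lift_uea_of_series[of n f] by (intro uea_of_series_memD) auto
  then show "f = g" using length_ge_all_imp_zero[of "f - g"] by auto
qed

text \<open>A compatible family of truncated series glues to a series.\<close>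

lemma uea_carrier_eq:
  "uea_carrier (L :: ('k::field, ('g, 'k) ncs) graded_lie) = range uea_of_series"
proof safe
  fix s assume s: "s \<in> uea_carrier (L :: ('k, ('g, 'k) ncs) graded_lie)"
  then have "\<forall>n. s n \<in> range (\<lambda>f. uea_of_series f n)"
    by (simp add: uea_carrier_def uea_quot_carrier)
  then have "\<forall>n. \<exists>f. s n = uea_of_series f n"
    by blast
  then obtain f where f: "\<And>n. s n = uea_of_series (f n) n" by metis
  have step: "f (Suc n) - f n \<in> length_ge n" for n
  proof -
    have "generator_lift (Suc n) (f (Suc n)) \<in> s (Suc n)"
      by (simp add: f generator_lift_uea_of_series)
    moreover have "s (Suc n) \<subseteq> s n" using s by (simp add: uea_carrier_def)
    moreover have "s (Suc n) \<subseteq> uea_of_series (f (Suc n)) n"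
      unfolding f uea_of_series_def by (auto intro: length_ge_mono)
    ultimately show ?thesis
      using f by (intro uea_of_series_memD[of "generator_lift (Suc n) (f (Suc n))"]) auto
  qed
  have diff: "f n - f m \<in> length_ge m" if "m \<le> n" for m n
    using that
  proof (induction n rule: dec_induct)
    case (step n)
    have "f (Suc n) - f n \<in> length_ge m"
      using step(1) \<open>\<And>n. f (Suc n) - f n \<in> length_ge n\<close> by (blast intro: length_ge_mono)
    then show ?case using length_ge_add[OF step(3), of "f (Suc n) - f n"] by simp
  qed simp
  (* The coefficient at w is the same in all f n with n > length w. *)
  define h where "h = Ncs (\<lambda>w. nc_coeff (f (Suc (length w))) w)"
  have h: "nc_coeff h w = nc_coeff (f (Suc (length w))) w" for w
    by (simp add: h_def Ncs_inverse)
  have "f n - h \<in> length_ge n" for n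
    unfolding length_ge_def
  proof (intro CollectI allI impI)
    fix w :: "'g list" assume "length w < n"
    then show "nc_coeff (f n - h) w = 0"
      using diff[of "Suc (length w)" n] by (simp add: h length_ge_def)
  qed
  then have "s n = uea_of_series h n" for n
    unfolding f by (rule uea_of_series_cong)
  then show "s \<in> range uea_of_series" by (auto simp: fun_eq_iff)
next
  fix f :: "('g, 'k) ncs"
  show "uea_of_series f \<in> uea_carrier L"
    by (auto simp: uea_carrier_def uea_quot_carrier uea_of_series_def intro: length_ge_mono)
qed

lemma uea_quot_ops:
  fixes f g :: "('g, 'k::field) ncs"
  shows "uea_of_series f n \<otimes>\<^bsub>uea_quot L n\<^esub> uea_of_series g n = uea_of_series (f * g) n"
    and "uea_of_series f n \<oplus>\<^bsub>uea_quot L n\<^esub> uea_of_series g n = uea_of_series (f + g) n"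
    and "\<one>\<^bsub>uea_quot L n\<^esub> = uea_of_series (1 :: ('g, 'k) ncs) n"
    and "\<zero>\<^bsub>uea_quot L n\<^esub> = uea_of_series (0 :: ('g, 'k) ncs) n"
proof -
  interpret I: ideal "uea_ideal L n" F by (rule uea_ideal_ideal)
  let ?I = "uea_ideal (L :: ('k, ('g, 'k) ncs) graded_lie) n"
  let ?f = "generator_lift n f" and ?g = "generator_lift n g"
  have fg: "uea_of_series f n = ?I +>\<^bsub>F\<^esub> ?f" "uea_of_series g n = ?I +>\<^bsub>F\<^esub> ?g"
    by (rule uea_of_series_coset[OF generator_lift_uea_of_series, symmetric])+
  have "eval_words (?f * ?g) - f * g = - ((f - trunc n f) * trunc n g) - f * (g - trunc n g)"
    by (simp add: eval_words_mult[OF generator_lift_carrier generator_lift_carrier] eval_words_generator_lift algebra_simps)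
  also have "\<dots> \<in> length_ge n"
    by (intro length_ge_diff length_ge_uminus length_ge_mult_right[OF trunc_diff]
        length_ge_mult_left[OF trunc_diff])
  finally have mult: "?f * ?g \<in> uea_of_series (f * g) n"
    by (simp add: uea_of_series_def free_algebra_mult generator_lift_carrier)
  have "eval_words (?f + ?g) - (f + g) = - (f - trunc n f) - (g - trunc n g)"
    by (simp add: eval_words_add[OF generator_lift_carrier generator_lift_carrier] eval_words_generator_lift algebra_simps)
  also have "\<dots> \<in> length_ge n"
    by (intro length_ge_diff length_ge_uminus trunc_diff)
  finally have add: "?f + ?g \<in> uea_of_series (f + g) n"
    by (simp add: uea_of_series_def free_algebra_add generator_lift_carrier)
  show "uea_of_series f n \<otimes>\<^bsub>uea_quot L n\<^esub> uea_of_series g n = uea_of_series (f * g) n"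
    using I.rcoset_mult_add[OF generator_lift_carrier generator_lift_carrier, of n f n g]
      uea_of_series_coset[OF mult]
    by (simp add: fg uea_quot_def FactRing_def complete_free_lie_simps free_algebra_ops)
  show "uea_of_series f n \<oplus>\<^bsub>uea_quot L n\<^esub> uea_of_series g n = uea_of_series (f + g) n"
    using I.a_rcos_sum[OF generator_lift_carrier generator_lift_carrier, of n f n g]
      uea_of_series_coset[OF add]
    by (simp add: fg uea_quot_def FactRing_def complete_free_lie_simps free_algebra_ops)
  have "(1 :: (('g, 'k) ncs, 'k) ncs) \<in> carrier F"
    using free_algebra_word[of "[]"] by (simp add: word_Nil)
  from uea_of_series_eval[OF this]
  show "\<one>\<^bsub>uea_quot L n\<^esub> = uea_of_series (1 :: ('g, 'k) ncs) n"
    by (simp add: uea_quot_def FactRing_def complete_free_lie_simps free_algebra_ops eval_words_one)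
  have "\<zero>\<^bsub>uea_quot L n\<^esub> = ?I"
    by (simp add: uea_quot_def FactRing_def)
  also have "?I = uea_of_series 0 n"
    by (simp only: uea_ideal_eq uea_of_series_def diff_zero)
  finally show "\<zero>\<^bsub>uea_quot L n\<^esub> = uea_of_series (0 :: ('g, 'k) ncs) n" .
qed

lemma uea_smult:
  fixes f :: "('g, 'k::field) ncs"
  shows "(\<Union>t\<in>uea_of_series f n. uea_ideal L n +>\<^bsub>F\<^esub> scal c t) = uea_of_series (scal c f) n"
proof -
  have "uea_ideal L n +>\<^bsub>F\<^esub> scal c t = uea_of_series (scal c f) n" if "t \<in> uea_of_series f n" for t
    using that length_ge_scal[of "eval_words t - f" n c]
    by (intro uea_of_series_coset)
      (simp add: uea_of_series_def free_algebra_scal eval_words_scal[of _ "lie_series dg"]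
        ncs.scale_right_diff_distrib)
  then show ?thesis using generator_lift_uea_of_series[of n f] by auto
qed

lemma uea_inj_eq:
  fixes x :: "('g, 'k::field) ncs"
  assumes "x \<in> lie_series dg"
  shows "uea_inj L x = uea_of_series x"
  using uea_of_series_eval[OF free_algebra_gen[OF assms]]
  by (auto simp: uea_inj_def complete_free_lie_simps eval_words_word)

lemma free_hom_part_eval:
  fixes t :: "(('g, 'k::field) ncs, 'k) ncs"
  assumes t: "t \<in> free_hom_part L d"
  shows "eval_words t \<in> homogeneous dg d"
  unfolding eval_words_def
proof (intro homogeneous_sum homogeneous_scal)
  fix xs assume "xs \<in> {xs. nc_coeff t xs \<noteq> 0}"
  then obtain ds where ds: "list_all2 (\<lambda>x e. x \<in> lie_series dg \<inter> homogeneous dg e) xs ds" "sum_list ds = d"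
    using t by (auto simp: free_hom_part_def complete_free_lie_simps)
  have "prod_list xs \<in> homogeneous dg (sum_list ds)"
    using ds(1) by (induction rule: list_all2_induct) (auto intro: homogeneous_mult)
  then show "prod_list xs \<in> homogeneous dg d" by (simp add: ds)
qed

lemma generator_lift_hom:
  fixes f :: "('g, 'k::field) ncs"
  assumes "f \<in> homogeneous dg d"
  shows "generator_lift n f \<in> free_hom_part L d"
  unfolding free_hom_part_def complete_free_lie_simps
proof (intro CollectI conjI allI impI generator_lift_carrier)
  fix xs assume "nc_coeff (generator_lift n f) xs \<noteq> 0"
  then obtain w where w: "nc_coeff f w * nc_coeff (word (map gen w)) xs \<noteq> 0"
    unfolding generator_lift_def nc_coeff_sum nc_coeff_simps using sum.not_neutral_contains_not_neutral
    by blast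
  then have "xs = map gen w" "word_deg dg w = d"
    using assms by (auto simp: nc_coeff_word homogeneous_def split: if_splits)
  then show "\<exists>ds. list_all2 (\<lambda>x e. x \<in> lie_series dg \<inter> homogeneous dg e) xs ds \<and> sum_list ds = d"
    by (intro exI[of _ "map dg w"])
      (auto simp: word_deg_def list_all2_conv_all_nth lie_series_gen)
qed

text \<open>
  Homogeneity in every quotient determines all coefficients of the series; conversely, the section
  lifts homogeneous series to homogeneous elements.
\<close>

lemma uea_of_series_hom_part:
  fixes f :: "('g, 'k::field) ncs"
  shows "(\<forall>n. uea_of_series f n \<inter> free_hom_part L d \<noteq> {}) \<longleftrightarrow> f \<in> homogeneous dg d"
proof safe
  assume *: "\<forall>n. uea_of_series f n \<inter> free_hom_part L d \<noteq> {}"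
  show "f \<in> homogeneous dg d"
    unfolding homogeneous_def
  proof (intro CollectI allI impI)
    fix w assume w: "nc_coeff f w \<noteq> 0"
    obtain t where t: "t \<in> uea_of_series f (Suc (length w))" "t \<in> free_hom_part L d"
      using * by blast
    then have "nc_coeff (eval_words t) w = nc_coeff f w"
      by (simp add: uea_of_series_def length_ge_def)
    then show "word_deg dg w = d"
      using free_hom_part_eval[OF t(2)] w by (simp add: homogeneous_def)
  qed
next
  fix n assume "f \<in> homogeneous dg d" "uea_of_series f n \<inter> free_hom_part L d = {}"
  then show False
    using generator_lift_hom[of f d n] generator_lift_uea_of_series[of n f] by blast
qed

end

subsection \<open>Algebras isomorphic to the algebra of series\<close>

text \<open>
  A graded algebra with the structure of the complete tensor algebra transported along an injection.
  Both the completed enveloping algebra and the cylinder are of this form over the same series, which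
  reduces the comparison of their derivations to series.
\<close>

locale series_model =
  fixes A :: "('k::field, 'a, 'm) graded_algebra_scheme" (structure)
    and \<phi> :: "('g::finite, 'k) ncs \<Rightarrow> 'a" and dg :: "'g \<Rightarrow> int"
  assumes inj: "inj \<phi>" and carrier_eq: "carrier A = range \<phi>"
    and phi_mult: "\<phi> x \<otimes> \<phi> y = \<phi> (x * y)" and phi_one: "\<one> = \<phi> 1"
    and phi_add: "\<phi> x \<oplus> \<phi> y = \<phi> (x + y)" and phi_zero: "\<zero> = \<phi> 0"
    and phi_smult: "c \<odot> \<phi> x = \<phi> (scal c x)"
    and hom_part: "hom_part A d = \<phi> ` homogeneous dg d"
    and fil: "fil A n = \<phi> ` length_ge n"
begin

lemma ring: "ring A"
  by (rule ringI; (rule abelian_groupI | rule monoidI)?)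
    (auto simp: carrier_eq phi_mult phi_add phi_one phi_zero algebra_simps inj_eq[OF inj] intro: exI[of _ "- _"])

lemma module: "module (ring_of_type_algebra :: 'k ring) A"
  by (rule moduleI[OF cring_from_type_algebra ring.is_abelian_group[OF ring]])
    (auto simp: ring_of_type_algebra_def carrier_eq phi_add phi_smult ncs.scale_left_distrib ncs.scale_right_distrib)

lemma uminus: "\<ominus> \<phi> x = \<phi> (- x)"
proof -
  interpret ring A by (rule ring)
  show ?thesis by (rule minus_equality) (simp_all add: phi_add phi_zero carrier_eq)
qed

lemma submodule: "submodule (hom_part A d) (ring_of_type_algebra :: 'k ring) A"
  by (rule module.submoduleI[OF module])
    (auto simp: hom_part carrier_eq phi_zero uminus phi_add phi_smult homogeneous_uminus homogeneous_add homogeneous_scal)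

lemma finsum: "finite S \<Longrightarrow> (\<Oplus>i\<in>S. \<phi> (x i)) = \<phi> (\<Sum>i\<in>S. x i)"
proof (induction S rule: finite_induct)
  case empty
  interpret ring A by (rule ring)
  show ?case by (simp add: phi_zero)
next
  case (insert i S)
  interpret ring A by (rule ring)
  show ?case using insert by (simp add: phi_add carrier_eq)
qed

text \<open>Series of different degrees have disjoint supports.\<close>

lemma hom_part_independent:
  assumes S: "finite S" and x: "\<forall>d\<in>S. x d \<in> hom_part A d" and sum: "(\<Oplus>d\<in>S. x d) = \<zero>" and d: "d \<in> S"
  shows "x d = \<zero>"
proof -
  interpret ring A by (rule ring)
  have "\<forall>d\<in>S. \<exists>y. y \<in> homogeneous dg d \<and> x d = \<phi> y"
    using x by (auto simp: hom_part)
  then obtain y where y: "\<And>d. d \<in> S \<Longrightarrow> y d \<in> homogeneous dg d" "\<And>d. d \<in> S \<Longrightarrow> x d = \<phi> (y d)"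
    by metis
  have "(\<Oplus>d\<in>S. x d) = (\<Oplus>d\<in>S. \<phi> (y d))"
    by (rule finsum_cong') (auto simp: y carrier_eq)
  then have "(\<Sum>d\<in>S. y d) = 0"
    using sum by (simp add: finsum S phi_zero inj_eq[OF inj])
  have "nc_coeff (y d) w = 0" for w
  proof (rule ccontr)
    assume w: "nc_coeff (y d) w \<noteq> 0"
    have "nc_coeff (y e) w = 0" if "e \<in> S - {d}" for e
      using y(1)[of e] y(1)[OF d] w that by (auto simp: homogeneous_def)
    then have "(\<Sum>e\<in>S. nc_coeff (y e) w) = nc_coeff (y d) w"
      using sum.remove[OF S d, of "\<lambda>e. nc_coeff (y e) w"] by simp
    then show False
      using \<open>(\<Sum>d\<in>S. y d) = 0\<close> w by (metis nc_coeff_sum nc_coeff_simps(1))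
  qed
  then have "y d = 0" by (intro ncs_eqI) simp
  then show ?thesis using y(2)[OF d] by (simp add: phi_zero)
qed

definition transport :: "(('g, 'k) ncs \<Rightarrow> ('g, 'k) ncs) \<Rightarrow> 'a \<Rightarrow> 'a" where
  "transport D = (\<lambda>s\<in>carrier A. \<phi> (D (inv_into UNIV \<phi> s)))"

lemma transport_apply: "transport D (\<phi> x) = \<phi> (D x)"
  by (simp add: transport_def carrier_eq inj)

lemma derivation:
  assumes D: "graded_derivation dg D" and E: "\<And>x. E (\<phi> x) = \<phi> (D x)"
  shows "derivation A E"
  unfolding derivation_def
  by (auto simp: carrier_eq E phi_add phi_smult phi_mult hom_part graded_derivationD(3)[OF D]
      cont_linear_add[OF graded_derivationD(1)[OF D]] cont_linear_scal[OF graded_derivationD(1)[OF D]]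
      twist_homogeneous scal_mult intro: graded_derivationD(2)[OF D])

lemma continuous_derivation_transport:
  assumes D: "graded_derivation dg D"
  shows "continuous_derivation A (transport D)"
proof -
  note cl = graded_derivationD(1)[OF D]
  have cont: "\<exists>m. \<forall>x\<in>fil A m. transport D x \<in> fil A n" for n
  proof -
    obtain m where "\<And>x. x \<in> length_ge m \<Longrightarrow> D x \<in> length_ge n"
      using cont_linear_cont[OF cl] by blast
    then show ?thesis by (intro exI[of _ m]) (auto simp: fil transport_apply)
  qed
  moreover have "transport D \<in> extensional (carrier A)"
    by (simp add: transport_def)
  ultimately show ?thesis
    using derivation[OF D transport_apply] by (simp add: continuous_derivation_def)
qed

lemma graded_derivation_transport:
  assumes E: "continuous_derivation A E"
  shows "graded_derivation dg (\<lambda>x. inv_into UNIV \<phi> (E (\<phi> x)))"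
proof -
  define D where "D = (\<lambda>x. inv_into UNIV \<phi> (E (\<phi> x)))"
  have E': "derivation A E" "E \<in> carrier A \<rightarrow> carrier A"
    "\<And>n. \<exists>m. \<forall>x\<in>fil A m. E x \<in> fil A n"
    using E by (auto simp: continuous_derivation_def derivation_def)
  have \<phi>D: "E (\<phi> x) = \<phi> (D x)" for x
  proof -
    have "E (\<phi> x) \<in> range \<phi>" using E'(2) by (auto simp: carrier_eq)
    then show ?thesis by (simp add: D_def f_inv_into_f)
  qed
  have "continuous_derivation (complete_tensor dg) D"
    unfolding continuous_derivation_def
  proof (intro conjI allI)
    show "derivation (complete_tensor dg) D"
      using E'(1) unfolding derivation_def
      by (auto simp: carrier_eq \<phi>D phi_add phi_smult phi_mult hom_part inj_eq[OF inj] complete_tensor_def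
          inj_image_mem_iff[OF inj])
    show "\<exists>m. \<forall>x\<in>fil (complete_tensor dg) m. D x \<in> fil (complete_tensor dg) n" for n
      using E'(3)[of n] by (auto simp: fil \<phi>D inj_image_mem_iff[OF inj] complete_tensor_def)
  qed (simp add: complete_tensor_def)
  then show ?thesis
    by (simp add: continuous_derivation_complete_tensor D_def)
qed

lemma transport_unique:
  assumes E: "continuous_derivation A E" and D: "graded_derivation dg D"
    and gen: "\<And>g. E (\<phi> (gen g)) = \<phi> (D (gen g))"
  shows "E = transport D"
proof (rule extensionalityI[of _ "carrier A"])
  have "(\<lambda>x. inv_into UNIV \<phi> (E (\<phi> x))) = D"
    by (rule graded_derivation_unique[OF graded_derivation_transport[OF E] D]) (simp add: gen inj)
  then have D_eq: "D x = inv_into UNIV \<phi> (E (\<phi> x))" for x by auto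
  fix s assume "s \<in> carrier A"
  then obtain x where s: "s = \<phi> x" by (auto simp: carrier_eq)
  have "E (\<phi> x) \<in> range \<phi>"
    using E by (auto simp: continuous_derivation_def derivation_def carrier_eq)
  then show "E s = transport D s"
    by (simp add: s transport_apply D_eq f_inv_into_f)
qed (use E in \<open>auto simp: continuous_derivation_def transport_def\<close>)

end

lemma series_model_complete_uea:
  "series_model (complete_uea (complete_free_lie dg)) (uea_of_series dg :: ('g::finite, 'k::field) ncs \<Rightarrow> _) dg"
proof unfold_locales
  let ?L = "complete_free_lie dg :: ('k, ('g, 'k) ncs) graded_lie"
  let ?\<phi> = "uea_of_series dg :: ('g, 'k) ncs \<Rightarrow> _"
  show "inj ?\<phi>" by (rule inj_uea_of_series)
  show "carrier (complete_uea ?L) = range ?\<phi>"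
    by (simp add: complete_uea_def uea_carrier_eq)
  show "hom_part (complete_uea ?L) d = ?\<phi> ` homogeneous dg d" for d
  proof -
    have "homogeneous dg d = {f. \<forall>n. ?\<phi> f n \<inter> free_hom_part ?L d \<noteq> {}}"
      by (simp only: uea_of_series_hom_part Collect_mem_eq)
    then show ?thesis
      by (auto simp: complete_uea_def uea_carrier_eq)
  qed
  show "fil (complete_uea ?L) n = ?\<phi> ` length_ge n" for n
  proof -
    have "?\<phi> f n = ?\<phi> 0 n \<longleftrightarrow> f \<in> length_ge n" for f
      using uea_of_series_cong[of f 0 n dg] generator_lift_uea_of_series[of n f dg]
        uea_of_series_memD[of "generator_lift n f" dg f n 0] by auto
    then show ?thesis
      by (auto simp: complete_uea_def uea_carrier_eq uea_quot_ops)
  qed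
qed (simp_all add: complete_uea_def uea_quot_ops uea_smult complete_free_lie_simps)

lemma with_diff_simps:
  "carrier (with_diff A D) = carrier A" "monoid.mult (with_diff A D) = monoid.mult A"
  "monoid.one (with_diff A D) = monoid.one A" "ring.zero (with_diff A D) = ring.zero A"
  "ring.add (with_diff A D) = ring.add A" "module.smult (with_diff A D) = module.smult A"
  "hom_part (with_diff A D) = hom_part A" "fil (with_diff A D) = fil A" "diff (with_diff A D) = D"
  by (simp_all add: with_diff_def graded_algebra.defs dg_algebra.defs)

lemma series_model_with_diff:
  "series_model A \<phi> dg \<Longrightarrow> series_model (with_diff A D) \<phi> dg"
  by (simp add: series_model_def with_diff_simps)

lemma is_dg_algebra_series_model:
  fixes A :: "('k::field, 'a, 'm) dg_algebra_scheme"
  assumes "series_model A \<phi> dg" and D: "graded_derivation dg D" and sq: "\<And>x. D (D x) = 0"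
    and diff: "\<And>x. diff A (\<phi> x) = \<phi> (D x)"
  shows "is_dg_algebra A"
proof -
  interpret series_model A \<phi> dg by fact
  show ?thesis
    unfolding is_dg_algebra_def
  proof (intro conjI)
    show "\<forall>S x. finite S \<and> (\<forall>d\<in>S. x d \<in> hom_part A d) \<and> finsum A x S = \<zero>\<^bsub>A\<^esub>
        \<longrightarrow> (\<forall>d\<in>S. x d = \<zero>\<^bsub>A\<^esub>)"
      using hom_part_independent by blast
  qed (auto simp: ring module submodule[unfolded hom_part] derivation[OF D diff] carrier_eq phi_smult phi_mult phi_one
      phi_zero hom_part scal_mult diff sq intro: homogeneous_mult)
qed

text \<open>The isomorphism reads off the series from one model and rebuilds it in the other.\<close>

lemma dga_isomorphic_series_models:
  assumes "series_model A \<phi> dg" "\<And>x. diff A (\<phi> x) = \<phi> (D x)"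
    and "series_model B \<psi> dg" "\<And>x. diff B (\<psi> x) = \<psi> (D x)"
    and "graded_derivation dg D" "\<And>x. D (D x) = 0"
  shows "dga_isomorphic A B"
proof -
  interpret A: series_model A \<phi> dg by fact
  interpret B: series_model B \<psi> dg by fact
  define h where "h = (\<lambda>s. \<psi> (inv_into UNIV \<phi> s))"
  have h: "h (\<phi> x) = \<psi> x" for x
    by (simp add: h_def A.inj)
  have "h \<in> ring_iso A B"
    unfolding ring_iso_def
  proof (intro CollectI conjI ring_hom_memI)
    show "bij_betw h (carrier A) (carrier B)"
      by (auto simp: bij_betw_def inj_on_def A.carrier_eq B.carrier_eq h inj_eq[OF B.inj] image_iff)
  qed (auto simp: A.carrier_eq B.carrier_eq h A.phi_mult B.phi_mult A.phi_add B.phi_add A.phi_one B.phi_one)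
  moreover have "h ` hom_part A d = hom_part B d" for d
    by (simp add: A.hom_part B.hom_part image_image h)
  ultimately have "h \<in> dga_iso A B"
    by (auto simp: dga_iso_def A.carrier_eq A.phi_smult B.phi_smult h assms(2,4))
  moreover have "is_dg_algebra A" "is_dg_algebra B"
    using is_dg_algebra_series_model assms by blast+
  ultimately show ?thesis
    by (auto simp: dga_isomorphic_def)
qed

subsection \<open>Renaming letters\<close>

text \<open>Series are pulled back along a map of letters in the opposite direction.\<close>

lift_definition rename :: "('h \<Rightarrow> 'g) \<Rightarrow> ('g, 'k::field) ncs \<Rightarrow> ('h, 'k) ncs"
  is "\<lambda>h f w. f (map h w)" .

lemma nc_coeff_rename [simp]: "nc_coeff (rename h f) w = nc_coeff f (map h w)"
  by (simp add: rename.rep_eq)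

lemma sum_splits_take_drop:
  "(\<Sum>(u, v)\<in>splits w. f u v) = (\<Sum>i\<le>length w. f (take i w) (drop i w))"
proof -
  have "inj_on (\<lambda>i. (take i w, drop i w)) {..length w}"
    by (rule inj_onI) (metis Pair_inject atMost_iff length_take min.absorb2)
  then show ?thesis
    unfolding splits_eq by (simp add: sum.reindex)
qed

lemma rename_mult: "rename h (f * g) = rename h f * rename h g"
  by (rule ncs_eqI) (simp add: nc_coeff_times sum_splits_take_drop take_map drop_map)

lemma rename_simps:
  "rename h 1 = 1" "rename h 0 = 0" "rename h (f + g) = rename h f + rename h g"
  "rename h (f - g) = rename h f - rename h g" "rename h (- f) = - rename h f"
  "rename h (scal c f) = scal c (rename h f)"
  by (auto intro!: ncs_eqI simp: nc_coeff_one)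

lemma rename_length_ge: "f \<in> length_ge n \<Longrightarrow> rename h f \<in> length_ge n"
  by (simp add: length_ge_def)

lemma cont_linear_rename: "cont_linear (rename h)"
  by (rule cont_linearI) (auto simp: rename_simps rename_length_ge)

lemma rename_gen:
  assumes "bij h" shows "rename h (gen (h g)) = gen g"
  using assms by (intro ncs_eqI) (auto simp: nc_coeff_word map_eq_Cons_conv dest: bij_is_inj injD)

lemma series_model_rename:
  fixes h :: "'h::finite \<Rightarrow> 'g::finite" and dg :: "'g \<Rightarrow> int"
  assumes h: "bij h" and dg': "dg' = dg \<circ> h"
  shows "series_model (complete_tensor dg') (rename h :: ('g, 'k::field) ncs \<Rightarrow> _) dg"
proof -
  let ?h' = "inv_into UNIV h"
  have h': "map h (map ?h' w) = w" "map ?h' (map h v) = v" for w v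
    using bij_is_surj[OF h] bij_is_inj[OF h] by (simp_all add: map_idI surj_f_inv_f o_def)
  have inv: "rename h (rename ?h' f) = f" "rename ?h' (rename h f') = f'"
    for f :: "('h, 'k) ncs" and f' :: "('g, 'k) ncs"
    by (rule ncs_eqI, simp only: nc_coeff_rename h')+
  have deg: "word_deg dg (map h w) = word_deg dg' w" for w
    by (simp add: word_deg_def dg' o_def)
  have deg': "word_deg dg' (map ?h' w) = word_deg dg w" for w
    using deg[of "map ?h' w"] by (simp only: h')
  have image: "rename h ` S = S'"
    if "\<And>f. f \<in> S \<Longrightarrow> rename h f \<in> S'" "\<And>f. f \<in> S' \<Longrightarrow> rename ?h' f \<in> S"
    for S :: "('g, 'k) ncs set" and S'
    using that inv by (auto simp: image_iff) metis
  show ?thesis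
  proof unfold_locales
    show "inj (rename h :: ('g, 'k) ncs \<Rightarrow> _)"
      by (rule injI) (metis inv(2))
    have "rename h ` (UNIV :: ('g, 'k) ncs set) = UNIV" by (rule image) auto
    then show "carrier (complete_tensor dg') = range (rename h :: ('g, 'k) ncs \<Rightarrow> _)"
      by (simp add: complete_tensor_def)
    show "hom_part (complete_tensor dg') d = rename h ` (homogeneous dg d :: ('g, 'k) ncs set)" for d
      unfolding complete_tensor_def
      by (simp, rule image[symmetric]) (auto simp: homogeneous_def deg deg' simp del: map_map)
    show "fil (complete_tensor dg') n = rename h ` (length_ge n :: ('g, 'k) ncs set)" for n
      unfolding complete_tensor_def
      by (simp, rule image[symmetric]) (auto simp: rename_length_ge)
  qed (simp_all add: complete_tensor_def rename_mult rename_simps)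
qed

section \<open>The Lawrence-Sullivan derivation\<close>

fun LS_values :: "ls_gen \<Rightarrow> (ls_gen, 'k::field_char_0) ncs" where
  "LS_values Ga = - (gen Ga * gen Ga)"
| "LS_values Gb = - (gen Gb * gen Gb)"
| "LS_values Gz = ad (gen Gz) (gen Gb) + ad_series bernoulli_fps (gen Gz) (gen Gb - gen Ga)"

definition LS_derivation :: "(ls_gen, 'k::field_char_0) ncs \<Rightarrow> (ls_gen, 'k) ncs" where
  "LS_derivation = derivation_ext ls_deg LS_values"

lemma gen_length: "gen g \<in> length_ge 1"
  by (simp add: length_ge_word)

lemma LS_values_length: "LS_values g \<in> length_ge 1"
  by (cases g) (auto simp del: One_nat_def simp: ad_def
    intro!: length_ge_add length_ge_diff length_ge_uminus length_ge_mult_left ad_series_length gen_length)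

lemma ad_power_homogeneous:
  assumes "z \<in> homogeneous dg 0" "x \<in> homogeneous dg d"
  shows "(ad z ^^ i) x \<in> homogeneous dg d"
proof (induction i)
  case (Suc i)
  then show ?case
    using homogeneous_mult[OF assms(1) Suc] homogeneous_mult[OF Suc assms(1)]
    by (simp add: ad_def[of z "(ad z ^^ i) x"] homogeneous_diff)
qed (use assms in simp)

lemma ls_homogeneous:
  "gen Ga \<in> homogeneous ls_deg (-1)" "gen Gb \<in> homogeneous ls_deg (-1)" "gen Gz \<in> homogeneous ls_deg 0"
  using homogeneous_gen[of Ga ls_deg] homogeneous_gen[of Gb ls_deg] homogeneous_gen[of Gz ls_deg] by simp_all

lemma LS_values_homogeneous:
  "(LS_values g :: (ls_gen, 'k::field_char_0) ncs) \<in> homogeneous ls_deg (ls_deg g - 1)"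
proof (cases g)
  case Gz
  have "ad_series bernoulli_fps (gen Gz) (gen Gb - gen Ga :: (ls_gen, 'k) ncs) \<in> homogeneous ls_deg (-1)"
    unfolding ad_series_def
    by (intro homogeneous_formal_sum ad_series_terms_length gen_length homogeneous_scal
        ad_power_homogeneous homogeneous_diff ls_homogeneous)
  moreover have "ad (gen Gz) (gen Gb :: (ls_gen, 'k) ncs) \<in> homogeneous ls_deg (-1)"
    using ad_power_homogeneous[OF ls_homogeneous(3,2), of 1] by simp
  ultimately show ?thesis by (simp add: Gz homogeneous_add)
qed (auto intro!: homogeneous_uminus homogeneous_mult[OF ls_homogeneous(1,1), simplified]
      homogeneous_mult[OF ls_homogeneous(2,2), simplified])

lemma LS_derivation:
  shows graded_derivation_LS: "graded_derivation ls_deg LS_derivation"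
    and LS_derivation_gen: "LS_derivation (gen g) = LS_values g"
    and LS_derivation_length: "x \<in> length_ge n \<Longrightarrow> LS_derivation x \<in> length_ge n"
  unfolding LS_derivation_def
  by (intro graded_derivation_ext derivation_ext_gen derivation_ext_length_ge LS_values_length
      LS_values_homogeneous | assumption)+

lemma LS_derivation_square_zero:
  fixes x :: "(ls_gen, 'k::field_char_0) ncs"
  shows "LS_derivation (LS_derivation x) = 0"
proof (rule graded_derivation_square_zero[OF graded_derivation_LS])
  note D = graded_derivation_LS
  note cl = graded_derivationD(1)[OF D]
  have odd: "LS_derivation (LS_derivation (gen g)) = (0 :: (ls_gen, 'k) ncs)"
    if "(gen g :: (ls_gen, 'k) ncs) \<in> homogeneous ls_deg (-1)"
      "(LS_values g :: (ls_gen, 'k) ncs) = - (gen g * gen g)" for g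
  proof -
    have "twist ls_deg (gen g :: (ls_gen, 'k) ncs) = - gen g"
      using twist_homogeneous[OF that(1)] by simp
    then show ?thesis
      by (simp add: LS_derivation_gen that(2) cont_linear_uminus[OF cl] graded_derivationD(3)[OF D]
          mult.assoc)
  qed
  show "LS_derivation (LS_derivation (gen g)) = (0 :: (ls_gen, 'k) ncs)" for g
  proof (cases g)
    case Gz
    show ?thesis
      unfolding Gz
      by (rule bernoulli_derivation_square_zero[OF gen_length D LS_derivation_length,
            where a = "gen Ga" and b = "gen Gb"])
        (simp_all add: LS_derivation_gen ls_homogeneous)
  qed (simp_all add: odd ls_homogeneous)
qed

lemma ad_power_comm:
  "(comm ls_deg (gen Gz) ^^ i) x = (ad (gen Gz) ^^ i) x"
proof -
  have "comm ls_deg (gen Gz) = ad (gen Gz :: (ls_gen, 'a::field) ncs)"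
    by (rule ext) (rule comm_degree_0[OF ls_homogeneous(3)])
  then show ?thesis by simp
qed

lemma comm_odd_self:
  assumes "x \<in> homogeneous dg (-1)"
  shows "scal (-1/2) (comm dg x x) = - (x * x :: ('g, 'k::field_char_0) ncs)"
proof -
  have "comm dg x x = scal 2 (x * x)"
    using comm_homogeneous[OF assms assms] ncs.scale_left_distrib[of 1 1 "x * x"] by simp
  then show ?thesis by simp
qed

lemma LS_values_eq:
  "LS_values Ga = scal (-1/2) (comm ls_deg (gen Ga) (gen Ga))"
  "LS_values Gb = scal (-1/2) (comm ls_deg (gen Gb) (gen Gb))"
  "LS_values Gz = comm ls_deg (gen Gz) (gen Gb) +
     formal_sum (\<lambda>i. scal (bernoulli i / fact i) ((comm ls_deg (gen Gz) ^^ i) (gen Gb - gen Ga)))"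
  unfolding ad_power_comm comm_degree_0[OF ls_homogeneous(3)] comm_odd_self[OF ls_homogeneous(1)]
    comm_odd_self[OF ls_homogeneous(2)]
  by (simp_all add: ad_series_def bernoulli_fps_def)

lemma LS_values_lie: "LS_values g \<in> lie_series ls_deg"
proof (cases g)
  case Gz
  have comm: "(comm ls_deg (gen Gz) ^^ i) (gen Gb - gen Ga) \<in> lie_series ls_deg" for i
    by (induction i) (auto intro: lie_series_comm lie_series_gen lie_series_diff)
  have "scal c ((comm ls_deg (gen Gz) ^^ i) x) \<in> length_ge i" for c i and x :: "(ls_gen, 'a) ncs"
    unfolding ad_power_comm by (rule ad_series_terms_length[OF gen_length])
  then show ?thesis
    unfolding Gz LS_values_eq
    by (intro lie_series_add lie_series_comm lie_series_gen lie_series_formal_sum lie_series_scal comm)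
qed (simp_all only: LS_values_eq lie_series_scal lie_series_comm lie_series_gen)

text \<open>The restriction has the defining properties of the Lie differential, and these determine it.\<close>

lemma LS_diff_eq: "LS_diff = restrict LS_derivation (lie_series ls_deg)"
  unfolding LS_diff_def LS_lie_def
proof (rule the_equality, goal_cases)
  case 1
  have "continuous_lie_derivation (complete_free_lie ls_deg) (restrict LS_derivation (lie_series ls_deg))"
    by (rule continuous_lie_derivation_restrict[OF graded_derivation_LS LS_derivation_length])
      (simp_all add: LS_derivation_gen LS_values_lie)
  then show ?case
    by (simp add: lie_series_gen LS_derivation_gen LS_values_eq del: LS_values.simps)
next
  case (2 d)
  have "d (gen g) = LS_values g" for g
    using 2 by (cases g) (simp_all add: LS_values_eq del: LS_values.simps)
  then show ?case
    using 2 by (intro continuous_lie_derivation_unique[of ls_deg] conjI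
        continuous_lie_derivation_restrict[OF graded_derivation_LS LS_derivation_length])
      (auto simp: LS_derivation_gen LS_values_lie lie_series_gen simp del: LS_values.simps)
qed

text \<open>
  The letters are Lie series, so the condition on the image of the Lie algebra fixes the values on the
  generators of the series algebra; the transported derivation meets it because \<open>D\<close> extends the
  differential of the Lie algebra.
\<close>

lemma uea_diff_eq:
  fixes D :: "('g::finite, 'k::field) ncs \<Rightarrow> ('g, 'k) ncs"
  assumes D: "graded_derivation dg D" and lie: "\<And>x. x \<in> lie_series dg \<Longrightarrow> D x \<in> lie_series dg"
  shows "uea_diff (complete_free_lie dg) (restrict D (lie_series dg)) (uea_of_series dg x)
    = uea_of_series dg (D x)"
proof -
  interpret series_model "complete_uea (complete_free_lie dg)" "uea_of_series dg" dg
    by (rule series_model_complete_uea)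
  have "uea_diff (complete_free_lie dg) (restrict D (lie_series dg)) = transport D"
    unfolding uea_diff_def complete_free_lie_simps
  proof (rule the_equality)
    show "continuous_derivation (complete_uea (complete_free_lie dg)) (transport D) \<and>
      (\<forall>x\<in>lie_series dg. transport D (uea_inj (complete_free_lie dg) x)
         = uea_inj (complete_free_lie dg) (restrict D (lie_series dg) x))"
      by (simp add: continuous_derivation_transport[OF D] uea_inj_eq lie transport_apply)
  next
    fix E assume "continuous_derivation (complete_uea (complete_free_lie dg)) E \<and>
      (\<forall>x\<in>lie_series dg. E (uea_inj (complete_free_lie dg) x)
         = uea_inj (complete_free_lie dg) (restrict D (lie_series dg) x))"
    then show "E = transport D"
      by (intro transport_unique D) (auto simp: uea_inj_eq lie lie_series_gen)
  qed
  then show ?thesis by (simp add: transport_apply)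
qed

section \<open>The cylinder\<close>

fun ls_of_cyl :: "cyl_gen \<Rightarrow> ls_gen" where
  "ls_of_cyl Gu = Ga" | "ls_of_cyl Gu' = Gb" | "ls_of_cyl Gsu = Gz"

lemma bij_ls_of_cyl: "bij ls_of_cyl"
proof (rule bijI)
  show "inj ls_of_cyl"
  proof (rule injI)
    show "ls_of_cyl x = ls_of_cyl y \<Longrightarrow> x = y" for x y by (cases x; cases y) auto
  qed
  have "g \<in> range ls_of_cyl" for g
    by (cases g) (metis ls_of_cyl.simps rangeI)+
  then show "surj ls_of_cyl" by auto
qed

lemma cyl_deg_eq: "cyl_deg = ls_deg \<circ> ls_of_cyl"
proof
  show "cyl_deg g = (ls_deg \<circ> ls_of_cyl) g" for g by (cases g) auto
qed

abbreviation to_cyl :: "(ls_gen, 'k::field) ncs \<Rightarrow> (cyl_gen, 'k) ncs" where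
  "to_cyl \<equiv> rename ls_of_cyl"

lemma to_cyl_gen: "to_cyl (gen Ga) = gen Gu" "to_cyl (gen Gb) = gen Gu'" "to_cyl (gen Gz) = gen Gsu"
  using rename_gen[OF bij_ls_of_cyl, of Gu] rename_gen[OF bij_ls_of_cyl, of Gu']
    rename_gen[OF bij_ls_of_cyl, of Gsu] by simp_all

lemma to_cyl_ad_series:
  fixes x :: "(ls_gen, 'k::field_char_0) ncs"
  shows "to_cyl (ad_series p (gen Gz) x) = ad_series p (gen Gsu) (to_cyl x)"
proof -
  have "to_cyl ((ad (gen Gz) ^^ i) x) = (ad (gen Gsu) ^^ i) (to_cyl x)" for i
    by (induction i) (simp_all add: ad_def rename_simps rename_mult to_cyl_gen)
  then show ?thesis
    unfolding ad_series_def
    by (subst cont_linear_formal_sum[OF cont_linear_rename])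
      (simp_all only: ad_series_terms_length[OF gen_length] rename_simps)
qed

lemma to_cyl_LS_values:
  "to_cyl (LS_values Ga) = - (gen Gu * gen Gu)"
  "to_cyl (LS_values Gb) = - (gen Gu' * gen Gu')"
  "to_cyl (LS_values Gz) = gen Gsu * gen Gu' - gen Gu' * gen Gsu +
     formal_sum (\<lambda>n. \<Sum>(p, q)\<in>{(p, q). p + q = n}.
         scal ((-1) ^ q * (bernoulli n / (fact p * fact q)))
           (gen Gsu ^ p * (gen Gu' - gen Gu) * gen Gsu ^ q))"
  unfolding bernoulli_ad_power ad_series_def[symmetric]
  by (simp_all add: rename_simps rename_mult to_cyl_gen to_cyl_ad_series ad_def[of "gen Gz"])

lemma cyl_diff_to_cyl:
  fixes x :: "(ls_gen, 'k::field_char_0) ncs"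
  shows "cyl_diff (to_cyl x) = to_cyl (LS_derivation x)"
proof -
  interpret series_model "complete_tensor cyl_deg" "to_cyl :: (ls_gen, 'k) ncs \<Rightarrow> _" ls_deg
    by (rule series_model_rename[OF bij_ls_of_cyl cyl_deg_eq])
  have gens: "transport LS_derivation (to_cyl (gen g)) = to_cyl (LS_values g)" for g
    by (simp add: transport_apply LS_derivation_gen)
  have eq: "cyl_diff = transport LS_derivation"
    unfolding cyl_diff_def
  proof (rule the_equality, goal_cases)
    case 1
    show ?case
      using continuous_derivation_transport[OF graded_derivation_LS]
      unfolding to_cyl_gen[symmetric] gens unfolding to_cyl_LS_values to_cyl_gen by simp
  next
    case (2 E)
    have "E (to_cyl (gen g)) = to_cyl (LS_values g)" for g
      using 2 by (cases g) (simp_all only: to_cyl_gen to_cyl_LS_values)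
    then show ?case
      using 2 by (intro transport_unique graded_derivation_LS) (simp_all add: LS_derivation_gen)
  qed
  show ?thesis
    unfolding eq by (rule transport_apply)
qed

theorem theorem3p3:
  shows "(\<forall>x :: (cyl_gen, 'k::field_char_0) ncs. cyl_diff (cyl_diff x) = 0) \<and>
    dga_isomorphic
      (dg_uea (LS_lie :: ('k, (ls_gen, 'k) ncs) graded_lie) LS_diff)
      (Cyl_T :: ('k, (cyl_gen, 'k) ncs) dg_algebra)"
proof
  interpret cyl: series_model "complete_tensor cyl_deg" "to_cyl :: (ls_gen, 'k) ncs \<Rightarrow> _" ls_deg
    by (rule series_model_rename[OF bij_ls_of_cyl cyl_deg_eq])
  show "\<forall>x :: (cyl_gen, 'k) ncs. cyl_diff (cyl_diff x) = 0"
  proof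
    fix x :: "(cyl_gen, 'k) ncs"
    have "x \<in> range to_cyl" using cyl.carrier_eq by (simp add: complete_tensor_def)
    then show "cyl_diff (cyl_diff x) = 0"
      by (auto simp: cyl_diff_to_cyl LS_derivation_square_zero rename_simps)
  qed
  have lie: "LS_derivation x \<in> lie_series ls_deg" if "x \<in> lie_series ls_deg" for x :: "(ls_gen, 'k) ncs"
  proof (rule graded_derivation_lie_series[OF graded_derivation_LS LS_derivation_length _ that])
    fix g
    show "LS_derivation (gen g) \<in> lie_series ls_deg"
      unfolding LS_derivation_gen by (rule LS_values_lie)
  qed
  show "dga_isomorphic (dg_uea (LS_lie :: ('k, (ls_gen, 'k) ncs) graded_lie) LS_diff)
      (Cyl_T :: ('k, (cyl_gen, 'k) ncs) dg_algebra)"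
    unfolding dg_uea_def Cyl_T_def
  proof (rule dga_isomorphic_series_models)
    show "series_model (with_diff (complete_uea LS_lie) (uea_diff LS_lie LS_diff))
        (uea_of_series ls_deg :: (ls_gen, 'k) ncs \<Rightarrow> _) ls_deg"
      unfolding LS_lie_def by (intro series_model_with_diff series_model_complete_uea)
    show "diff (with_diff (complete_uea LS_lie) (uea_diff LS_lie LS_diff)) (uea_of_series ls_deg x)
        = uea_of_series ls_deg (LS_derivation x)" for x :: "(ls_gen, 'k) ncs"
      by (simp add: with_diff_simps LS_lie_def LS_diff_eq uea_diff_eq[OF graded_derivation_LS lie])
    show "series_model (with_diff (complete_tensor cyl_deg) cyl_diff)
        (to_cyl :: (ls_gen, 'k) ncs \<Rightarrow> _) ls_deg"
      by (intro series_model_with_diff cyl.series_model_axioms)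
  qed (simp_all add: with_diff_simps cyl_diff_to_cyl graded_derivation_LS LS_derivation_square_zero)
qed

end
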